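(* Let $\mathbb F$ be an algebraically closed field and $A(s)\in\mathbb F[s]^{p\times q}$ a matrix pencil of rank $\rho$. For $\lambda\in\overline{\mathbb F}$ let $n_1(\lambda,A(s))\ge\dots\ge n_\rho(\lambda,A(s))\ge0$ be the partial multiplicities of $\lambda$ in $A(s)$, and let $c_1\ge\dots\ge c_{q-\rho}$ be the column minimal indices of $A(s)$. Let $(w^R_1(\lambda,A(s)),w^R_2(\lambda,A(s)),\dots)$ be the conjugate partition of $(n_1(\lambda,A(s)),\dots,n_\rho(\lambda,A(s)))$, let $(r_1,r_2,\dots)$ be the conjugate partition of $(c_1,\dots,c_{q-\rho})$ and $r_0=q-\rho$. Then for every $\lambda\in\overline{\mathbb F}$, $$w(\lambda,A(s))=(w^R_1(\lambda,A(s)),w^R_2(\lambda,A(s)),\dots)+(r_0,r_1,\dots),$$ i.e. $w_i(\lambda,A(s))=w^R_i(\lambda,A(s))+r_{i-1}$ for all $i\ge1$.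
   Context: A matrix pencil is $A(s)=A_0+sA_1$, $A_0,A_1\in\mathbb F^{p\times q}$; its rank $\rho$ is its rank over $\mathbb F(s)$; $A(\infty):=A_1$. Homogeneous invariant factors $\phi_1\mid\cdots\mid\phi_\rho$ are the invariant factors of $tA_0+sA_1$ over $\mathbb F[s,t]$. Partial multiplicities: for $\lambda\in\mathbb F$, $n_i(\lambda,A(s))$ is the exponent of $(s-\lambda t)$ in $\phi_{\rho-i+1}(s,t)$; $n_i(\infty,A(s))$ is the exponent of $t$ in $\phi_{\rho-i+1}(s,t)$. Column minimal indices: the $q-\rho$ indices $k$ (zeros included) of blocks $L_k(s)\in\mathbb F[s]^{k\times(k+1)}$ ($s$ on the diagonal, $1$ on the superdiagonal) in the Kronecker canonical form. Conjugate of a finite nonincreasing sequence $(a_1,\dots,a_m)$ of nonnegative integers: $(\bar a_1,\bar a_2,\dots)$, $\bar a_k=\#\{i:a_i\ge k\}$. Jordan chain at $\lambda$ of length $k+1$: vectors $(x_k,\dots,x_0)$ in $\mathbb F^q$ with $x_0\ne0$ and, for $\lambda\in\mathbb F$, $A(\lambda)x_0=0$, $A(\lambda)x_i=-A_1x_{i-1}$ ($1\le i\le k$); for $\lambda=\infty$, $A_1x_0=0$, $A_1x_i=-A_0x_{i-1}$. $\mathcal L^\ell_\lambda(A(s))$ is the span of all vectors in Jordan chains at $\lambda$ of length $\le\ell$, $\mathcal L^0_\lambda=\{0\}$, and $w_i(\lambda,A(s))=\dim(\mathcal L^i_\lambda(A(s))/\mathcal L^{i-1}_\lambda(A(s)))$,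 $i\ge1$; $w(\lambda,A(s))=(w_1(\lambda,A(s)),w_2(\lambda,A(s)),\dots)$. *)

theory Defs
  imports
    "Jordan_Normal_Form.Determinant"
    "Jordan_Normal_Form.DL_Rank"
    "Jordan_Normal_Form.DL_Submatrix"
    "HOL-Computational_Algebra.Polynomial_Factorial"
    "HOL-Computational_Algebra.Euclidean_Algorithm"
begin

text \<open>A pencil A(s) = A0 + s A1 with A0, A1 in F^(p x q) is represented by the pair of
  matrices (A0, A1), both in carrier_mat p q.\<close>

datatype 'a ext_pt = Fin 'a | Infty

definition pencil_poly :: "'a::comm_ring_1 mat \<Rightarrow> 'a mat \<Rightarrow> 'a poly mat" where
  "pencil_poly A0 A1 = mat (dim_row A0) (dim_col A0) (\<lambda>(i,j). [:A0 $$ (i,j), A1 $$ (i,j):])"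

definition pencil_rank :: "'a::field mat \<Rightarrow> 'a mat \<Rightarrow> nat" where
  "pencil_rank A0 A1 =
     vec_space.rank (dim_row A0) (map_mat to_fract (pencil_poly A0 A1) :: 'a poly fract mat)"

text \<open>The homogeneous pencil t A0 + s A1 as a matrix over F[s,t] = (F[t])[s]:
  the outer polynomial variable is s, the coefficients are polynomials in t.\<close>
definition hom_pencil :: "'a::comm_ring_1 mat \<Rightarrow> 'a mat \<Rightarrow> 'a poly poly mat" where
  "hom_pencil A0 A1 = mat (dim_row A0) (dim_col A0)
      (\<lambda>(i,j). [: [:0, A0 $$ (i,j):], [:A1 $$ (i,j):] :])"

definition var_t :: "'a::comm_ring_1 poly poly" where
  "var_t = [: [:0, 1:] :]"

definition lin_form :: "'a::comm_ring_1 \<Rightarrow> 'a poly poly" where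
  "lin_form lam = [: [:0, - lam:], [:1:] :]"

definition minors :: "'b::comm_ring_1 mat \<Rightarrow> nat \<Rightarrow> 'b set" where
  "minors M k = {det (submatrix M I J) | I J.
      I \<subseteq> {..<dim_row M} \<and> J \<subseteq> {..<dim_col M} \<and> card I = k \<and> card J = k}"

definition det_divisor :: "'b::{comm_ring_1, semiring_Gcd} mat \<Rightarrow> nat \<Rightarrow> 'b" where
  "det_divisor M k = Gcd (minors M k)"

definition invariant_factor :: "'b::{comm_ring_1, semiring_Gcd} mat \<Rightarrow> nat \<Rightarrow> 'b" where
  "invariant_factor M k = det_divisor M k div det_divisor M (k - 1)"

text \<open>Homogeneous invariant factors phi_1 | ... | phi_rho of the pencil (k = 1..rho).\<close>
definition hom_inv_factor :: "'a::field_gcd mat \<Rightarrow> 'a mat \<Rightarrow> nat \<Rightarrow> 'a poly poly" where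
  "hom_inv_factor A0 A1 k = invariant_factor (hom_pencil A0 A1) k"

definition part_mult :: "'a::field_gcd mat \<Rightarrow> 'a mat \<Rightarrow> 'a ext_pt \<Rightarrow> nat \<Rightarrow> nat" where
  "part_mult A0 A1 \<mu> i =
     (let \<rho> = pencil_rank A0 A1; \<phi> = hom_inv_factor A0 A1 (\<rho> - i + 1) in
      case \<mu> of Fin lam \<Rightarrow> multiplicity (lin_form lam) \<phi>
              | Infty \<Rightarrow> multiplicity var_t \<phi>)"

definition wR :: "'a::field_gcd mat \<Rightarrow> 'a mat \<Rightarrow> 'a ext_pt \<Rightarrow> nat \<Rightarrow> nat" where
  "wR A0 A1 \<mu> k = card {i \<in> {1..pencil_rank A0 A1}. part_mult A0 A1 \<mu> i \<ge> k}"

text \<open>Jordan chains (x_k, ..., x_0) at mu, of length k+1, given by x :: nat => 'a vec.\<close>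
definition jordan_chain :: "'a::field mat \<Rightarrow> 'a mat \<Rightarrow> 'a ext_pt \<Rightarrow> (nat \<Rightarrow> 'a vec) \<Rightarrow> nat \<Rightarrow> bool" where
  "jordan_chain A0 A1 \<mu> x k \<longleftrightarrow>
     (\<forall>i\<le>k. x i \<in> carrier_vec (dim_col A0)) \<and> x 0 \<noteq> 0\<^sub>v (dim_col A0) \<and>
     (case \<mu> of
        Fin lam \<Rightarrow> (A0 + lam \<cdot>\<^sub>m A1) *\<^sub>v x 0 = 0\<^sub>v (dim_row A0) \<and>
                 (\<forall>i\<in>{1..k}. (A0 + lam \<cdot>\<^sub>m A1) *\<^sub>v x i = - (A1 *\<^sub>v x (i - 1)))
      | Infty \<Rightarrow> A1 *\<^sub>v x 0 = 0\<^sub>v (dim_row A0) \<and>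
                 (\<forall>i\<in>{1..k}. A1 *\<^sub>v x i = - (A0 *\<^sub>v x (i - 1))))"

definition chain_space :: "'a::field mat \<Rightarrow> 'a mat \<Rightarrow> 'a ext_pt \<Rightarrow> nat \<Rightarrow> 'a vec set" where
  "chain_space A0 A1 \<mu> l =
     (if l = 0 then {0\<^sub>v (dim_col A0)}
      else LinearCombinations.module.span class_ring (module_vec TYPE('a) (dim_col A0))
             {x i | x k i. jordan_chain A0 A1 \<mu> x k \<and> k + 1 \<le> l \<and> i \<le> k})"

definition subspace_dim :: "'a::field itself \<Rightarrow> nat \<Rightarrow> 'a vec set \<Rightarrow> nat" where
  "subspace_dim ty q W = vectorspace.dim class_ring ((module_vec ty q)\<lparr>carrier := W\<rparr>)"

text \<open>w_i(mu, A(s)) = dim (L^i / L^(i-1)) = dim L^i - dim L^(i-1) (as L^(i-1) is a subspace of L^i).\<close>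
definition w :: "'a::field mat \<Rightarrow> 'a mat \<Rightarrow> 'a ext_pt \<Rightarrow> nat \<Rightarrow> nat" where
  "w A0 A1 \<mu> i =
     subspace_dim TYPE('a) (dim_col A0) (chain_space A0 A1 \<mu> i)
     - subspace_dim TYPE('a) (dim_col A0) (chain_space A0 A1 \<mu> (i - 1))"

text \<open>Kronecker canonical form blocks: L_k, L_k^T, Jordan blocks at finite eigenvalues,
  and blocks at infinity. Each block is a pencil (B0, B1).\<close>
datatype 'a kblock = Lblk nat | LTblk nat | Jblk 'a nat | Nblk nat

text \<open>L_k(s) in F[s]^(k x (k+1)): s on the diagonal, 1 on the superdiagonal.\<close>
definition L0 :: "nat \<Rightarrow> 'a::{zero,one} mat" where
  "L0 k = mat k (k+1) (\<lambda>(i,j). if j = i + 1 then 1 else 0)"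
definition L1 :: "nat \<Rightarrow> 'a::{zero,one} mat" where
  "L1 k = mat k (k+1) (\<lambda>(i,j). if j = i then 1 else 0)"

definition shift_mat :: "nat \<Rightarrow> 'a::{zero,one} mat" where
  "shift_mat k = mat k k (\<lambda>(i,j). if j = i + 1 then 1 else 0)"

fun kblock0 :: "'a::comm_ring_1 kblock \<Rightarrow> 'a mat" where
  "kblock0 (Lblk k) = L0 k"
| "kblock0 (LTblk k) = transpose_mat (L0 k)"
| "kblock0 (Jblk lam k) = shift_mat k - lam \<cdot>\<^sub>m 1\<^sub>m k"
| "kblock0 (Nblk k) = 1\<^sub>m k"

fun kblock1 :: "'a::comm_ring_1 kblock \<Rightarrow> 'a mat" where
  "kblock1 (Lblk k) = L1 k"
| "kblock1 (LTblk k) = transpose_mat (L1 k)"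
| "kblock1 (Jblk lam k) = 1\<^sub>m k"
| "kblock1 (Nblk k) = shift_mat k"

fun kblock_ok :: "'a kblock \<Rightarrow> bool" where
  "kblock_ok (Jblk lam k) = (k \<ge> 1)"
| "kblock_ok (Nblk k) = (k \<ge> 1)"
| "kblock_ok _ = True"

definition is_KCF :: "'a::field mat \<Rightarrow> 'a mat \<Rightarrow> 'a kblock list \<Rightarrow> bool" where
  "is_KCF A0 A1 bs \<longleftrightarrow> (\<forall>b\<in>set bs. kblock_ok b) \<and>
     (\<exists>P Q. P \<in> carrier_mat (dim_row A0) (dim_row A0) \<and> invertible_mat P \<and>
            Q \<in> carrier_mat (dim_col A0) (dim_col A0) \<and> invertible_mat Q \<and>
            P * A0 * Q = diag_block_mat (map kblock0 bs) \<and>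
            P * A1 * Q = diag_block_mat (map kblock1 bs))"

definition col_min_indices :: "'a kblock list \<Rightarrow> nat list" where
  "col_min_indices bs = [k. Lblk k \<leftarrow> bs]"

end

theory Submission
  imports Defs
begin

text \<open>At a point \<mu> write the pencil as u M + \<pi> N, where \<pi> is the linear form vanishing at \<mu> (s - lam t
  or t), M is the value of the pencil at \<mu> and u is a form prime to \<pi>. The space spanned by the
  Jordan chains of length at most l is then K l, where K 0 = 0 and K (l + 1) is the preimage of N (K l) under M.
  The dimensions of the spaces K l are invariant under strict equivalence and additive over
  direct sums. The same holds for the number of diagonal entries divisible by \<pi>^k in a Smith form
  over the local ring at \<pi>; these entries are read off the minors, hence they are the partial multiplicities.
  So both sides of the claim can be computed block by block on the Kronecker form. After a change of
  basis a block is either L_k, its transpose, a nilpotent Jordan block, or has M invertible; a block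
  L_k contributes min l (k + 1) to dim (K l) and nothing to the multiplicities, a nilpotent block of
  size k contributes min l k and one multiplicity k, and the others contribute nothing.\<close>

section \<open>Subspaces of a given dimension\<close>

text \<open>The multiplicities are defined by gcds of minors over F[s,t], which is not a principal
  ideal domain, so a Smith form with unimodular transformations need not exist there. Only the
  exponent of one prime is asked for at a time, and after localising at \<pi> a diagonal form
  exists. Instead of constructing the local ring, denominators are cleared: a transformation needs
  an inverse only up to a scalar prime to \<pi>, and such a transformation does not affect
  divisibility of minors by powers of \<pi>. A block L_k has no eigenvalue, and translating its
  parameter is a strict equivalence; hence it looks the same at every point. Its contribution min l
  (k + 1) grows at step i exactly when i - 1 \<le> k, one step longer than for a nilpotent block of
  size k. This is the source of the shifted index in r_(i-1), and r_0 counts all the L_k, k = 0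
  included. The rank over F(s) comes from the same forms: it is the number of nonzero entries of a
  local Smith form at any single prime.\<close>

text \<open>The columns of \<open>B\<close> are a basis of \<open>W\<close>, so one predicate
  carries both that \<open>W\<close> is a subspace and its dimension; images and direct sums then
  reduce to products and block sums of the matrices \<open>B\<close>.\<close>

definition has_dim :: "nat \<Rightarrow> 'a::field vec set \<Rightarrow> nat \<Rightarrow> bool" where
  "has_dim q W d \<longleftrightarrow> (\<exists>B \<in> carrier_mat q d. W = (\<lambda>c. B *\<^sub>v c) ` carrier_vec d \<and>
     (\<forall>c \<in> carrier_vec d. B *\<^sub>v c = 0\<^sub>v q \<longrightarrow> c = 0\<^sub>v d))"

lemma (in vec_space) span_cols_eq_image:
  assumes "A \<in> carrier_mat n m"
  shows "span (set (cols A)) = (\<lambda>c. A *\<^sub>v c) ` carrier_vec m"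
  using col_space_eq[OF assms] assms unfolding col_space_def by auto

text \<open>A dependence among the columns of \<open>B\<close> is a nonzero kernel vector, so
  injectivity makes the columns a basis. The second part is how \<open>has_dim\<close> certifies
  closure under linear combinations.\<close>

lemma has_dim_imp:
  fixes W :: "'a::field vec set"
  assumes "has_dim q W d"
  shows "subspace_dim TYPE('a) q W = d"
    and "LinearCombinations.module.span class_ring (module_vec TYPE('a) q) W = W"
proof -
  interpret vec_space "TYPE('a)" q .
  obtain B where B: "B \<in> carrier_mat q d" and W: "W = (\<lambda>c. B *\<^sub>v c) ` carrier_vec d"
    and inj: "\<And>c. c \<in> carrier_vec d \<Longrightarrow> B *\<^sub>v c = 0\<^sub>v q \<Longrightarrow> c = 0\<^sub>v d"
    using assms unfolding has_dim_def by blast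
  have eq: "span (set (cols B)) = W" using span_cols_eq_image[OF B] W by simp
  have cs: "set (cols B) \<subseteq> carrier_vec q" using B cols_dim by blast
  show "span W = W" using eq cs by (metis span_span)
  have dist: "distinct (cols B)"
    unfolding distinct_conv_nth
  proof (intro allI impI)
    fix i j assume ij: "i < length (cols B)" "j < length (cols B)" "i \<noteq> j"
    \<comment> \<open>If columns \<open>i\<close> and \<open>j\<close> were equal, this nonzero
      vector would lie in the kernel of \<open>B\<close>. Distinctness matters because independence
      is stated for the set of columns.\<close>
    let ?c = "unit_vec d i - unit_vec d j :: 'a vec"
    have i: "i < d" "j < d" using ij B by auto
    show "cols B ! i \<noteq> cols B ! j"
    proof
      assume "cols B ! i = cols B ! j"
      hence "col B i = col B j" using ij by simp
      hence "B $$ (k, i) = B $$ (k, j)" if "k < q" for k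
        using that B i by (metis carrier_matD index_col)
      hence "B *\<^sub>v ?c = 0\<^sub>v q" using B i
        by (intro eq_vecI) (auto simp: scalar_prod_minus_distrib[of _ d])
      hence "?c = 0\<^sub>v d" by (intro inj) auto
      hence "?c $ i = 0" using i by simp
      thus False using ij i by simp
    qed
  qed
  have li: "lin_indpt (set (cols B))"
  proof
    assume "lin_dep (set (cols B))"
    from lin_depE[OF B this dist] inj show False by metis
  qed
  have "rank B = d" by (rule lin_indpt_full_rank[OF B dist li])
  thus "subspace_dim TYPE('a) q W = d" unfolding rank_def eq subspace_dim_def .
qed

lemma rank_has_dim:
  fixes A :: "'a::field mat"
  assumes "A \<in> carrier_mat p q" "has_dim p ((\<lambda>c. A *\<^sub>v c) ` carrier_vec q) d"
  shows "vec_space.rank p A = d"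
proof -
  interpret vec_space "TYPE('a)" p .
  show ?thesis using has_dim_imp(1)[OF assms(2)] span_cols_eq_image[OF assms(1)]
    unfolding rank_def subspace_dim_def by simp
qed

lemma has_dim_mult:
  fixes W :: "'a::field vec set"
  assumes W: "has_dim q W d" and P: "P \<in> carrier_mat q' q"
    and inj: "\<And>x. x \<in> carrier_vec q \<Longrightarrow> P *\<^sub>v x = 0\<^sub>v q' \<Longrightarrow> x = 0\<^sub>v q"
  shows "has_dim q' ((\<lambda>x. P *\<^sub>v x) ` W) d"
proof -
  obtain B where B: "B \<in> carrier_mat q d" and W: "W = (\<lambda>c. B *\<^sub>v c) ` carrier_vec d"
    and injB: "\<And>c. c \<in> carrier_vec d \<Longrightarrow> B *\<^sub>v c = 0\<^sub>v q \<Longrightarrow> c = 0\<^sub>v d"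
    using assms unfolding has_dim_def by blast
  have e: "(P * B) *\<^sub>v c = P *\<^sub>v (B *\<^sub>v c)" if "c \<in> carrier_vec d" for c
    using assoc_mult_mat_vec[OF P B that] .
  show ?thesis unfolding has_dim_def
  proof (intro bexI[of _ "P * B"] conjI ballI impI)
    show "P * B \<in> carrier_mat q' d" using P B by simp
    show "(\<lambda>x. P *\<^sub>v x) ` W = (\<lambda>c. (P * B) *\<^sub>v c) ` carrier_vec d"
      unfolding W image_image by (rule image_cong) (auto simp: e)
    fix c assume c: "c \<in> carrier_vec d" "(P * B) *\<^sub>v c = 0\<^sub>v q'"
    have "B *\<^sub>v c = 0\<^sub>v q" using c e[of c] B by (intro inj) auto
    thus "c = 0\<^sub>v d" using injB c by blast
  qed
qed

lemma vec_append_cases: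
  assumes "x \<in> carrier_vec (m + n)"
  obtains a b where "a \<in> carrier_vec m" "b \<in> carrier_vec n" "x = a @\<^sub>v b"
  using assms by (metis vec_first_last_append vec_first_carrier vec_last_carrier)

lemma diag_block_mult_vec:
  fixes A1 :: "'a::comm_ring_1 mat"
  assumes "A1 \<in> carrier_mat p1 q1" "A2 \<in> carrier_mat p2 q2"
    "a \<in> carrier_vec q1" "b \<in> carrier_vec q2"
  shows "four_block_mat A1 (0\<^sub>m p1 q2) (0\<^sub>m p2 q1) A2 *\<^sub>v (a @\<^sub>v b) = (A1 *\<^sub>v a) @\<^sub>v (A2 *\<^sub>v b)"
proof -
  have "0\<^sub>m p1 q2 *\<^sub>v b = 0\<^sub>v p1" "0\<^sub>m p2 q1 *\<^sub>v a = 0\<^sub>v p2" using assms by auto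
  thus ?thesis
    using four_block_mat_mult_vec[OF assms(1) _ _ assms(2,3,4), of "0\<^sub>m p1 q2" "0\<^sub>m p2 q1"] assms by simp
qed

lemma append_vec_eq_zero:
  "a \<in> carrier_vec m \<Longrightarrow> b \<in> carrier_vec n \<Longrightarrow> a @\<^sub>v b = 0\<^sub>v (m + n) \<longleftrightarrow> a = 0\<^sub>v m \<and> b = 0\<^sub>v n"
proof -
  assume a: "a \<in> carrier_vec m" "b \<in> carrier_vec n"
  have "0\<^sub>v (m + n) = 0\<^sub>v m @\<^sub>v 0\<^sub>v n" by (rule eq_vecI) auto
  show ?thesis unfolding \<open>0\<^sub>v (m + n) = 0\<^sub>v m @\<^sub>v 0\<^sub>v n\<close> using append_vec_eq[OF a(1), of "0\<^sub>v m" b "0\<^sub>v n"] by simp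
qed

lemma has_dim_append:
  fixes W1 :: "'a::field vec set"
  assumes "has_dim q1 W1 d1" "has_dim q2 W2 d2"
  shows "has_dim (q1 + q2) {x @\<^sub>v y | x y. x \<in> W1 \<and> y \<in> W2} (d1 + d2)"
proof -
  obtain B1 where B1: "B1 \<in> carrier_mat q1 d1" and W1: "W1 = (\<lambda>c. B1 *\<^sub>v c) ` carrier_vec d1"
    and inj1: "\<And>c. c \<in> carrier_vec d1 \<Longrightarrow> B1 *\<^sub>v c = 0\<^sub>v q1 \<Longrightarrow> c = 0\<^sub>v d1"
    using assms unfolding has_dim_def by blast
  obtain B2 where B2: "B2 \<in> carrier_mat q2 d2" and W2: "W2 = (\<lambda>c. B2 *\<^sub>v c) ` carrier_vec d2"
    and inj2: "\<And>c. c \<in> carrier_vec d2 \<Longrightarrow> B2 *\<^sub>v c = 0\<^sub>v q2 \<Longrightarrow> c = 0\<^sub>v d2"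
    using assms unfolding has_dim_def by blast
  let ?B = "four_block_mat B1 (0\<^sub>m q1 d2) (0\<^sub>m q2 d1) B2"
  note e = diag_block_mult_vec[OF B1 B2]
  show ?thesis unfolding has_dim_def
  proof (intro bexI[of _ ?B] conjI ballI impI)
    show "?B \<in> carrier_mat (q1 + q2) (d1 + d2)" using B1 B2 by simp
    show "{x @\<^sub>v y | x y. x \<in> W1 \<and> y \<in> W2} = (\<lambda>c. ?B *\<^sub>v c) ` carrier_vec (d1 + d2)" (is "?L = ?R")
    proof
      show "?L \<subseteq> ?R"
      proof
        fix z assume "z \<in> ?L"
        then obtain a b where "a \<in> carrier_vec d1" "b \<in> carrier_vec d2" "z = (B1 *\<^sub>v a) @\<^sub>v (B2 *\<^sub>v b)"
          unfolding W1 W2 by auto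
        thus "z \<in> ?R" using e by (intro image_eqI[of _ _ "a @\<^sub>v b"]) auto
      qed
      show "?R \<subseteq> ?L"
      proof
        fix z assume "z \<in> ?R"
        then obtain c where c: "c \<in> carrier_vec (d1 + d2)" "z = ?B *\<^sub>v c" by auto
        from vec_append_cases[OF c(1)] obtain a b
          where "a \<in> carrier_vec d1" "b \<in> carrier_vec d2" "c = a @\<^sub>v b" by blast
        thus "z \<in> ?L" using c(2) e unfolding W1 W2 by auto
      qed
    qed
    fix c assume c: "c \<in> carrier_vec (d1 + d2)" "?B *\<^sub>v c = 0\<^sub>v (q1 + q2)"
    from vec_append_cases[OF c(1)] obtain a b
      where ab: "a \<in> carrier_vec d1" "b \<in> carrier_vec d2" "c = a @\<^sub>v b" by blast
    have "(B1 *\<^sub>v a) @\<^sub>v (B2 *\<^sub>v b) = 0\<^sub>v (q1 + q2)" using c(2) ab e by simp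
    hence "B1 *\<^sub>v a = 0\<^sub>v q1" "B2 *\<^sub>v b = 0\<^sub>v q2"
      using append_vec_eq_zero[of "B1 *\<^sub>v a" q1 "B2 *\<^sub>v b" q2] B1 B2 ab by auto
    thus "c = 0\<^sub>v (d1 + d2)" using inj1 inj2 ab append_vec_eq_zero by blast
  qed
qed

text \<open>These coordinate subspaces will be the root spaces of the L_k and of the nilpotent
  blocks.\<close>

lemma has_dim_initial_segment:
  "has_dim n {x \<in> carrier_vec n. \<forall>i<n. l \<le> i \<longrightarrow> x $ i = (0 :: 'a::field)} (min l n)"
proof -
  let ?d = "min l n"
  let ?B = "mat n ?d (\<lambda>(i,j). if i = j then 1 else 0) :: 'a mat"
  have e: "(?B *\<^sub>v c) $ i = (if i < ?d then c $ i else 0)" if "c \<in> carrier_vec ?d" "i < n" for c i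
  proof -
    have "(?B *\<^sub>v c) $ i = (\<Sum>j<?d. (if i = j then 1 else 0) * c $ j)"
      using that by (auto simp: scalar_prod_def atLeast0LessThan intro!: sum.cong)
    also have "\<dots> = (\<Sum>j<?d. if i = j then c $ j else 0)" by (intro sum.cong) auto
    finally show ?thesis by simp
  qed
  show ?thesis unfolding has_dim_def
  proof (intro bexI[of _ ?B] conjI ballI impI)
    show "{x \<in> carrier_vec n. \<forall>i<n. l \<le> i \<longrightarrow> x $ i = 0} = (\<lambda>c. ?B *\<^sub>v c) ` carrier_vec ?d" (is "?L = ?R")
    proof
      show "?L \<subseteq> ?R"
      proof
        fix x assume x: "x \<in> ?L"
        have "x = ?B *\<^sub>v vec ?d (\<lambda>i. x $ i)"
          by (rule eq_vecI) (use x e[of "vec ?d (\<lambda>i. x $ i)"] in auto)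
        thus "x \<in> ?R" by (rule image_eqI) auto
      qed
      show "?R \<subseteq> ?L" using e by (auto intro!: carrier_vecI)
    qed
    fix c assume c: "c \<in> carrier_vec ?d" "?B *\<^sub>v c = 0\<^sub>v n"
    show "c = 0\<^sub>v ?d"
    proof (rule eq_vecI)
      fix i assume "i < dim_vec (0\<^sub>v ?d :: 'a vec)"
      thus "c $ i = 0\<^sub>v ?d $ i" using e[OF c(1), of i] c by auto
    qed (use c in auto)
  qed auto
qed

lemma has_dim_zero: "has_dim n {0\<^sub>v n :: 'a::field vec} 0"
proof -
  have "{x \<in> carrier_vec n. \<forall>i<n. 0 \<le> i \<longrightarrow> x $ i = (0 :: 'a)} = {0\<^sub>v n}" by auto
  thus ?thesis using has_dim_initial_segment[where ?'a='a, of n 0] by simp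
qed

section \<open>Spaces spanned by Jordan chains\<close>

text \<open>The minus sign in the definition of a Jordan chain is immaterial here, as every
  member of the recursion is closed under negation.\<close>

primrec root_space :: "'a::field mat \<Rightarrow> 'a mat \<Rightarrow> nat \<Rightarrow> 'a vec set" where
  "root_space M N 0 = {0\<^sub>v (dim_col M)}"
| "root_space M N (Suc l) = {x \<in> carrier_vec (dim_col M). \<exists>y \<in> root_space M N l. M *\<^sub>v x = N *\<^sub>v y}"

lemma mult_mat_vec_zero [simp]: "A \<in> carrier_mat p q \<Longrightarrow> A *\<^sub>v 0\<^sub>v q = (0\<^sub>v p :: 'a::comm_ring_1 vec)"
  by (auto intro!: eq_vecI)

lemma root_space_carrier: "root_space M N l \<subseteq> carrier_vec (dim_col M)"
  by (cases l) auto

lemma zero_in_root_space: "dim_row M = dim_row N \<Longrightarrow> dim_col M = dim_col N \<Longrightarrow> 0\<^sub>v (dim_col M) \<in> root_space M N l"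
proof (induction l)
  case (Suc l)
  have "M *\<^sub>v 0\<^sub>v (dim_col M) = 0\<^sub>v (dim_row M)" "N *\<^sub>v 0\<^sub>v (dim_col N) = 0\<^sub>v (dim_row N)"
    by (simp_all add: mult_mat_vec_def scalar_prod_def zero_vec_def)
  thus ?case using Suc by (auto intro!: bexI[of _ "0\<^sub>v (dim_col N)"])
qed auto

lemma uminus_in_root_space:
  assumes "dim_row M = dim_row N" "dim_col M = dim_col N" "x \<in> root_space M N l"
  shows "- x \<in> root_space M N l"
  using assms(3)
proof (induction l arbitrary: x)
  case (Suc l)
  then obtain y where y: "x \<in> carrier_vec (dim_col M)" "y \<in> root_space M N l" "M *\<^sub>v x = N *\<^sub>v y" by auto
  have yc: "y \<in> carrier_vec (dim_col N)" using subsetD[OF root_space_carrier y(2)] assms by simp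
  have "M *\<^sub>v (- x) = - (M *\<^sub>v x)" "N *\<^sub>v (- y) = - (N *\<^sub>v y)"
    using y(1) yc by (auto intro!: eq_vecI simp: scalar_prod_uminus_right)
  thus ?case using y Suc.IH[of y] by (auto intro!: bexI[of _ "- y"])
qed auto

section \<open>Invertible matrices and strict equivalence of matrix pairs\<close>

definition mutual_inverse :: "nat \<Rightarrow> 'a::semiring_1 mat \<Rightarrow> 'a mat \<Rightarrow> bool" where
  "mutual_inverse n P P' \<longleftrightarrow> P \<in> carrier_mat n n \<and> P' \<in> carrier_mat n n \<and> P * P' = 1\<^sub>m n \<and> P' * P = 1\<^sub>m n"

lemma mutual_inverse_sym: "mutual_inverse n P P' \<Longrightarrow> mutual_inverse n P' P"
  unfolding mutual_inverse_def by auto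

lemma mutual_inverse_vec:
  assumes "mutual_inverse n P P'" "x \<in> carrier_vec n"
  shows "P *\<^sub>v (P' *\<^sub>v x) = x"
  using assms unfolding mutual_inverse_def by (metis assoc_mult_mat_vec one_mult_mat_vec)

lemma mutual_inverse_inj:
  fixes P :: "'a::comm_ring_1 mat"
  assumes "mutual_inverse n P P'" "x \<in> carrier_vec n" "y \<in> carrier_vec n" "P *\<^sub>v x = P *\<^sub>v y"
  shows "x = y"
  using assms mutual_inverse_vec[OF mutual_inverse_sym] by metis

lemma invertible_mat_mutual_inverse:
  assumes "P \<in> carrier_mat n n" "invertible_mat P"
  obtains P' where "mutual_inverse n P P'"
proof -
  obtain B where B: "P * B = 1\<^sub>m (dim_row P)" "B * P = 1\<^sub>m (dim_row B)"
    using assms(2) unfolding invertible_mat_def inverts_mat_def by blast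
  \<comment> \<open>\<open>invertible_mat\<close> does not fix the format of \<open>B\<close>: its
    columns are read off \<open>P * B\<close>, its rows off \<open>B * P\<close>.\<close>
  have "dim_col B = n" using B(1) assms(1) by (metis carrier_matD(1) index_mult_mat(3) index_one_mat(3))
  moreover have "dim_row B = n" using B(2) assms(1) by (metis carrier_matD(2) index_mult_mat(3) index_one_mat(3))
  ultimately have "mutual_inverse n P B" unfolding mutual_inverse_def using B assms(1) by auto
  thus thesis by (rule that)
qed

lemma mutual_inverse_transpose:
  fixes P :: "'a::comm_ring_1 mat"
  assumes "mutual_inverse n P P'"
  shows "mutual_inverse n P\<^sup>T P'\<^sup>T"
  using assms unfolding mutual_inverse_def by (metis transpose_carrier_mat transpose_mult transpose_one)

lemma det_nonzero_mutual_inverse: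
  fixes P :: "'a::field mat"
  assumes "P \<in> carrier_mat n n" "det P \<noteq> 0"
  obtains P' where "mutual_inverse n P P'"
proof -
  have "P \<in> Units (ring_mat TYPE('a) n ())" by (rule det_non_zero_imp_unit[OF assms])
  then obtain P' where "P' \<in> carrier_mat n n" "P' * P = 1\<^sub>m n" "P * P' = 1\<^sub>m n"
    unfolding Units_def ring_mat_def by auto
  thus thesis using that assms(1) unfolding mutual_inverse_def by blast
qed

definition strict_equiv ::
  "nat \<Rightarrow> nat \<Rightarrow> 'a::field mat \<Rightarrow> 'a mat \<Rightarrow> 'a mat \<Rightarrow> 'a mat \<Rightarrow> bool" where
  "strict_equiv p q M N M' N' \<longleftrightarrow> M \<in> carrier_mat p q \<and> N \<in> carrier_mat p q \<and>
     (\<exists>P P' Q Q'. mutual_inverse p P P' \<and> mutual_inverse q Q Q' \<and> M' = P * M * Q \<and> N' = P * N * Q)"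

lemma strict_equiv_carrier:
  assumes "strict_equiv p q M N M' N'"
  shows "M \<in> carrier_mat p q" "N \<in> carrier_mat p q" "M' \<in> carrier_mat p q" "N' \<in> carrier_mat p q"
  using assms unfolding strict_equiv_def mutual_inverse_def by auto

lemma mutual_inverse_cancel:
  fixes P :: "'a::comm_ring_1 mat"
  assumes "mutual_inverse p P P'" "mutual_inverse q Q Q'" "M \<in> carrier_mat p q"
  shows "P' * (P * M * Q) * Q' = M"
proof -
  have c: "P \<in> carrier_mat p p" "P' \<in> carrier_mat p p" "Q \<in> carrier_mat q q" "Q' \<in> carrier_mat q q"
    "P' * P = 1\<^sub>m p" "Q * Q' = 1\<^sub>m q"
    using assms unfolding mutual_inverse_def by auto
  have "P' * (P * M * Q) * Q' = P' * (P * M * Q * Q')" using c assms(3) by (intro assoc_mult_mat) auto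
  also have "P * M * Q * Q' = P * M * (Q * Q')" using c assms(3) by (intro assoc_mult_mat) auto
  also have "\<dots> = P * M" using c assms(3) by simp
  also have "P' * (P * M) = P' * P * M" using c assms(3) by (intro assoc_mult_mat[symmetric]) auto
  finally show ?thesis using c assms(3) by simp
qed

lemma strict_equiv_sym:
  assumes "strict_equiv p q M N M' N'"
  shows "strict_equiv p q M' N' M N"
proof -
  obtain P P' Q Q' where *: "mutual_inverse p P P'" "mutual_inverse q Q Q'" "M' = P * M * Q" "N' = P * N * Q"
    using assms unfolding strict_equiv_def by blast
  note c = strict_equiv_carrier[OF assms]
  show ?thesis unfolding strict_equiv_def
    using c * mutual_inverse_sym mutual_inverse_cancel[OF *(1,2)] by metis
qed

lemma strict_equiv_transpose:
  assumes "strict_equiv p q M N M' N'"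
  shows "strict_equiv q p M\<^sup>T N\<^sup>T M'\<^sup>T N'\<^sup>T"
proof -
  obtain P P' Q Q' where *: "mutual_inverse p P P'" "mutual_inverse q Q Q'" "M' = P * M * Q" "N' = P * N * Q"
    using assms unfolding strict_equiv_def by blast
  note c = strict_equiv_carrier[OF assms]
  have t: "(P * X * Q)\<^sup>T = Q\<^sup>T * X\<^sup>T * P\<^sup>T" if "X \<in> carrier_mat p q" for X
  proof -
    have pc: "P \<in> carrier_mat p p" "Q \<in> carrier_mat q q" using * unfolding mutual_inverse_def by auto
    have "(P * X * Q)\<^sup>T = Q\<^sup>T * (X\<^sup>T * P\<^sup>T)"
      using that pc by (simp add: transpose_mult[of _ p q _ q] transpose_mult[of _ p p _ q])
    thus ?thesis using that pc by (simp add: assoc_mult_mat[of _ q q _ p _ p])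
  qed
  show ?thesis unfolding strict_equiv_def
    using c * mutual_inverse_transpose t by (metis transpose_carrier_mat)
qed

section \<open>Invariance and additivity of the dimensions\<close>

definition root_dims :: "'a::field mat \<Rightarrow> 'a mat \<Rightarrow> (nat \<Rightarrow> nat) \<Rightarrow> bool" where
  "root_dims M N f \<longleftrightarrow> dim_row M = dim_row N \<and> dim_col M = dim_col N \<and>
     (\<forall>l. has_dim (dim_col M) (root_space M N l) (f l))"

text \<open>By induction on \<open>l\<close>, \<open>x\<close> lies in the new space iff
  \<open>Q *\<^sub>v x\<close> lies in the old one; \<open>P\<close> cancels from both sides of the
  recursion. Hence the injective map \<open>Q'\<close> carries the old spaces onto the new
  ones.\<close>

lemma root_dims_strict_equiv:
  assumes "strict_equiv p q M N M' N'" "root_dims M N f"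
  shows "root_dims M' N' f"
proof -
  obtain P P' Q Q' where *: "mutual_inverse p P P'" "mutual_inverse q Q Q'" "M' = P * M * Q" "N' = P * N * Q"
    using assms(1) unfolding strict_equiv_def by blast
  note c = strict_equiv_carrier[OF assms(1)]
  have Pc: "P \<in> carrier_mat p p" and Qc: "Q \<in> carrier_mat q q" "Q' \<in> carrier_mat q q"
    using * unfolding mutual_inverse_def by auto
  have e: "(P * X * Q) *\<^sub>v x = P *\<^sub>v (X *\<^sub>v (Q *\<^sub>v x))" if "X \<in> carrier_mat p q" "x \<in> carrier_vec q" for X x
  proof -
    have "(P * X * Q) *\<^sub>v x = (P * X) *\<^sub>v (Q *\<^sub>v x)" using that Pc Qc by (intro assoc_mult_mat_vec) auto
    also have "\<dots> = P *\<^sub>v (X *\<^sub>v (Q *\<^sub>v x))" using that Pc Qc by (intro assoc_mult_mat_vec) auto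
    finally show ?thesis .
  qed
  have QQ': "Q *\<^sub>v (Q' *\<^sub>v x) = x" "Q' *\<^sub>v (Q *\<^sub>v x) = x" if "x \<in> carrier_vec q" for x
    using that * mutual_inverse_vec mutual_inverse_sym by metis+
  have iff: "x \<in> root_space M' N' l \<longleftrightarrow> x \<in> carrier_vec q \<and> Q *\<^sub>v x \<in> root_space M N l" for l x
  proof (induction l arbitrary: x)
    case 0
    have "x \<in> carrier_vec q \<and> Q *\<^sub>v x = 0\<^sub>v q \<longleftrightarrow> x = 0\<^sub>v q" for x
    proof
      assume "x \<in> carrier_vec q \<and> Q *\<^sub>v x = 0\<^sub>v q"
      thus "x = 0\<^sub>v q" using QQ'(2)[of x] mult_mat_vec_zero[OF Qc(2)] by simp
    qed (use Qc in auto)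
    thus ?case using c by simp
  next
    case (Suc l)
    show ?case
    proof
      assume "x \<in> root_space M' N' (Suc l)"
      then obtain y where y: "x \<in> carrier_vec q" "y \<in> carrier_vec q" "Q *\<^sub>v y \<in> root_space M N l"
        "M' *\<^sub>v x = N' *\<^sub>v y" using Suc c by auto
      have "M *\<^sub>v (Q *\<^sub>v x) = N *\<^sub>v (Q *\<^sub>v y)"
        by (rule mutual_inverse_inj[OF *(1)]) (use y e[OF c(1)] e[OF c(2)] * c Qc in auto)
      thus "x \<in> carrier_vec q \<and> Q *\<^sub>v x \<in> root_space M N (Suc l)" using y c Qc by auto
    next
      assume x: "x \<in> carrier_vec q \<and> Q *\<^sub>v x \<in> root_space M N (Suc l)"
      then obtain z where z: "z \<in> root_space M N l" "M *\<^sub>v (Q *\<^sub>v x) = N *\<^sub>v z" by auto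
      have zc: "z \<in> carrier_vec q" using z root_space_carrier c by blast
      \<comment> \<open>The predecessor \<open>z\<close> of \<open>Q *\<^sub>v x\<close> is moved to
        the new coordinates, where it is a predecessor of \<open>x\<close>.\<close>
      have "Q' *\<^sub>v z \<in> root_space M' N' l" unfolding Suc using zc z(1) QQ' Qc by auto
      moreover have "M' *\<^sub>v x = N' *\<^sub>v (Q' *\<^sub>v z)"
        unfolding *(3,4) using x zc z(2) QQ' Qc by (subst (1 2) e) (use c in auto)
      ultimately show "x \<in> root_space M' N' (Suc l)" using x c by auto
    qed
  qed
  have img: "root_space M' N' l = (\<lambda>x. Q' *\<^sub>v x) ` root_space M N l" for l
  proof
    show "root_space M' N' l \<subseteq> (\<lambda>x. Q' *\<^sub>v x) ` root_space M N l"
    proof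
      fix x assume "x \<in> root_space M' N' l"
      hence "x \<in> carrier_vec q" "Q *\<^sub>v x \<in> root_space M N l" using iff by auto
      thus "x \<in> (\<lambda>x. Q' *\<^sub>v x) ` root_space M N l" using QQ' by (metis image_eqI)
    qed
    show "(\<lambda>x. Q' *\<^sub>v x) ` root_space M N l \<subseteq> root_space M' N' l"
    proof
      fix x assume "x \<in> (\<lambda>x. Q' *\<^sub>v x) ` root_space M N l"
      then obtain z where z: "z \<in> root_space M N l" "x = Q' *\<^sub>v z" by auto
      have zc: "z \<in> carrier_vec q" using z root_space_carrier c by blast
      show "x \<in> root_space M' N' l" unfolding iff using zc z QQ' Qc by auto
    qed
  qed
  have inj: "x = 0\<^sub>v q" if "x \<in> carrier_vec q" "Q' *\<^sub>v x = 0\<^sub>v q" for x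
    using QQ'(1)[of x] that mult_mat_vec_zero[OF Qc(1)] by simp
  show ?thesis unfolding root_dims_def
    using c assms(2) has_dim_mult[OF _ Qc(2) inj] unfolding root_dims_def img by auto
qed

text \<open>A block diagonal action splits the recursion into two components, so each root space is
  the product of those of the summands.\<close>

lemma root_dims_block:
  assumes "root_dims M1 N1 f1" "root_dims M2 N2 f2"
  defines "blk \<equiv> \<lambda>A B. four_block_mat A (0\<^sub>m (dim_row A) (dim_col B)) (0\<^sub>m (dim_row B) (dim_col A)) B"
  shows "root_dims (blk M1 M2) (blk N1 N2) (\<lambda>l. f1 l + f2 l)"
proof -
  let ?M = "blk M1 M2" and ?N = "blk N1 N2"
  let ?q1 = "dim_col M1" and ?q2 = "dim_col M2" and ?p1 = "dim_row M1" and ?p2 = "dim_row M2"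
  have c: "M1 \<in> carrier_mat ?p1 ?q1" "N1 \<in> carrier_mat ?p1 ?q1" "M2 \<in> carrier_mat ?p2 ?q2" "N2 \<in> carrier_mat ?p2 ?q2"
    using assms unfolding root_dims_def by auto
  have d: "dim_row ?M = ?p1 + ?p2" "dim_col ?M = ?q1 + ?q2" "dim_row ?N = ?p1 + ?p2" "dim_col ?N = ?q1 + ?q2"
    using c unfolding blk_def by auto
  have eM: "?M *\<^sub>v (a @\<^sub>v b) = (M1 *\<^sub>v a) @\<^sub>v (M2 *\<^sub>v b)" if "a \<in> carrier_vec ?q1" "b \<in> carrier_vec ?q2" for a b
    unfolding blk_def using diag_block_mult_vec[OF c(1,3) that] .
  have eN: "?N *\<^sub>v (a @\<^sub>v b) = (N1 *\<^sub>v a) @\<^sub>v (N2 *\<^sub>v b)" if "a \<in> carrier_vec ?q1" "b \<in> carrier_vec ?q2" for a b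
    using diag_block_mult_vec[OF c(2,4) that]
    unfolding blk_def carrier_matD[OF c(2)] carrier_matD[OF c(4)] .
  have r: "root_space ?M ?N l = {x @\<^sub>v y | x y. x \<in> root_space M1 N1 l \<and> y \<in> root_space M2 N2 l}" for l
  proof (induction l)
    case 0
    have "0\<^sub>v (?q1 + ?q2) = 0\<^sub>v ?q1 @\<^sub>v (0\<^sub>v ?q2 :: 'a vec)" by (rule eq_vecI) auto
    thus ?case using d by simp
  next
    case (Suc l)
    show ?case
    proof (intro Set.set_eqI iffI)
      fix z assume "z \<in> root_space ?M ?N (Suc l)"
      then obtain y1 y2 where z: "z \<in> carrier_vec (?q1 + ?q2)" and y: "y1 \<in> root_space M1 N1 l"
        "y2 \<in> root_space M2 N2 l" and e: "?M *\<^sub>v z = ?N *\<^sub>v (y1 @\<^sub>v y2)" using Suc d by auto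
      obtain a b where ab: "a \<in> carrier_vec ?q1" "b \<in> carrier_vec ?q2" "z = a @\<^sub>v b"
        using vec_append_cases[OF z] by blast
      have yc: "y1 \<in> carrier_vec ?q1" "y2 \<in> carrier_vec ?q2" using y root_space_carrier by blast+
      have "(M1 *\<^sub>v a) @\<^sub>v (M2 *\<^sub>v b) = (N1 *\<^sub>v y1) @\<^sub>v (N2 *\<^sub>v y2)"
        using e eM[OF ab(1,2)] eN[OF yc] ab(3) by simp
      hence "M1 *\<^sub>v a = N1 *\<^sub>v y1 \<and> M2 *\<^sub>v b = N2 *\<^sub>v y2"
        using append_vec_eq[OF mult_mat_vec_carrier[OF c(1) ab(1)] mult_mat_vec_carrier[OF c(2) yc(1)]] by blast
      hence "a \<in> root_space M1 N1 (Suc l)" "b \<in> root_space M2 N2 (Suc l)"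
        unfolding root_space.simps using ab(1,2) y by blast+
      thus "z \<in> {x @\<^sub>v y | x y. x \<in> root_space M1 N1 (Suc l) \<and> y \<in> root_space M2 N2 (Suc l)}"
        unfolding ab(3) by (intro CollectI exI[of _ a] exI[of _ b]) simp
    next
      fix z assume "z \<in> {x @\<^sub>v y | x y. x \<in> root_space M1 N1 (Suc l) \<and> y \<in> root_space M2 N2 (Suc l)}"
      then obtain a b y1 y2 where ab: "a \<in> carrier_vec ?q1" "b \<in> carrier_vec ?q2" "z = a @\<^sub>v b"
        and y: "y1 \<in> root_space M1 N1 l" "y2 \<in> root_space M2 N2 l"
        and e: "M1 *\<^sub>v a = N1 *\<^sub>v y1" "M2 *\<^sub>v b = N2 *\<^sub>v y2" by auto
      have yc: "y1 \<in> carrier_vec ?q1" "y2 \<in> carrier_vec ?q2" using y root_space_carrier by blast+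
      have "?M *\<^sub>v z = ?N *\<^sub>v (y1 @\<^sub>v y2)" using ab e eM[OF ab(1,2)] eN[OF yc] by simp
      moreover have "y1 @\<^sub>v y2 \<in> root_space ?M ?N l" unfolding Suc using y by blast
      moreover have "z \<in> carrier_vec (?q1 + ?q2)" using ab by simp
      ultimately show "z \<in> root_space ?M ?N (Suc l)" unfolding root_space.simps d by blast
    qed
  qed
  have "has_dim (?q1 + ?q2) (root_space ?M ?N l) (f1 l + f2 l)" for l
    unfolding r
    by (rule has_dim_append[OF assms(1)[unfolded root_dims_def, THEN conjunct2, THEN conjunct2, rule_format]
        assms(2)[unfolded root_dims_def, THEN conjunct2, THEN conjunct2, rule_format]])
  thus ?thesis unfolding root_dims_def d by simp
qed

text \<open>The recursion starts from zero, and \<open>M\<close> pulls zero back only to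
  zero.\<close>

lemma root_dims_injective:
  assumes "M \<in> carrier_mat p q" "N \<in> carrier_mat p q"
    and inj: "\<And>x. x \<in> carrier_vec q \<Longrightarrow> M *\<^sub>v x = 0\<^sub>v p \<Longrightarrow> x = 0\<^sub>v q"
  shows "root_dims M N (\<lambda>_. 0)"
proof -
  have "root_space M N l = {0\<^sub>v q}" for l
  proof (induction l)
    case (Suc l)
    have "M *\<^sub>v 0\<^sub>v q = 0\<^sub>v p" "N *\<^sub>v 0\<^sub>v q = 0\<^sub>v p" using assms by auto
    thus ?case using Suc assms by auto
  qed (use assms in auto)
  thus ?thesis unfolding root_dims_def using assms has_dim_zero by auto
qed

lemma root_dims_initial_segments:
  assumes "M \<in> carrier_mat p q" "N \<in> carrier_mat p q"
    and "\<And>l. root_space M N l = {x \<in> carrier_vec q. \<forall>i<q. l \<le> i \<longrightarrow> x $ i = 0}"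
  shows "root_dims M N (\<lambda>l. min l q)"
  unfolding root_dims_def using assms has_dim_initial_segment by auto

section \<open>Root spaces as spans of Jordan chains\<close>

definition pencil_at :: "'a::comm_ring_1 ext_pt \<Rightarrow> 'a mat \<Rightarrow> 'a mat \<Rightarrow> 'a mat" where
  "pencil_at \<mu> A0 A1 = (case \<mu> of Fin lam \<Rightarrow> A0 + lam \<cdot>\<^sub>m A1 | Infty \<Rightarrow> A1)"

definition pencil_dir :: "'a ext_pt \<Rightarrow> 'a mat \<Rightarrow> 'a mat \<Rightarrow> 'a mat" where
  "pencil_dir \<mu> A0 A1 = (case \<mu> of Fin lam \<Rightarrow> A1 | Infty \<Rightarrow> A0)"

lemma pencil_at_carrier [simp]:
  "A0 \<in> carrier_mat p q \<Longrightarrow> A1 \<in> carrier_mat p q \<Longrightarrow> pencil_at \<mu> A0 A1 \<in> carrier_mat p q"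
  "A0 \<in> carrier_mat p q \<Longrightarrow> A1 \<in> carrier_mat p q \<Longrightarrow> pencil_dir \<mu> A0 A1 \<in> carrier_mat p q"
  unfolding pencil_at_def pencil_dir_def by (auto split: ext_pt.splits)

lemma all_interval_pred_iff:
  fixes P :: "nat \<Rightarrow> nat \<Rightarrow> bool"
  shows "(\<forall>i\<in>{1..k}. P i (i - 1)) \<longleftrightarrow> (\<forall>i<k. P (Suc i) i)"
proof
  assume *: "\<forall>i\<in>{1..k}. P i (i - 1)"
  show "\<forall>i<k. P (Suc i) i"
  proof (rule allI, rule impI)
    fix i assume "i < k"
    hence "Suc i \<in> {1..k}" by simp
    from bspec[OF * this] show "P (Suc i) i" by simp
  qed
next
  assume *: "\<forall>i<k. P (Suc i) i"
  show "\<forall>i\<in>{1..k}. P i (i - 1)"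
  proof
    fix i assume i: "i \<in> {1..k}"
    then obtain j where "i = Suc j" by (cases i) simp_all
    thus "P i (i - 1)" using * i by simp
  qed
qed

lemma jordan_chain_alt:
  assumes "A0 \<in> carrier_mat p q" "A1 \<in> carrier_mat p q"
  shows "jordan_chain A0 A1 \<mu> x k \<longleftrightarrow> (\<forall>i\<le>k. x i \<in> carrier_vec q) \<and> x 0 \<noteq> 0\<^sub>v q \<and>
    pencil_at \<mu> A0 A1 *\<^sub>v x 0 = 0\<^sub>v p \<and>
    (\<forall>i<k. pencil_at \<mu> A0 A1 *\<^sub>v x (Suc i) = - (pencil_dir \<mu> A0 A1 *\<^sub>v x i))"
proof (cases \<mu>)
  case (Fin lam)
  show ?thesis
    unfolding jordan_chain_def pencil_at_def pencil_dir_def Fin ext_pt.case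
      all_interval_pred_iff[of k "\<lambda>i j. (A0 + lam \<cdot>\<^sub>m A1) *\<^sub>v x i = - (A1 *\<^sub>v x j)"]
      carrier_matD[OF assms(1)] ..
next
  case Infty
  show ?thesis
    unfolding jordan_chain_def pencil_at_def pencil_dir_def Infty ext_pt.case
      all_interval_pred_iff[of k "\<lambda>i j. A1 *\<^sub>v x i = - (A0 *\<^sub>v x j)"]
      carrier_matD[OF assms(1)] ..
qed

lemma root_space_mono:
  assumes "dim_row M = dim_row N" "dim_col M = dim_col N" "m \<le> n"
  shows "root_space M N m \<subseteq> root_space M N n"
proof -
  have "root_space M N m \<subseteq> root_space M N (Suc m)" for m
  proof (induction m)
    case 0
    show ?case using zero_in_root_space[OF assms(1,2), of 1] by simp
  next
    case (Suc m)
    thus ?case by auto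
  qed
  thus ?thesis using lift_Suc_mono_le[of "root_space M N"] assms(3) by blast
qed

lemma root_space_SucI:
  assumes "M \<in> carrier_mat p q" "N \<in> carrier_mat p q"
    "x \<in> carrier_vec q" "y \<in> root_space M N m" "M *\<^sub>v x = - (N *\<^sub>v y)"
  shows "x \<in> root_space M N (Suc m)"
proof -
  have "y \<in> carrier_vec q" using assms(1,4) root_space_carrier by blast
  hence "N *\<^sub>v (- y) = - (N *\<^sub>v y)"
    using assms by (auto intro!: eq_vecI simp: scalar_prod_uminus_right)
  moreover have "- y \<in> root_space M N m" using assms by (intro uminus_in_root_space) auto
  ultimately show ?thesis using assms by (auto intro!: bexI[of _ "- y"])
qed

text \<open>In the recursion \<open>x 0\<close> has predecessor 0, and \<open>x (Suc i)\<close> has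
  predecessor \<open>- x i\<close>.\<close>

lemma jordan_chain_in_root_space:
  assumes A: "A0 \<in> carrier_mat p q" "A1 \<in> carrier_mat p q"
    and j: "jordan_chain A0 A1 \<mu> x k" and "i \<le> k"
  shows "x i \<in> root_space (pencil_at \<mu> A0 A1) (pencil_dir \<mu> A0 A1) (Suc i)"
  using assms(4)
proof (induction i)
  case 0
  have "pencil_dir \<mu> A0 A1 *\<^sub>v 0\<^sub>v q = 0\<^sub>v p" using A by (intro mult_mat_vec_zero) simp
  thus ?case using j pencil_at_carrier(1)[OF A, of \<mu>] unfolding jordan_chain_alt[OF A] by auto
next
  case (Suc i)
  have "x (Suc i) \<in> carrier_vec q"
    using j Suc.prems unfolding jordan_chain_alt[OF A] by auto
  moreover have "x i \<in> root_space (pencil_at \<mu> A0 A1) (pencil_dir \<mu> A0 A1) (Suc i)" using Suc by simp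
  moreover have "pencil_at \<mu> A0 A1 *\<^sub>v x (Suc i) = - (pencil_dir \<mu> A0 A1 *\<^sub>v x i)"
    using j Suc.prems unfolding jordan_chain_alt[OF A] by auto
  ultimately show ?case by (rule root_space_SucI[OF pencil_at_carrier[OF A]])
qed

text \<open>Following predecessors down from \<open>z\<close> yields a chain, but zero may be
  reached early; the chain is cut there because its initial vector must be nonzero. This is why the
  length is only bounded by \<open>m\<close>.\<close>

lemma root_space_jordan_chain:
  assumes A: "A0 \<in> carrier_mat p q" "A1 \<in> carrier_mat p q"
    and "z \<in> root_space (pencil_at \<mu> A0 A1) (pencil_dir \<mu> A0 A1) m" "z \<noteq> 0\<^sub>v q"
  obtains x k where "jordan_chain A0 A1 \<mu> x k" "k < m" "x k = z"
proof -
  let ?M = "pencil_at \<mu> A0 A1" and ?N = "pencil_dir \<mu> A0 A1"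
  have c: "?M \<in> carrier_mat p q" "?N \<in> carrier_mat p q" using A by auto
  have "\<exists>x k. jordan_chain A0 A1 \<mu> x k \<and> k < m \<and> x k = z"
    using assms(3,4)
  proof (induction m arbitrary: z)
    case 0
    thus ?case using c by auto
  next
    case (Suc m)
    then obtain y0 where y0: "z \<in> carrier_vec q" "y0 \<in> root_space ?M ?N m" "?M *\<^sub>v z = ?N *\<^sub>v y0"
      using c by auto
    define y where "y = - y0"
    have y0c: "y0 \<in> carrier_vec q" using y0(2) root_space_carrier c by blast
    hence "?N *\<^sub>v (- y0) = - (?N *\<^sub>v y0)"
      using c by (auto intro!: eq_vecI simp: scalar_prod_uminus_right)
    hence yM: "?M *\<^sub>v z = - (?N *\<^sub>v y)" unfolding y_def y0(3) by simp
    have yr: "y \<in> root_space ?M ?N m" unfolding y_def using c y0(2) by (intro uminus_in_root_space) auto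
    show ?case
    \<comment> \<open>With a zero predecessor \<open>z\<close> starts a chain of length one;
      otherwise it is put on top of a chain that ends in \<open>y\<close>.\<close>
    proof (cases "y = 0\<^sub>v q")
      case True
      have "?M *\<^sub>v z = 0\<^sub>v p" unfolding yM True mult_mat_vec_zero[OF c(2)] by simp
      hence "jordan_chain A0 A1 \<mu> (\<lambda>_. z) 0" unfolding jordan_chain_alt[OF A] using y0(1) Suc.prems(2) by simp
      thus ?thesis by (intro exI[of _ "\<lambda>_. z"] exI[of _ 0] conjI) simp_all
    next
      case False
      then obtain x k where x: "jordan_chain A0 A1 \<mu> x k" "k < m" "x k = y" using Suc.IH[OF yr] by blast
      have "jordan_chain A0 A1 \<mu> (x(Suc k := z)) (Suc k)"
        unfolding jordan_chain_alt[OF A]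
      proof (intro conjI allI impI)
        fix i assume "i < Suc k"
        thus "?M *\<^sub>v (x(Suc k := z)) (Suc i) = - (?N *\<^sub>v (x(Suc k := z)) i)"
          using x(1,3) yM unfolding jordan_chain_alt[OF A] by (cases "i = k") simp_all
      next
        fix i assume "i \<le> Suc k"
        thus "(x(Suc k := z)) i \<in> carrier_vec q"
          using x(1) y0(1) unfolding jordan_chain_alt[OF A] by (cases "i = Suc k") simp_all
      next
        show "(x(Suc k := z)) 0 \<noteq> 0\<^sub>v q" using x(1) unfolding jordan_chain_alt[OF A] by simp
      next
        show "?M *\<^sub>v (x(Suc k := z)) 0 = 0\<^sub>v p" using x(1) unfolding jordan_chain_alt[OF A] by simp
      qed
      moreover have "Suc k < Suc m" using x(2) by (simp only: Suc_less_eq)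
      moreover have "(x(Suc k := z)) (Suc k) = z" by (rule fun_upd_same)
      ultimately show ?thesis by metis
    qed
  qed
  thus thesis using that by blast
qed

text \<open>Every vector of a chain is in the root space, and every nonzero root vector is the top
  of a chain. Taking the span adds nothing, because \<open>d\<close> makes the root space a
  subspace.\<close>

lemma chain_space_eq_root_space:
  fixes A0 A1 :: "'a::field mat"
  assumes A: "A0 \<in> carrier_mat p q" "A1 \<in> carrier_mat p q"
    and d: "root_dims (pencil_at \<mu> A0 A1) (pencil_dir \<mu> A0 A1) f"
  shows "chain_space A0 A1 \<mu> l = root_space (pencil_at \<mu> A0 A1) (pencil_dir \<mu> A0 A1) l"
proof (cases "l = 0")
  case True
  thus ?thesis using A carrier_matD(2)[OF pencil_at_carrier(1)[OF A, of \<mu>]] unfolding chain_space_def by simp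
next
  case False
  interpret vec_space "TYPE('a)" q .
  let ?M = "pencil_at \<mu> A0 A1" and ?N = "pencil_dir \<mu> A0 A1"
  let ?S = "{x i | x k i. jordan_chain A0 A1 \<mu> x k \<and> k + 1 \<le> l \<and> i \<le> k}"
  have c: "?M \<in> carrier_mat p q" "?N \<in> carrier_mat p q" using A by auto
  have S: "?S \<subseteq> root_space ?M ?N l"
  proof
    fix z assume "z \<in> ?S"
    then obtain x k i where z: "z = x i" "jordan_chain A0 A1 \<mu> x k" "k + 1 \<le> l" "i \<le> k" by blast
    have "root_space ?M ?N (Suc i) \<subseteq> root_space ?M ?N l" using z c by (intro root_space_mono) auto
    thus "z \<in> root_space ?M ?N l" using jordan_chain_in_root_space[OF A z(2,4)] z(1) by blast
  qed
  have Sc: "?S \<subseteq> carrier_vec q" using S root_space_carrier c by blast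
  \<comment> \<open>Zero is the empty combination; it need not be a member of any chain.\<close>
  have zero: "0\<^sub>v q \<in> span ?S" unfolding span_def lincomb_def by force
  have sp: "span (root_space ?M ?N l) = root_space ?M ?N l"
    using d c has_dim_imp(2)[of q "root_space ?M ?N l"] unfolding root_dims_def by auto
  have "root_space ?M ?N l \<subseteq> span ?S"
  proof
    fix z assume z: "z \<in> root_space ?M ?N l"
    show "z \<in> span ?S"
    proof (cases "z = 0\<^sub>v q")
      case False
      then obtain x k where "jordan_chain A0 A1 \<mu> x k" "k < l" "x k = z"
        using root_space_jordan_chain[OF A z] by metis
      hence "z = x k \<and> jordan_chain A0 A1 \<mu> x k \<and> k + 1 \<le> l \<and> k \<le> k" by simp
      hence "z \<in> ?S" by blast
      thus ?thesis using in_own_span[OF Sc] by blast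
    qed (use zero in simp)
  qed
  hence "span ?S = root_space ?M ?N l" using span_is_monotone[OF S] unfolding sp by (rule subset_antisym[rotated])
  thus ?thesis using False A unfolding chain_space_def by simp
qed

lemma w_eq_root_dims:
  fixes A0 A1 :: "'a::field mat"
  assumes A: "A0 \<in> carrier_mat p q" "A1 \<in> carrier_mat p q"
    and d: "root_dims (pencil_at \<mu> A0 A1) (pencil_dir \<mu> A0 A1) f"
  shows "w A0 A1 \<mu> i = f i - f (i - 1)"
proof -
  have "has_dim q (chain_space A0 A1 \<mu> l) (f l)" for l
    using d carrier_matD(2)[OF pencil_at_carrier(1)[OF A]]
    unfolding chain_space_eq_root_space[OF A d] root_dims_def by metis
  hence "subspace_dim TYPE('a) q (chain_space A0 A1 \<mu> l) = f l" for l by (rule has_dim_imp(1))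
  thus ?thesis unfolding w_def carrier_matD(2)[OF A(1)] by simp
qed

section \<open>Minors\<close>

text \<open>Arbitrary index functions instead of index sets: expanding the minors of a product
  then needs no sorting of indices.\<close>

definition gen_minor :: "'b::comm_ring_1 mat \<Rightarrow> (nat \<Rightarrow> nat) \<Rightarrow> (nat \<Rightarrow> nat) \<Rightarrow> nat \<Rightarrow> 'b" where
  "gen_minor X f g k = det (mat k k (\<lambda>(i,j). X $$ (f i, g j)))"

lemma gen_minor_transpose:
  assumes "X \<in> carrier_mat p q" "\<And>i. i < k \<Longrightarrow> f i < q" "\<And>i. i < k \<Longrightarrow> g i < p"
  shows "gen_minor X\<^sup>T f g k = gen_minor X g f k"
proof -
  let ?M = "mat k k (\<lambda>(i,j). X $$ (g i, f j))"
  have "mat k k (\<lambda>(i,j). X\<^sup>T $$ (f i, g j)) = ?M\<^sup>T" using assms by (intro eq_matI) auto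
  thus ?thesis unfolding gen_minor_def using det_transpose[of ?M k] by simp
qed

lemma pick_card_lt: "finite I \<Longrightarrow> (i::nat) \<in> I \<Longrightarrow> card {a\<in>I. a < i} < card I"
  by (rule psubset_card_mono) blast+

text \<open>Sorting the row indices permutes the rows and changes only the sign; \<open>pick\<close>
  lists a set increasingly, as \<open>submatrix\<close> does.\<close>

lemma gen_minor_sort_rows:
  assumes X: "X \<in> carrier_mat p q" and inj: "inj_on f {..<k}"
  shows "gen_minor X f g k \<in> {gen_minor X (pick (f ` {..<k})) g k, - gen_minor X (pick (f ` {..<k})) g k}"
proof -
  let ?I = "f ` {..<k}"
  \<comment> \<open>\<open>s i\<close> is the rank of \<open>f i\<close> among the selected rows;
    outside \<open>{..<k}\<close> it is the identity, as \<open>permutes\<close> demands.\<close>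
  define s where "s = (\<lambda>i. if i < k then card {a\<in>?I. a < f i} else i)"
  have card: "card ?I = k" using inj by (simp add: card_image)
  have fs: "f i = pick ?I (s i)" "s i < k" if "i < k" for i
    using that pick_card_in_set[of "f i" ?I] pick_card_lt[of ?I "f i"] card unfolding s_def by auto
  have "inj_on s {0..<k}"
  proof (rule inj_onI)
    fix i j assume "i \<in> {0..<k}" "j \<in> {0..<k}" "s i = s j"
    hence "f i = f j" using fs(1)[of i] fs(1)[of j] by simp
    thus "i = j" using inj \<open>i \<in> _\<close> \<open>j \<in> _\<close> by (auto dest: inj_onD)
  qed
  moreover have "s ` {0..<k} \<subseteq> {0..<k}" using fs(2) by auto
  ultimately have "bij_betw s {0..<k} {0..<k}"
    unfolding bij_betw_def using endo_inj_surj[of "{0..<k}" s] by auto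
  hence perm: "s permutes {0..<k}" by (intro bij_imp_permutes) (auto simp: s_def)
  let ?A = "mat k k (\<lambda>(i,j). X $$ (pick ?I i, g j))"
  have "mat k k (\<lambda>(i,j). X $$ (f i, g j)) = mat k k (\<lambda>(i,j). ?A $$ (s i, j))"
    using fs by (intro eq_matI) auto
  hence "gen_minor X f g k = signof s * gen_minor X (pick ?I) g k"
    unfolding gen_minor_def using det_permute_rows[of ?A k s] perm by simp
  thus ?thesis by (simp add: sign_def)
qed

lemma gen_minor_not_inj:
  assumes "\<not> inj_on f {..<k}"
  shows "gen_minor X f g k = 0"
proof -
  from assms obtain i j where ij: "i < k" "j < k" "i \<noteq> j" "f i = f j" unfolding inj_on_def by auto
  show ?thesis unfolding gen_minor_def
    by (rule det_identical_rows[of _ k i j]) (use ij in \<open>auto simp: row_def\<close>)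
qed

text \<open>Rows are sorted directly, columns through the transpose. A repeated index would make the
  minor vanish, so both index functions are injective.\<close>

lemma gen_minor_minors:
  assumes X: "X \<in> carrier_mat p q" and f: "\<And>i. i < k \<Longrightarrow> f i < p" and g: "\<And>i. i < k \<Longrightarrow> g i < q"
    and nz: "gen_minor X f g k \<noteq> 0"
  shows "\<exists>m \<in> minors X k. gen_minor X f g k \<in> {m, - m}"
proof -
  have injf: "inj_on f {..<k}" using gen_minor_not_inj nz by blast
  have tr: "gen_minor X f' g' k = gen_minor X\<^sup>T g' f' k"
    if "\<And>i. i < k \<Longrightarrow> f' i < p" "\<And>i. i < k \<Longrightarrow> g' i < q" for f' g'
    using gen_minor_transpose[OF X] that by metis
  let ?I = "f ` {..<k}" and ?J = "g ` {..<k}"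
  have cI: "card ?I = k" using injf by (simp add: card_image)
  have I: "?I \<subseteq> {..<p}" using f by auto
  have pI: "pick ?I i < p" if "i < k" for i
    using subsetD[OF I pick_in_set_le[of i ?I]] that cI by simp
  have injg: "inj_on g {..<k}"
  proof (rule ccontr)
    assume "\<not> inj_on g {..<k}"
    hence "gen_minor X\<^sup>T g f k = 0" by (rule gen_minor_not_inj)
    thus False using nz tr[of f g] f g by simp
  qed
  have cJ: "card ?J = k" using injg by (simp add: card_image)
  have J: "?J \<subseteq> {..<q}" using g by auto
  have pJ: "pick ?J i < q" if "i < k" for i
    using subsetD[OF J pick_in_set_le[of i ?J]] that cJ by simp
  have 1: "gen_minor X f g k \<in> {gen_minor X (pick ?I) g k, - gen_minor X (pick ?I) g k}"
    by (rule gen_minor_sort_rows[OF X injf])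
  have 2: "gen_minor X (pick ?I) g k \<in> {gen_minor X (pick ?I) (pick ?J) k, - gen_minor X (pick ?I) (pick ?J) k}"
    using gen_minor_sort_rows[of "X\<^sup>T" q p g k "pick ?I"] X injg tr[OF pI g] tr[OF pI pJ] by simp
  have "{i. i < dim_row X \<and> i \<in> ?I} = ?I" "{i. i < dim_col X \<and> i \<in> ?J} = ?J" using X I J by auto
  hence "submatrix X ?I ?J = mat k k (\<lambda>(i,j). X $$ (pick ?I i, pick ?J j))"
    unfolding submatrix_def using cI cJ by simp
  hence "gen_minor X (pick ?I) (pick ?J) k = det (submatrix X ?I ?J)" unfolding gen_minor_def by simp
  moreover have "det (submatrix X ?I ?J) \<in> minors X k"
    unfolding minors_def carrier_matD[OF X] using I J cI cJ by blast
  ultimately show ?thesis using 1 2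
    by (intro bexI[of _ "gen_minor X (pick ?I) (pick ?J) k"]) (simp only: insert_iff empty_iff, metis minus_minus, metis)
qed

lemma minors_gen_minor:
  assumes X: "X \<in> carrier_mat p q" and m: "m \<in> minors X k"
  obtains f g where "\<And>i. i < k \<Longrightarrow> f i < p" "\<And>i. i < k \<Longrightarrow> g i < q" "m = gen_minor X f g k"
proof -
  from m X obtain I J where IJ: "I \<subseteq> {..<p}" "J \<subseteq> {..<q}" "card I = k" "card J = k" "m = det (submatrix X I J)"
    unfolding minors_def by auto
  have "{i. i < dim_row X \<and> i \<in> I} = I" "{i. i < dim_col X \<and> i \<in> J} = J" using X IJ by auto
  hence "submatrix X I J = mat k k (\<lambda>(i,j). X $$ (pick I i, pick J j))"
    unfolding submatrix_def using IJ by simp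
  hence "m = gen_minor X (pick I) (pick J) k" unfolding gen_minor_def IJ(5) by simp
  thus thesis using that[of "pick I" "pick J"] pick_in_set_le[of _ I] pick_in_set_le[of _ J] IJ by auto
qed

text \<open>For \<open>d\<close> a power of \<pi> this test replaces the determinantal divisor: the
  valuation of the gcd is the largest exponent that passes, and no gcd has to be followed through
  matrix products.\<close>

definition dvd_minors :: "'b::comm_ring_1 \<Rightarrow> 'b mat \<Rightarrow> nat \<Rightarrow> bool" where
  "dvd_minors d X k \<longleftrightarrow> (\<forall>f g. (\<forall>i<k. f i < dim_row X \<and> g i < dim_col X) \<longrightarrow> d dvd gen_minor X f g k)"

lemma dvd_minorsD:
  assumes "dvd_minors d X k" "\<And>i. i < k \<Longrightarrow> f i < dim_row X" "\<And>i. i < k \<Longrightarrow> g i < dim_col X"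
  shows "d dvd gen_minor X f g k"
  using assms unfolding dvd_minors_def by blast

lemma dvd_minors_iff: "dvd_minors d X k \<longleftrightarrow> (\<forall>m \<in> minors X k. d dvd m)"
proof
  assume *: "dvd_minors d X k"
  show "\<forall>m \<in> minors X k. d dvd m"
  proof
    fix m assume m: "m \<in> minors X k"
    have "X \<in> carrier_mat (dim_row X) (dim_col X)" by simp
    from minors_gen_minor[OF this m] show "d dvd m" using * unfolding dvd_minors_def by metis
  qed
next
  assume *: "\<forall>m \<in> minors X k. d dvd m"
  show "dvd_minors d X k" unfolding dvd_minors_def
  proof (intro allI impI)
    fix f g assume "\<forall>i<k. f i < dim_row X \<and> g i < dim_col X"
    thus "d dvd gen_minor X f g k"
      using gen_minor_minors[of X "dim_row X" "dim_col X" k f g] * by (cases "gen_minor X f g k = 0") auto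
  qed
qed

lemma dvd_minors_transpose: "dvd_minors d X\<^sup>T k \<longleftrightarrow> dvd_minors d X k"
proof -
  have *: "dvd_minors d X\<^sup>T k" if "dvd_minors d X k" for X :: "'a mat"
    using that gen_minor_transpose[of X "dim_row X" "dim_col X" k] unfolding dvd_minors_def by auto
  show ?thesis using *[of X] *[of "X\<^sup>T"] by auto
qed

text \<open>A one-sided Cauchy-Binet formula: the rows of \<open>P * X\<close> are combinations of
  rows of \<open>X\<close>, and the determinant is multilinear in its rows. All index maps
  \<open>h\<close> occur, unsorted and non-injective ones too; they are fixed outside
  \<open>{0..<k}\<close> so that the sum is finite.\<close>

lemma gen_minor_mult:
  fixes P X :: "'b::comm_ring_1 mat"
  assumes P: "P \<in> carrier_mat p' p" and X: "X \<in> carrier_mat p q"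
    and f: "\<And>i. i < k \<Longrightarrow> f i < p'" and g: "\<And>i. i < k \<Longrightarrow> g i < q"
  shows "gen_minor (P * X) f g k =
    (\<Sum>h | (\<forall>i\<in>{0..<k}. h i \<in> {0..<p}) \<and> (\<forall>i. i \<notin> {0..<k} \<longrightarrow> h i = i).
        (\<Prod>i = 0..<k. P $$ (f i, h i)) * gen_minor X h g k)"
proof -
  define A where "A = mat k p (\<lambda>(i,l). P $$ (f i, l))"
  define B where "B = mat p k (\<lambda>(l,j). X $$ (l, g j))"
  let ?H = "{h. (\<forall>i\<in>{0..<k}. h i \<in> {0..<p}) \<and> (\<forall>i. i \<notin> {0..<k} \<longrightarrow> h i = i)}"
  have AB: "A \<in> carrier_mat k p" "B \<in> carrier_mat p k" unfolding A_def B_def by auto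
  have "mat k k (\<lambda>(i,j). (P * X) $$ (f i, g j)) = A * B"
    using P X f g unfolding A_def B_def
    by (intro eq_matI) (auto simp: scalar_prod_def intro!: sum.cong)
  hence "gen_minor (P * X) f g k = det (A * B)" unfolding gen_minor_def by simp
  also have "A * B = mat\<^sub>r k k (\<lambda>i. finsum_vec TYPE('b) k (\<lambda>l. A $$ (i,l) \<cdot>\<^sub>v row B l) {0..<p})"
    by (rule mat_mul_finsum_alt[OF AB])
  also have "det \<dots> = (\<Sum>h\<in>?H. det (mat\<^sub>r k k (\<lambda>i. A $$ (i, h i) \<cdot>\<^sub>v row B (h i))))"
    by (rule det_linear_rows_sum) (use AB in auto)
  also have "\<dots> = (\<Sum>h\<in>?H. (\<Prod>i = 0..<k. P $$ (f i, h i)) * gen_minor X h g k)"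
  proof (rule sum.cong[OF refl])
    fix h assume h: "h \<in> ?H"
    have "det (mat\<^sub>r k k (\<lambda>i. A $$ (i, h i) \<cdot>\<^sub>v row B (h i)))
        = (\<Prod>i = 0..<k. A $$ (i, h i)) * det (mat\<^sub>r k k (\<lambda>i. row B (h i)))"
      by (rule det_rows_mul) (use AB in auto)
    also have "(\<Prod>i = 0..<k. A $$ (i, h i)) = (\<Prod>i = 0..<k. P $$ (f i, h i))"
      using h unfolding A_def by (intro prod.cong) auto
    also have "mat\<^sub>r k k (\<lambda>i. row B (h i)) = mat k k (\<lambda>(i,j). X $$ (h i, g j))"
      using h unfolding B_def by (intro eq_matI) auto
    finally show "det (mat\<^sub>r k k (\<lambda>i. A $$ (i, h i) \<cdot>\<^sub>v row B (h i))) =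
      (\<Prod>i = 0..<k. P $$ (f i, h i)) * gen_minor X h g k" unfolding gen_minor_def .
  qed
  finally show ?thesis .
qed

lemma dvd_minors_mult_left:
  assumes "P \<in> carrier_mat p' p" "X \<in> carrier_mat p q" "dvd_minors d X k"
  shows "dvd_minors d (P * X) k"
  unfolding dvd_minors_def
proof (intro allI impI)
  fix f g assume "\<forall>i<k. f i < dim_row (P * X) \<and> g i < dim_col (P * X)"
  hence fg: "\<And>i. i < k \<Longrightarrow> f i < p'" "\<And>i. i < k \<Longrightarrow> g i < q" using assms by auto
  have "d dvd gen_minor X h g k" if "\<forall>i\<in>{0..<k}. h i \<in> {0..<p}" for h
    using that assms(2,3) fg(2) unfolding dvd_minors_def by auto
  hence "d dvd (\<Sum>h | (\<forall>i\<in>{0..<k}. h i \<in> {0..<p}) \<and> (\<forall>i. i \<notin> {0..<k} \<longrightarrow> h i = i).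
        (\<Prod>i = 0..<k. P $$ (f i, h i)) * gen_minor X h g k)"
    by (intro dvd_sum dvd_mult) blast
  thus "d dvd gen_minor (P * X) f g k" using gen_minor_mult[OF assms(1,2) fg] by simp
qed

text \<open>Laplace expansion along the first row. This is what makes the quotients of successive
  determinantal divisors exact.\<close>

lemma dvd_minors_Suc:
  assumes "dvd_minors d X k"
  shows "dvd_minors d X (Suc k)"
  unfolding dvd_minors_def
proof (intro allI impI)
  fix f g assume fg: "\<forall>i<Suc k. f i < dim_row X \<and> g i < dim_col X"
  let ?A = "mat (Suc k) (Suc k) (\<lambda>(i,j). X $$ (f i, g j))"
  have eq: "gen_minor X f g (Suc k) = (\<Sum>j<Suc k. ?A $$ (0,j) * cofactor ?A 0 j)"
    unfolding gen_minor_def by (rule laplace_expansion_row[OF mat_carrier zero_less_Suc])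
  have "d dvd cofactor ?A 0 j" if j: "j < Suc k" for j
  proof -
    \<comment> \<open>Deleting column \<open>j\<close> means skipping the index \<open>j\<close>;
      row 0 is skipped by \<open>Suc\<close>.\<close>
    let ?g = "\<lambda>i. g (if i < j then i else Suc i)"
    have "mat_delete ?A 0 j = mat k k (\<lambda>(i,l). X $$ (f (Suc i), ?g l))"
      by (rule eq_matI) (simp_all add: mat_delete_def)
    hence e: "det (mat_delete ?A 0 j) = gen_minor X (\<lambda>i. f (Suc i)) ?g k" unfolding gen_minor_def by (rule arg_cong)
    have "f (Suc i) < dim_row X" "?g i < dim_col X" if "i < k" for i
      using fg[rule_format, of "Suc i"] fg[rule_format, of i] that by auto
    hence "d dvd gen_minor X (\<lambda>i. f (Suc i)) ?g k"
      by (intro dvd_minorsD[OF assms, where f = "\<lambda>i. f (Suc i)" and g = ?g])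
    hence "d dvd (- 1) ^ (0 + j) * gen_minor X (\<lambda>i. f (Suc i)) ?g k" by (rule dvd_mult)
    thus ?thesis unfolding cofactor_def by (subst e)
  qed
  thus "d dvd gen_minor X f g (Suc k)" unfolding eq by (intro dvd_sum dvd_mult) (simp only: lessThan_iff)
qed

lemma gen_minor_smult:
  assumes "\<And>i. i < k \<Longrightarrow> f i < dim_row X" "\<And>i. i < k \<Longrightarrow> g i < dim_col X"
  shows "gen_minor (c \<cdot>\<^sub>m X) f g k = c ^ k * gen_minor X f g k"
proof -
  have "mat k k (\<lambda>(i,j). (c \<cdot>\<^sub>m X) $$ (f i, g j)) = c \<cdot>\<^sub>m mat k k (\<lambda>(i,j). X $$ (f i, g j))"
    using assms by (intro eq_matI) auto
  thus ?thesis unfolding gen_minor_def by simp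
qed

section \<open>Local unimodular equivalence\<close>

text \<open>\<open>P'\<close> divided by \<open>c\<close> is the inverse over the local ring;
  keeping \<open>P'\<close> and \<open>c\<close> apart avoids denominators.\<close>

definition scalar_inverse :: "'b::comm_ring_1 \<Rightarrow> nat \<Rightarrow> 'b mat \<Rightarrow> 'b mat \<Rightarrow> 'b \<Rightarrow> bool" where
  "scalar_inverse \<pi> n P P' c \<longleftrightarrow> P \<in> carrier_mat n n \<and> P' \<in> carrier_mat n n \<and>
     P * P' = c \<cdot>\<^sub>m 1\<^sub>m n \<and> P' * P = c \<cdot>\<^sub>m 1\<^sub>m n \<and> \<not> \<pi> dvd c"

text \<open>For a prime \<pi> these are the matrices that are invertible over the local ring at \<pi>.\<close>

definition loc_unimodular :: "'b::comm_ring_1 \<Rightarrow> nat \<Rightarrow> 'b mat \<Rightarrow> bool" where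
  "loc_unimodular \<pi> n P \<longleftrightarrow> (\<exists>P' c. scalar_inverse \<pi> n P P' c)"

lemma loc_unimodular_carrier: "loc_unimodular \<pi> n P \<Longrightarrow> P \<in> carrier_mat n n"
  unfolding loc_unimodular_def scalar_inverse_def by blast

text \<open>The adjugate serves as \<open>P'\<close>, with \<open>c = det P\<close>.\<close>

lemma loc_unimodularI_det:
  assumes "P \<in> carrier_mat n n" "\<not> \<pi> dvd det P"
  shows "loc_unimodular \<pi> n P"
  unfolding loc_unimodular_def scalar_inverse_def using assms adj_mat[OF assms(1)] by blast

text \<open>Minors of \<open>P * X\<close> are combinations of minors of \<open>X\<close>.
  Conversely, multiplying \<open>P * X\<close> by \<open>P'\<close> gives \<open>c\<close> times
  \<open>X\<close>, whose minors of order \<open>k\<close> carry the factor \<open>c ^ k\<close>,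
  prime to \<pi>.\<close>

lemma dvd_minors_loc_unimodular_left:
  fixes X :: "'b::factorial_ring_gcd mat"
  assumes "prime_elem \<pi>" "loc_unimodular \<pi> p P" "X \<in> carrier_mat p q"
  shows "dvd_minors (\<pi> ^ m) (P * X) k \<longleftrightarrow> dvd_minors (\<pi> ^ m) X k"
proof
  obtain P' c where P: "P \<in> carrier_mat p p" "P' \<in> carrier_mat p p" "P' * P = c \<cdot>\<^sub>m 1\<^sub>m p" "\<not> \<pi> dvd c"
    using assms(2) unfolding loc_unimodular_def scalar_inverse_def by blast
  show "dvd_minors (\<pi> ^ m) (P * X) k" if "dvd_minors (\<pi> ^ m) X k"
    using dvd_minors_mult_left[OF P(1) assms(3) that] .
  assume d: "dvd_minors (\<pi> ^ m) (P * X) k"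
  have "P' * (P * X) = P' * P * X" using P assms(3) by (intro assoc_mult_mat[symmetric]) auto
  also have "\<dots> = c \<cdot>\<^sub>m X" unfolding P(3) using assms(3) by (simp add: mult_smult_assoc_mat[of _ p p _ q])
  finally have e: "P' * (P * X) = c \<cdot>\<^sub>m X" .
  have "dvd_minors (\<pi> ^ m) (P' * (P * X)) k"
    by (rule dvd_minors_mult_left[OF P(2) mult_carrier_mat[OF P(1) assms(3)] d])
  hence d': "dvd_minors (\<pi> ^ m) (c \<cdot>\<^sub>m X) k" unfolding e .
  show "dvd_minors (\<pi> ^ m) X k" unfolding dvd_minors_def
  proof (intro allI impI)
    fix f g assume fg: "\<forall>i<k. f i < dim_row X \<and> g i < dim_col X"
    have "\<pi> ^ m dvd gen_minor (c \<cdot>\<^sub>m X) f g k" by (rule dvd_minorsD[OF d']) (use fg in simp_all)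
    moreover have "gen_minor (c \<cdot>\<^sub>m X) f g k = c ^ k * gen_minor X f g k"
      by (rule gen_minor_smult) (use fg in simp_all)
    ultimately have "\<pi> ^ m dvd c ^ k * gen_minor X f g k" by simp
    moreover have "\<not> \<pi> dvd c ^ k" using P(4) prime_elem_dvd_power[OF assms(1)] by blast
    \<comment> \<open>Cancelling \<open>c ^ k\<close> requires a positive exponent, hence the split
      on \<open>m = 0\<close>.\<close>
    ultimately show "\<pi> ^ m dvd gen_minor X f g k"
      using prime_power_dvd_multD[OF assms(1), of m "c ^ k" "gen_minor X f g k"] by (cases "m = 0") simp_all
  qed
qed

lemma transpose_smult: "(c \<cdot>\<^sub>m A)\<^sup>T = c \<cdot>\<^sub>m A\<^sup>T"
  by (rule eq_matI) simp_all

lemma loc_unimodular_transpose: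
  assumes "loc_unimodular \<pi> n P"
  shows "loc_unimodular \<pi> n P\<^sup>T"
proof -
  obtain P' c where P: "P \<in> carrier_mat n n" "P' \<in> carrier_mat n n" "P * P' = c \<cdot>\<^sub>m 1\<^sub>m n" "P' * P = c \<cdot>\<^sub>m 1\<^sub>m n" "\<not> \<pi> dvd c"
    using assms unfolding loc_unimodular_def scalar_inverse_def by blast
  have "P\<^sup>T * P'\<^sup>T = c \<cdot>\<^sub>m 1\<^sub>m n" "P'\<^sup>T * P\<^sup>T = c \<cdot>\<^sub>m 1\<^sub>m n"
    unfolding transpose_mult[OF P(2,1), symmetric] transpose_mult[OF P(1,2), symmetric] P(3,4)
    by (simp_all add: transpose_smult transpose_one)
  thus ?thesis unfolding loc_unimodular_def scalar_inverse_def using P by (metis transpose_carrier_mat)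
qed

lemma loc_unimodular_mult:
  assumes "prime_elem \<pi>" "loc_unimodular \<pi> n P" "loc_unimodular \<pi> n Q"
  shows "loc_unimodular \<pi> n (P * Q)"
proof -
  obtain P' c where P: "P \<in> carrier_mat n n" "P' \<in> carrier_mat n n" "P * P' = c \<cdot>\<^sub>m 1\<^sub>m n" "P' * P = c \<cdot>\<^sub>m 1\<^sub>m n" "\<not> \<pi> dvd c"
    using assms unfolding loc_unimodular_def scalar_inverse_def by blast
  obtain Q' d where Q: "Q \<in> carrier_mat n n" "Q' \<in> carrier_mat n n" "Q * Q' = d \<cdot>\<^sub>m 1\<^sub>m n" "Q' * Q = d \<cdot>\<^sub>m 1\<^sub>m n" "\<not> \<pi> dvd d"
    using assms unfolding loc_unimodular_def scalar_inverse_def by blast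
  have gen: "(A * B) * (B' * A') = (a * b) \<cdot>\<^sub>m 1\<^sub>m n"
    if "A \<in> carrier_mat n n" "B \<in> carrier_mat n n" "A' \<in> carrier_mat n n" "B' \<in> carrier_mat n n"
      "A * A' = a \<cdot>\<^sub>m 1\<^sub>m n" "B * B' = b \<cdot>\<^sub>m 1\<^sub>m n" for A B A' B' :: "'a mat" and a b
  proof -
    have "(A * B) * (B' * A') = A * (B * (B' * A'))" using that by (intro assoc_mult_mat) auto
    also have "B * (B' * A') = B * B' * A'" using that by (intro assoc_mult_mat[symmetric]) auto
    also have "\<dots> = b \<cdot>\<^sub>m A'" unfolding that(6) using that(3) by (simp add: mult_smult_assoc_mat[of _ n n _ n])
    also have "A * (b \<cdot>\<^sub>m A') = b \<cdot>\<^sub>m (A * A')" using that by (intro mult_smult_distrib) auto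
    finally show ?thesis unfolding that(5) by (auto simp: mult.commute)
  qed
  have "\<not> \<pi> dvd c * d" using assms(1) P(5) Q(5) prime_elem_dvd_mult_iff by blast
  moreover have "(P * Q) * (Q' * P') = (c * d) \<cdot>\<^sub>m 1\<^sub>m n" by (rule gen) (fact P Q)+
  moreover have "(Q' * P') * (P * Q) = (c * d) \<cdot>\<^sub>m 1\<^sub>m n"
    using gen[of Q' P' Q P d c] P Q by (simp add: mult.commute)
  ultimately show ?thesis unfolding loc_unimodular_def scalar_inverse_def using P(1,2) Q(1,2)
    by (intro exI[of _ "Q' * P'"] exI[of _ "c * d"]) simp
qed

text \<open>The right factor acts from the left after transposition, which preserves minors.\<close>

lemma dvd_minors_loc_unimodular:
  fixes X :: "'b::factorial_ring_gcd mat"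
  assumes "prime_elem \<pi>" "loc_unimodular \<pi> p P" "loc_unimodular \<pi> q Q" "X \<in> carrier_mat p q"
  shows "dvd_minors (\<pi> ^ m) (P * X * Q) k \<longleftrightarrow> dvd_minors (\<pi> ^ m) X k"
proof -
  note c = loc_unimodular_carrier[OF assms(2)] loc_unimodular_carrier[OF assms(3)]
  have "dvd_minors (\<pi> ^ m) (P * X * Q) k \<longleftrightarrow> dvd_minors (\<pi> ^ m) (Q\<^sup>T * (P * X)\<^sup>T) k"
    using dvd_minors_transpose[of "\<pi> ^ m" "P * X * Q" k] transpose_mult[of "P * X" p q Q q] c assms(4) by simp
  also have "\<dots> \<longleftrightarrow> dvd_minors (\<pi> ^ m) (P * X)\<^sup>T k"
    by (rule dvd_minors_loc_unimodular_left[OF assms(1) loc_unimodular_transpose[OF assms(3)], of _ p])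
      (use c assms(4) in simp)
  also have "\<dots> \<longleftrightarrow> dvd_minors (\<pi> ^ m) X k"
    unfolding dvd_minors_transpose by (rule dvd_minors_loc_unimodular_left[OF assms(1,2,4)])
  finally show ?thesis .
qed

section \<open>Monomial matrices as unsorted diagonal forms\<close>

definition support :: "'b::zero mat \<Rightarrow> (nat \<times> nat) set" where
  "support D = {(i, j). i < dim_row D \<and> j < dim_col D \<and> D $$ (i, j) \<noteq> 0}"

text \<open>A diagonal form up to permutations of rows and columns. Direct sums involving
  rectangular blocks such as L_k keep this shape without any reordering.\<close>

definition monomial_mat :: "'b::zero mat \<Rightarrow> bool" where
  "monomial_mat D \<longleftrightarrow> inj_on fst (support D) \<and> inj_on snd (support D)"

lemma finite_support [simp]: "finite (support D)"
  by (rule finite_subset[of _ "{..<dim_row D} \<times> {..<dim_col D}"]) (auto simp: support_def)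

text \<open>The largest index in a set of \<open>k + 1\<close> numbers is at least \<open>k\<close>;
  induction removes it.\<close>

lemma sum_first_le_sum:
  fixes v :: "nat \<Rightarrow> nat"
  assumes "\<And>i j. i \<le> j \<Longrightarrow> j < n \<Longrightarrow> v i \<le> v j" "S \<subseteq> {..<n}" "card S = k"
  shows "(\<Sum>i<k. v i) \<le> (\<Sum>i\<in>S. v i)"
  using assms(2,3)
proof (induction k arbitrary: S)
  case (Suc k)
  have fin: "finite S" using Suc.prems finite_subset by blast
  have ne: "S \<noteq> {}" using Suc.prems by auto
  let ?m = "Max S"
  have m: "?m \<in> S" using fin ne by simp
  have "S \<subseteq> {..?m}" using fin by auto
  hence "card S \<le> card {..?m}" by (intro card_mono) auto
  hence "k \<le> ?m" using Suc.prems by simp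
  moreover have "?m < n" using m Suc.prems by auto
  ultimately have "v k \<le> v ?m" by (rule assms(1))
  moreover have "(\<Sum>i<k. v i) \<le> (\<Sum>i\<in>S - {?m}. v i)" using Suc m fin by (intro Suc.IH) auto
  ultimately show ?case using sum.remove[OF fin m, of v] by simp
qed simp

text \<open>A nonzero Leibniz term of a minor multiplies \<open>k\<close> distinct nonzero entries
  of \<open>D\<close>, so its valuation is at least the sum of the \<open>k\<close> smallest ones;
  the minor on exactly these entries is diagonal and attains the bound.\<close>

lemma monomial_dvd_minors:
  fixes D :: "'b::factorial_ring_gcd mat"
  assumes \<pi>: "prime_elem \<pi>" and mono: "monomial_mat D"
    and ys: "distinct ys" "set ys = support D"
    and sorted: "\<And>i j. i \<le> j \<Longrightarrow> j < length ys \<Longrightarrow> multiplicity \<pi> (D $$ (ys ! i)) \<le> multiplicity \<pi> (D $$ (ys ! j))"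
    and k: "k \<le> length ys"
  shows "dvd_minors (\<pi> ^ m) D k \<longleftrightarrow> m \<le> (\<Sum>i<k. multiplicity \<pi> (D $$ (ys ! i)))"
proof
  let ?v = "\<lambda>i. multiplicity \<pi> (D $$ (ys ! i))"
  have pos: "fst (ys ! i) < dim_row D" "snd (ys ! i) < dim_col D" "D $$ (ys ! i) \<noteq> 0"
    if "i < length ys" for i
  proof -
    have "ys ! i \<in> support D" using nth_mem[OF that] unfolding ys(2) .
    thus "fst (ys ! i) < dim_row D" "snd (ys ! i) < dim_col D" "D $$ (ys ! i) \<noteq> 0"
      by (cases "ys ! i"; simp add: support_def)+
  qed
  assume "dvd_minors (\<pi> ^ m) D k"
  hence "\<pi> ^ m dvd gen_minor D (\<lambda>i. fst (ys ! i)) (\<lambda>i. snd (ys ! i)) k"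
    by (rule dvd_minorsD) (use pos k in simp_all)
  also have "gen_minor D (\<lambda>i. fst (ys ! i)) (\<lambda>i. snd (ys ! i)) k = (\<Prod>i<k. D $$ (ys ! i))"
  proof -
    let ?M = "mat k k (\<lambda>(i,j). D $$ (fst (ys ! i), snd (ys ! j)))"
    \<comment> \<open>A nonzero entry here would share its row with \<open>ys ! i\<close> and its
      column with \<open>ys ! j\<close>, so it would equal both.\<close>
    have off: "D $$ (fst (ys ! i), snd (ys ! j)) = 0" if ij: "i < k" "j < k" "i \<noteq> j" for i j
    proof (rule ccontr)
      assume "D $$ (fst (ys ! i), snd (ys ! j)) \<noteq> 0"
      hence mem: "(fst (ys ! i), snd (ys ! j)) \<in> support D"
        using pos(1)[of i] pos(2)[of j] ij k unfolding support_def by simp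
      have mi: "ys ! i \<in> support D" "ys ! j \<in> support D" using ys(2) ij k nth_mem by fastforce+
      have "(fst (ys ! i), snd (ys ! j)) = ys ! i"
        using inj_onD[OF mono[unfolded monomial_mat_def, THEN conjunct1] _ mem mi(1)] by simp
      moreover have "(fst (ys ! i), snd (ys ! j)) = ys ! j"
        using inj_onD[OF mono[unfolded monomial_mat_def, THEN conjunct2] _ mem mi(2)] by simp
      ultimately show False using ij k ys(1) nth_eq_iff_index_eq[of ys i j] by simp
    qed
    have "det ?M = prod_list (diag_mat ?M)"
      by (rule det_upper_triangular[of _ k]) (use off in \<open>auto simp: upper_triangular_def\<close>)
    also have "diag_mat ?M = map (\<lambda>i. D $$ (ys ! i)) [0..<k]"
      unfolding diag_mat_def by (rule nth_equalityI) simp_all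
    also have "prod_list (map (\<lambda>i. D $$ (ys ! i)) [0..<k]) = (\<Prod>i<k. D $$ (ys ! i))"
      using prod.distinct_set_conv_list[of "[0..<k]" "\<lambda>i. D $$ (ys ! i)"] by (simp add: atLeast0LessThan)
    finally show ?thesis unfolding gen_minor_def .
  qed
  finally have d: "\<pi> ^ m dvd (\<Prod>i<k. D $$ (ys ! i))" .
  have nz: "D $$ (ys ! i) \<noteq> 0" if "i < k" for i using pos(3)[of i] that k by simp
  have "multiplicity \<pi> (\<Prod>i<k. D $$ (ys ! i)) = (\<Sum>i<k. ?v i)"
    by (rule prime_elem_multiplicity_prod_distrib[OF \<pi>]) (use nz in auto)
  moreover have "(\<Prod>i<k. D $$ (ys ! i)) \<noteq> 0" using nz by simp
  ultimately show "m \<le> (\<Sum>i<k. ?v i)"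
    using d \<pi> by (metis multiplicity_geI prime_elem_not_unit)
next
  let ?v = "\<lambda>i. multiplicity \<pi> (D $$ (ys ! i))"
  assume m: "m \<le> (\<Sum>i<k. ?v i)"
  show "dvd_minors (\<pi> ^ m) D k" unfolding dvd_minors_def
  proof (intro allI impI)
    fix f g assume fg: "\<forall>i<k. f i < dim_row D \<and> g i < dim_col D"
    show "\<pi> ^ m dvd gen_minor D f g k"
    proof (cases "inj_on f {..<k}")
      case True
      let ?M = "mat k k (\<lambda>(i,j). D $$ (f i, g j))"
      have leibniz: "\<pi> ^ m dvd (\<Prod>i = 0..<k. ?M $$ (i, p i))" if p: "p permutes {0..<k}" for p
      proof (cases "\<exists>i<k. D $$ (f i, g (p i)) = 0")
        case True
        have pk: "p i < k" if "i < k" for i using permutes_in_image[OF p, of i] that by simp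
        from True obtain i where "i < k" "?M $$ (i, p i) = 0" using pk by auto
        hence "(\<Prod>i = 0..<k. ?M $$ (i, p i)) = 0" by (intro prod_zero) auto
        thus ?thesis by (simp only: dvd_0_right)
      next
        case False
        have pk: "p i < k" if "i < k" for i using permutes_in_image[OF p, of i] that by simp
        \<comment> \<open>\<open>a i\<close> will be the position in \<open>ys\<close> of the entry
          that the permutation selects in row \<open>f i\<close>; injectivity of \<open>f\<close>
          makes these positions distinct.\<close>
        have "\<forall>i<k. \<exists>a<length ys. ys ! a = (f i, g (p i))"
        proof (intro allI impI)
          fix i assume i: "i < k"
          have "(f i, g (p i)) \<in> support D" using fg False i pk[OF i] unfolding support_def by auto
          thus "\<exists>a<length ys. ys ! a = (f i, g (p i))" using ys(2) by (metis in_set_conv_nth)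
        qed
        then obtain a where a: "\<And>i. i < k \<Longrightarrow> a i < length ys" "\<And>i. i < k \<Longrightarrow> ys ! a i = (f i, g (p i))"
          by metis
        have inj: "inj_on a {..<k}"
        proof (rule inj_onI)
          fix i j assume ij: "i \<in> {..<k}" "j \<in> {..<k}" "a i = a j"
          hence "f i = f j" using a(2)[of i] a(2)[of j] by simp
          thus "i = j" using True ij by (meson inj_onD)
        qed
        have "(\<Sum>i<k. ?v i) \<le> (\<Sum>i\<in>a ` {..<k}. ?v i)"
          by (rule sum_first_le_sum[OF sorted]) (use a(1) inj in \<open>auto simp: card_image\<close>)
        with m have "m \<le> (\<Sum>i\<in>a ` {..<k}. ?v i)" by (rule order_trans)
        also have "\<dots> = (\<Sum>i<k. ?v (a i))" using inj by (simp add: sum.reindex)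
        finally have "\<pi> ^ m dvd \<pi> ^ (\<Sum>i<k. ?v (a i))" by (rule le_imp_power_dvd)
        also have "\<dots> = (\<Prod>i<k. \<pi> ^ ?v (a i))" by (simp add: power_sum)
        also have "\<dots> dvd (\<Prod>i<k. D $$ (ys ! a i))" by (intro prod_dvd_prod multiplicity_dvd)
        also have "\<dots> = (\<Prod>i = 0..<k. ?M $$ (i, p i))"
          using a(2) pk by (intro prod.cong) auto
        finally show ?thesis .
      qed
      have "gen_minor D f g k = (\<Sum>p\<in>{p. p permutes {0..<k}}. signof p * (\<Prod>i = 0..<k. ?M $$ (i, p i)))"
        unfolding gen_minor_def by (rule det_def') simp
      also have "\<pi> ^ m dvd \<dots>" by (intro dvd_sum dvd_mult) (use leibniz in blast)
      finally show ?thesis .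
    next
      case False
      thus ?thesis using gen_minor_not_inj[OF False, of D g] by simp
    qed
  qed
qed

section \<open>Invariant factors and local Smith forms\<close>

text \<open>The bound \<open>s\<close> on the exponents also rules out a zero gcd, which every power
  of \<pi> would divide.\<close>

lemma multiplicity_det_divisor:
  fixes X :: "'b::factorial_ring_gcd mat"
  assumes \<pi>: "prime_elem \<pi>" and s: "\<And>m. dvd_minors (\<pi> ^ m) X k \<longleftrightarrow> m \<le> s"
  shows "det_divisor X k \<noteq> 0" "multiplicity \<pi> (det_divisor X k) = s"
proof -
  have iff: "\<pi> ^ m dvd det_divisor X k \<longleftrightarrow> m \<le> s" for m
    using s[of m] unfolding dvd_minors_iff det_divisor_def by (simp only: dvd_Gcd_iff)
  show "det_divisor X k \<noteq> 0"
  proof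
    assume "det_divisor X k = 0"
    thus False using iff[of "Suc s"] by simp
  qed
  show "multiplicity \<pi> (det_divisor X k) = s"
    by (rule multiplicity_eqI) (use iff[of s] iff[of "Suc s"] in simp_all)
qed

lemma det_divisor_dvd_Suc:
  fixes X :: "'b::factorial_ring_gcd mat"
  shows "det_divisor X k dvd det_divisor X (Suc k)"
proof -
  have "dvd_minors (det_divisor X k) X k" unfolding dvd_minors_iff det_divisor_def by (intro ballI Gcd_dvd)
  hence "dvd_minors (det_divisor X k) X (Suc k)" by (rule dvd_minors_Suc)
  thus ?thesis unfolding dvd_minors_iff det_divisor_def[of X "Suc k"] by (intro Gcd_greatest) simp
qed

lemma multiplicity_invariant_factor:
  fixes X :: "'b::factorial_ring_gcd mat"
  assumes \<pi>: "prime_elem \<pi>"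
    and s: "\<And>m. dvd_minors (\<pi> ^ m) X k \<longleftrightarrow> m \<le> s" "\<And>m. dvd_minors (\<pi> ^ m) X (Suc k) \<longleftrightarrow> m \<le> s + t"
  shows "multiplicity \<pi> (invariant_factor X (Suc k)) = t"
proof -
  note 0 = multiplicity_det_divisor[OF \<pi>, of X k s, OF s(1)]
  note 1 = multiplicity_det_divisor[OF \<pi>, of X "Suc k" "s + t", OF s(2)]
  obtain c where c: "det_divisor X (Suc k) = det_divisor X k * c" using det_divisor_dvd_Suc by (rule dvdE)
  have c0: "c \<noteq> 0" using 1(1) c by auto
  have "invariant_factor X (Suc k) = c" unfolding invariant_factor_def using c 0(1) by simp
  moreover have "s + t = s + multiplicity \<pi> c"
    using prime_elem_multiplicity_mult_distrib[OF \<pi> 0(1) c0] unfolding c[symmetric] 0(2) 1(2) .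
  ultimately show ?thesis by simp
qed

text \<open>With the valuations of the entries of \<open>D\<close> in increasing order, the sum of
  the first \<open>k\<close> is the valuation of the determinantal divisor of order
  \<open>k\<close>; hence the invariant factor of order \<open>k + 1\<close> has the next valuation
  in the list.\<close>

lemma card_multiplicity_invariant_factors:
  fixes X :: "'b::factorial_ring_gcd mat"
  assumes \<pi>: "prime_elem \<pi>" and X: "X \<in> carrier_mat p q"
    and PQ: "loc_unimodular \<pi> p P" "loc_unimodular \<pi> q Q" and mono: "monomial_mat (P * X * Q)"
  defines "D \<equiv> P * X * Q"
  shows "card {i \<in> {1..card (support D)}. j \<le> multiplicity \<pi> (invariant_factor X (card (support D) - i + 1))}
    = card {e \<in> support D. \<pi> ^ j dvd D $$ e}"
proof -
  let ?v = "\<lambda>e. multiplicity \<pi> (D $$ e)"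
  let ?r = "card (support D)"
  obtain xs where xs: "set xs = support D" "distinct xs"
    using finite_distinct_list[OF finite_support] by blast
  define ys where "ys = sort_key ?v xs"
  have ys: "distinct ys" "set ys = support D" "sorted (map ?v ys)" unfolding ys_def using xs by auto
  have len: "length ys = ?r" using ys(1,2) distinct_card by metis
  have srt: "?v (ys ! i) \<le> ?v (ys ! j)" if "i \<le> j" "j < length ys" for i j
    using sorted_nth_mono[OF ys(3) that(1)] that by simp
  have minors: "dvd_minors (\<pi> ^ m) X k \<longleftrightarrow> m \<le> (\<Sum>i<k. ?v (ys ! i))" if "k \<le> ?r" for m k
  proof -
    have "dvd_minors (\<pi> ^ m) D k \<longleftrightarrow> m \<le> (\<Sum>i<k. ?v (ys ! i))"
      by (rule monomial_dvd_minors[OF \<pi> mono[folded D_def] ys(1,2)]) (use srt that len in simp_all)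
    thus ?thesis unfolding D_def dvd_minors_loc_unimodular[OF \<pi> PQ X] .
  qed
  have inv: "multiplicity \<pi> (invariant_factor X (Suc k)) = ?v (ys ! k)" if "k < ?r" for k
  proof (rule multiplicity_invariant_factor[OF \<pi>, where s = "\<Sum>i<k. ?v (ys ! i)"])
    show "dvd_minors (\<pi> ^ m) X k \<longleftrightarrow> m \<le> (\<Sum>i<k. ?v (ys ! i))" for m
      using that by (intro minors) simp
    show "dvd_minors (\<pi> ^ m) X (Suc k) \<longleftrightarrow> m \<le> (\<Sum>i<k. ?v (ys ! i)) + ?v (ys ! k)" for m
      using that minors[of "Suc k" m] by simp
  qed
  \<comment> \<open>Partial multiplicities are numbered from 1 in decreasing order,
    \<open>ys\<close> from 0 in increasing order; \<open>?r - i\<close> translates between the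
    two.\<close>
  have "bij_betw (\<lambda>i. ?r - i) {i \<in> {1..?r}. j \<le> multiplicity \<pi> (invariant_factor X (?r - i + 1))}
     {a. a < length ys \<and> j \<le> ?v (ys ! a)}"
  proof (rule bij_betwI[of _ _ _ "\<lambda>a. ?r - a"])
    show "(\<lambda>i. ?r - i) \<in> {i \<in> {1..?r}. j \<le> multiplicity \<pi> (invariant_factor X (?r - i + 1))} \<rightarrow>
      {a. a < length ys \<and> j \<le> ?v (ys ! a)}"
    proof
      fix i assume i: "i \<in> {i \<in> {1..?r}. j \<le> multiplicity \<pi> (invariant_factor X (?r - i + 1))}"
      hence lt: "?r - i < ?r" by auto
      show "?r - i \<in> {a. a < length ys \<and> j \<le> ?v (ys ! a)}" using inv[OF lt] i lt len by simp
    qed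
    show "(\<lambda>a. ?r - a) \<in> {a. a < length ys \<and> j \<le> ?v (ys ! a)} \<rightarrow>
      {i \<in> {1..?r}. j \<le> multiplicity \<pi> (invariant_factor X (?r - i + 1))}"
    proof
      fix a assume a: "a \<in> {a. a < length ys \<and> j \<le> ?v (ys ! a)}"
      hence lt: "a < ?r" using len by simp
      hence "?r - (?r - a) = a" by simp
      thus "?r - a \<in> {i \<in> {1..?r}. j \<le> multiplicity \<pi> (invariant_factor X (?r - i + 1))}"
        using inv[OF lt] a lt by simp
    qed
  qed (use len in auto)
  hence "card {i \<in> {1..?r}. j \<le> multiplicity \<pi> (invariant_factor X (?r - i + 1))} =
    card {a. a < length ys \<and> j \<le> ?v (ys ! a)}" by (rule bij_betw_same_card)
  also have "\<dots> = length (filter (\<lambda>e. j \<le> ?v e) ys)" by (simp only: length_filter_conv_card)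
  also have "\<dots> = card ({e. j \<le> ?v e} \<inter> support D)" using distinct_length_filter[OF ys(1)] ys(2) by simp
  also have "{e. j \<le> ?v e} \<inter> support D = {e \<in> support D. \<pi> ^ j dvd D $$ e}"
  proof -
    have "j \<le> ?v e \<longleftrightarrow> \<pi> ^ j dvd D $$ e" if "e \<in> support D" for e
      using that power_dvd_iff_le_multiplicity[of "D $$ e" \<pi> j] \<pi> by (auto simp: support_def)
    thus ?thesis by blast
  qed
  finally show ?thesis .
qed

section \<open>Local Smith forms of matrix pairs\<close>

text \<open>\<open>h\<close> embeds the field. With \<open>h\<close>, \<open>u\<close> and \<pi>
  abstract, the same results serve F[s,t] at an arbitrary point, for the multiplicities, and F[s]
  with u = 1 and \<pi> = s, for the rank.\<close>

definition pencil_form :: "('a \<Rightarrow> 'b::comm_ring_1) \<Rightarrow> 'b \<Rightarrow> 'b \<Rightarrow> 'a mat \<Rightarrow> 'a mat \<Rightarrow> 'b mat" where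
  "pencil_form h u \<pi> M N = u \<cdot>\<^sub>m map_mat h M + \<pi> \<cdot>\<^sub>m map_mat h N"

lemma pencil_form_carrier [simp]:
  "M \<in> carrier_mat p q \<Longrightarrow> N \<in> carrier_mat p q \<Longrightarrow> pencil_form h u \<pi> M N \<in> carrier_mat p q"
  unfolding pencil_form_def by simp

text \<open>\<open>r\<close> will be the rank and \<open>g\<close> the conjugate of the
  multiplicities. At \<open>j = 0\<close> the count is \<open>r\<close>, while the formulas used for
  \<open>g\<close> on blocks have other values there in general, so only positive \<open>j\<close>
  are constrained.\<close>

definition local_smith ::
  "('a::field \<Rightarrow> 'b::factorial_ring_gcd) \<Rightarrow> 'b \<Rightarrow> 'b \<Rightarrow> 'a mat \<Rightarrow> 'a mat \<Rightarrow> nat \<Rightarrow> (nat \<Rightarrow> nat) \<Rightarrow> bool" where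
  "local_smith h u \<pi> M N r g \<longleftrightarrow> (\<exists>p q P Q D. M \<in> carrier_mat p q \<and> N \<in> carrier_mat p q \<and>
     loc_unimodular \<pi> p P \<and> loc_unimodular \<pi> q Q \<and> D = P * pencil_form h u \<pi> M N * Q \<and>
     monomial_mat D \<and> card (support D) = r \<and>
     (\<forall>j\<ge>1. card {e \<in> support D. \<pi> ^ j dvd D $$ e} = g j))"

lemma support_four_block:
  fixes D1 D2 :: "'b::zero mat"
  assumes "D1 \<in> carrier_mat p1 q1" "D2 \<in> carrier_mat p2 q2"
  defines "D \<equiv> four_block_mat D1 (0\<^sub>m p1 q2) (0\<^sub>m p2 q1) D2"
  shows "support D = support D1 \<union> (\<lambda>(i,j). (i + p1, j + q1)) ` support D2"
proof (intro subset_antisym subsetI)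
  fix e assume e: "e \<in> support D"
  obtain i j where ij: "e = (i, j)" by (cases e)
  have b: "i < p1 + p2" "j < q1 + q2" "D $$ (i, j) \<noteq> 0"
    using e assms unfolding ij support_def D_def by auto
  show "e \<in> support D1 \<union> (\<lambda>(i,j). (i + p1, j + q1)) ` support D2"
  proof (cases "i < p1")
    case True
    hence "j < q1" using b assms unfolding D_def by (cases "j < q1") auto
    hence "e \<in> support D1" using True b assms unfolding ij support_def D_def by auto
    thus ?thesis by simp
  next
    case False
    hence "\<not> j < q1" using b assms unfolding D_def by (cases "j < q1") auto
    hence "(i - p1, j - q1) \<in> support D2" using False b assms unfolding support_def D_def by auto
    moreover have "e = (\<lambda>(i,j). (i + p1, j + q1)) (i - p1, j - q1)"
      using False \<open>\<not> j < q1\<close> ij by simp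
    ultimately show ?thesis by blast
  qed
next
  fix e assume "e \<in> support D1 \<union> (\<lambda>(i,j). (i + p1, j + q1)) ` support D2"
  thus "e \<in> support D" using assms unfolding support_def D_def by auto
qed

lemma monomial_four_block:
  fixes D1 D2 :: "'b::zero mat"
  assumes D: "D1 \<in> carrier_mat p1 q1" "D2 \<in> carrier_mat p2 q2"
    and mono: "monomial_mat D1" "monomial_mat D2"
  shows "monomial_mat (four_block_mat D1 (0\<^sub>m p1 q2) (0\<^sub>m p2 q1) D2)"
proof -
  let ?sh = "\<lambda>(i,j). (i + p1, j + q1)"
  have s1: "fst e < p1 \<and> snd e < q1" if "e \<in> support D1" for e
    using that D(1) by (cases e) (simp add: support_def)
  have "inj_on fst (?sh ` support D2)" "inj_on snd (?sh ` support D2)"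
    using mono(2) unfolding monomial_mat_def inj_on_def by force+
  moreover have "fst ` support D1 \<inter> fst ` (?sh ` support D2) = {}" using s1 by force
  moreover have "snd ` support D1 \<inter> snd ` (?sh ` support D2) = {}" using s1 by force
  ultimately show ?thesis
    using mono(1) unfolding monomial_mat_def support_four_block[OF D] inj_on_Un by blast
qed

text \<open>\<open>R\<close> will be constantly true for the rank, and divisibility by a power of
  \<pi> for the multiplicities.\<close>

lemma card_support_four_block:
  fixes D1 D2 :: "'b::zero mat"
  assumes D: "D1 \<in> carrier_mat p1 q1" "D2 \<in> carrier_mat p2 q2"
  defines "D \<equiv> four_block_mat D1 (0\<^sub>m p1 q2) (0\<^sub>m p2 q1) D2"
  shows "card {e \<in> support D. R (D $$ e)} =
    card {e \<in> support D1. R (D1 $$ e)} + card {e \<in> support D2. R (D2 $$ e)}"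
proof -
  let ?sh = "\<lambda>(i,j). (i + p1, j + q1)"
  have e1: "D $$ e = D1 $$ e \<and> fst e < p1" if "e \<in> support D1" for e
    using that D by (cases e) (simp add: support_def D_def)
  have e2: "D $$ (?sh e) = D2 $$ e" if "e \<in> support D2" for e
    using that D by (cases e) (simp add: support_def D_def)
  have "{e \<in> support D. R (D $$ e)} =
    {e \<in> support D1. R (D1 $$ e)} \<union> ?sh ` {e \<in> support D2. R (D2 $$ e)}" (is "_ = ?A \<union> ?B")
  proof -
    have "{e \<in> support D. R (D $$ e)} = {e \<in> support D1. R (D $$ e)} \<union> ?sh ` {e \<in> support D2. R (D $$ ?sh e)}"
      unfolding D_def support_four_block[OF D] by blast
    also have "{e \<in> support D1. R (D $$ e)} = ?A" using e1 by auto
    also have "{e \<in> support D2. R (D $$ ?sh e)} = {e \<in> support D2. R (D2 $$ e)}"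
      using e2 by (intro Collect_cong conj_cong) simp_all
    finally show ?thesis .
  qed
  also have "card \<dots> = card ?A + card ?B"
  proof (rule card_Un_disjoint)
    show "?A \<inter> ?B = {}" using e1 by force
  qed simp_all
  also have "card ?B = card {e \<in> support D2. R (D2 $$ e)}"
    by (rule card_image) (auto simp: inj_on_def)
  finally show ?thesis .
qed

lemma mult_diag_four_block:
  fixes A1 A2 :: "'b::comm_ring_1 mat"
  assumes "A1 \<in> carrier_mat p1 n1" "A2 \<in> carrier_mat p2 n2" "B1 \<in> carrier_mat n1 q1" "B2 \<in> carrier_mat n2 q2"
  shows "four_block_mat A1 (0\<^sub>m p1 n2) (0\<^sub>m p2 n1) A2 * four_block_mat B1 (0\<^sub>m n1 q2) (0\<^sub>m n2 q1) B2
    = four_block_mat (A1 * B1) (0\<^sub>m p1 q2) (0\<^sub>m p2 q1) (A2 * B2)"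
proof -
  have "A1 * B1 \<in> carrier_mat p1 q1" "A2 * B2 \<in> carrier_mat p2 q2" using assms by auto
  thus ?thesis using assms by (subst mult_four_block_mat[OF assms(1) _ _ assms(2) assms(3) _ _ assms(4)]) simp_all
qed

lemma smult_one_four_block:
  "c \<cdot>\<^sub>m 1\<^sub>m (m + n) = four_block_mat (c \<cdot>\<^sub>m 1\<^sub>m m) (0\<^sub>m m n) (0\<^sub>m n m) (c \<cdot>\<^sub>m 1\<^sub>m n)"
  for c :: "'b::comm_ring_1"
  by (rule eq_matI) auto

lemma loc_unimodular_four_block:
  assumes \<pi>: "prime_elem \<pi>" and "loc_unimodular \<pi> m P" "loc_unimodular \<pi> n Q"
  shows "loc_unimodular \<pi> (m + n) (four_block_mat P (0\<^sub>m m n) (0\<^sub>m n m) Q)"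
proof -
  obtain P' c where P: "P \<in> carrier_mat m m" "P' \<in> carrier_mat m m" "P * P' = c \<cdot>\<^sub>m 1\<^sub>m m" "P' * P = c \<cdot>\<^sub>m 1\<^sub>m m" "\<not> \<pi> dvd c"
    using assms unfolding loc_unimodular_def scalar_inverse_def by blast
  obtain Q' d where Q: "Q \<in> carrier_mat n n" "Q' \<in> carrier_mat n n" "Q * Q' = d \<cdot>\<^sub>m 1\<^sub>m n" "Q' * Q = d \<cdot>\<^sub>m 1\<^sub>m n" "\<not> \<pi> dvd d"
    using assms unfolding loc_unimodular_def scalar_inverse_def by blast
  \<comment> \<open>The two blocks have inverses up to different scalars; scaling each by the scalar
    of the other gives the common scalar \<open>c * d\<close>.\<close>
  let ?P' = "four_block_mat (d \<cdot>\<^sub>m P') (0\<^sub>m m n) (0\<^sub>m n m) (c \<cdot>\<^sub>m Q')"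
  have c': "d \<cdot>\<^sub>m P' \<in> carrier_mat m m" "c \<cdot>\<^sub>m Q' \<in> carrier_mat n n" using P Q by auto
  have s: "d \<cdot>\<^sub>m (c \<cdot>\<^sub>m 1\<^sub>m m) = (c * d) \<cdot>\<^sub>m 1\<^sub>m m" "c \<cdot>\<^sub>m (d \<cdot>\<^sub>m 1\<^sub>m n) = (c * d) \<cdot>\<^sub>m 1\<^sub>m n"
    by (rule eq_matI; simp add: mult.commute)+
  have "four_block_mat P (0\<^sub>m m n) (0\<^sub>m n m) Q * ?P' = (c * d) \<cdot>\<^sub>m 1\<^sub>m (m + n)"
    unfolding mult_diag_four_block[OF P(1) Q(1) c'] smult_one_four_block
      mult_smult_distrib[OF P(1,2)] mult_smult_distrib[OF Q(1,2)] P(3) Q(3) s ..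
  moreover have "?P' * four_block_mat P (0\<^sub>m m n) (0\<^sub>m n m) Q = (c * d) \<cdot>\<^sub>m 1\<^sub>m (m + n)"
    unfolding mult_diag_four_block[OF c' P(1) Q(1)] smult_one_four_block
      mult_smult_assoc_mat[OF P(2,1)] mult_smult_assoc_mat[OF Q(2,1)] P(4) Q(4) s ..
  moreover have "\<not> \<pi> dvd c * d" using \<pi> P(5) Q(5) prime_elem_dvd_mult_iff by blast
  ultimately show ?thesis unfolding loc_unimodular_def scalar_inverse_def
    using P(1,2) Q(1,2) by (intro exI[of _ ?P'] exI[of _ "c * d"]) simp
qed

lemma local_smith_block:
  assumes \<pi>: "prime_elem \<pi>" and h0: "h 0 = 0"
    and "local_smith h u \<pi> M1 N1 r1 g1" "local_smith h u \<pi> M2 N2 r2 g2"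
  defines "blk \<equiv> \<lambda>A B. four_block_mat A (0\<^sub>m (dim_row A) (dim_col B)) (0\<^sub>m (dim_row B) (dim_col A)) B"
  shows "local_smith h u \<pi> (blk M1 M2) (blk N1 N2) (r1 + r2) (\<lambda>j. g1 j + g2 j)"
proof -
  obtain p1 q1 P1 Q1 D1 where 1: "M1 \<in> carrier_mat p1 q1" "N1 \<in> carrier_mat p1 q1"
    "loc_unimodular \<pi> p1 P1" "loc_unimodular \<pi> q1 Q1" "D1 = P1 * pencil_form h u \<pi> M1 N1 * Q1"
    "monomial_mat D1" "card (support D1) = r1" "\<And>j. j \<ge> 1 \<Longrightarrow> card {e \<in> support D1. \<pi> ^ j dvd D1 $$ e} = g1 j"
    using assms(3) unfolding local_smith_def by blast
  obtain p2 q2 P2 Q2 D2 where 2: "M2 \<in> carrier_mat p2 q2" "N2 \<in> carrier_mat p2 q2"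
    "loc_unimodular \<pi> p2 P2" "loc_unimodular \<pi> q2 Q2" "D2 = P2 * pencil_form h u \<pi> M2 N2 * Q2"
    "monomial_mat D2" "card (support D2) = r2" "\<And>j. j \<ge> 1 \<Longrightarrow> card {e \<in> support D2. \<pi> ^ j dvd D2 $$ e} = g2 j"
    using assms(4) unfolding local_smith_def by blast
  let ?b = "\<lambda>p1 q1 p2 q2 A B. four_block_mat A (0\<^sub>m p1 q2) (0\<^sub>m p2 q1) B"
  let ?P = "?b p1 p1 p2 p2 P1 P2" and ?Q = "?b q1 q1 q2 q2 Q1 Q2" and ?D = "?b p1 q1 p2 q2 D1 D2"
  have blk: "blk M1 M2 = ?b p1 q1 p2 q2 M1 M2" "blk N1 N2 = ?b p1 q1 p2 q2 N1 N2"
    unfolding blk_def carrier_matD[OF 1(1)] carrier_matD[OF 1(2)] carrier_matD[OF 2(1)] carrier_matD[OF 2(2)] by simp_all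
  note P1 = loc_unimodular_carrier[OF 1(3)] and Q1 = loc_unimodular_carrier[OF 1(4)]
  note P2 = loc_unimodular_carrier[OF 2(3)] and Q2 = loc_unimodular_carrier[OF 2(4)]
  let ?H1 = "pencil_form h u \<pi> M1 N1" and ?H2 = "pencil_form h u \<pi> M2 N2"
  have H: "?H1 \<in> carrier_mat p1 q1" "?H2 \<in> carrier_mat p2 q2" using 1 2 by simp_all
  have hi: "pencil_form h u \<pi> (blk M1 M2) (blk N1 N2) = ?b p1 q1 p2 q2 ?H1 ?H2"
    unfolding blk pencil_form_def by (rule eq_matI) (use 1(1,2) 2(1,2) h0 in auto)
  have D: "D1 \<in> carrier_mat p1 q1" "D2 \<in> carrier_mat p2 q2"
    unfolding 1(5) 2(5) using P1 Q1 P2 Q2 H by simp_all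
  have "?P * pencil_form h u \<pi> (blk M1 M2) (blk N1 N2) * ?Q = ?D"
    unfolding hi mult_diag_four_block[OF P1 P2 H]
      mult_diag_four_block[OF mult_carrier_mat[OF P1 H(1)] mult_carrier_mat[OF P2 H(2)] Q1 Q2] 1(5) 2(5) ..
  moreover have "loc_unimodular \<pi> (p1 + p2) ?P" "loc_unimodular \<pi> (q1 + q2) ?Q"
    using loc_unimodular_four_block[OF \<pi>] 1(3,4) 2(3,4) by blast+
  moreover have "monomial_mat ?D" by (rule monomial_four_block[OF D 1(6) 2(6)])
  moreover have "card (support ?D) = r1 + r2"
    using card_support_four_block[OF D, of "\<lambda>_. True"] 1(7) 2(7) by simp
  moreover have "card {e \<in> support ?D. \<pi> ^ j dvd ?D $$ e} = g1 j + g2 j" if "j \<ge> 1" for j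
    using card_support_four_block[OF D, of "\<lambda>x. \<pi> ^ j dvd x"] 1(8)[OF that] 2(8)[OF that] by simp
  moreover have "blk M1 M2 \<in> carrier_mat (p1 + p2) (q1 + q2)" "blk N1 N2 \<in> carrier_mat (p1 + p2) (q1 + q2)"
    unfolding blk using 1 2 by simp_all
  ultimately show ?thesis unfolding local_smith_def
    by (intro exI[of _ "p1 + p2"] exI[of _ "q1 + q2"] exI[of _ ?P] exI[of _ ?Q] exI[of _ ?D] conjI allI impI) simp_all
qed

lemma local_smith_transpose:
  assumes "local_smith h u \<pi> M N r g"
  shows "local_smith h u \<pi> M\<^sup>T N\<^sup>T r g"
proof -
  obtain p q P Q D where *: "M \<in> carrier_mat p q" "N \<in> carrier_mat p q"
    "loc_unimodular \<pi> p P" "loc_unimodular \<pi> q Q" "D = P * pencil_form h u \<pi> M N * Q"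
    "monomial_mat D" "card (support D) = r" "\<And>j. j \<ge> 1 \<Longrightarrow> card {e \<in> support D. \<pi> ^ j dvd D $$ e} = g j"
    using assms unfolding local_smith_def by blast
  let ?H = "pencil_form h u \<pi> M N"
  note P = loc_unimodular_carrier[OF *(3)] and Q = loc_unimodular_carrier[OF *(4)]
  have H: "?H \<in> carrier_mat p q" using *(1,2) by simp
  have hi: "pencil_form h u \<pi> M\<^sup>T N\<^sup>T = ?H\<^sup>T"
    unfolding pencil_form_def by (rule eq_matI) (use *(1,2) in auto)
  have "D\<^sup>T = Q\<^sup>T * (P * ?H)\<^sup>T" unfolding *(5) by (rule transpose_mult) (use P Q H in auto)
  also have "(P * ?H)\<^sup>T = ?H\<^sup>T * P\<^sup>T" by (rule transpose_mult[OF P H])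
  also have "Q\<^sup>T * (?H\<^sup>T * P\<^sup>T) = Q\<^sup>T * ?H\<^sup>T * P\<^sup>T"
    by (rule assoc_mult_mat[symmetric, of _ q q _ p _ p]) (use P Q H in auto)
  finally have D: "D\<^sup>T = Q\<^sup>T * pencil_form h u \<pi> M\<^sup>T N\<^sup>T * P\<^sup>T" unfolding hi .
  have sw: "support D\<^sup>T = prod.swap ` support D"
    unfolding support_def by (auto simp: image_iff)
  have mono: "monomial_mat D\<^sup>T"
    using *(6) unfolding monomial_mat_def sw by (auto simp: inj_on_def)
  have card: "card {e \<in> support D\<^sup>T. R (D\<^sup>T $$ e)} = card {e \<in> support D. R (D $$ e)}" for R
  proof -
    have "{e \<in> support D\<^sup>T. R (D\<^sup>T $$ e)} = prod.swap ` {e \<in> support D. R (D $$ e)}"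
      unfolding sw by (auto simp: support_def image_iff)
    thus ?thesis by (simp add: card_image)
  qed
  show ?thesis unfolding local_smith_def
    using D mono card[of "\<lambda>_. True"] card[of "\<lambda>x. \<pi> ^ _ dvd x"] *
      loc_unimodular_transpose[OF *(3)] loc_unimodular_transpose[OF *(4)]
    by (intro exI[of _ q] exI[of _ p] exI[of _ "Q\<^sup>T"] exI[of _ "P\<^sup>T"] exI[of _ "D\<^sup>T"] conjI allI impI) simp_all
qed

lemma pencil_form_mult:
  assumes h: "comm_ring_hom h"
    and c: "M \<in> carrier_mat p q" "N \<in> carrier_mat p q" "P \<in> carrier_mat p p" "Q \<in> carrier_mat q q"
  shows "pencil_form h u \<pi> (P * M * Q) (P * N * Q) = map_mat h P * pencil_form h u \<pi> M N * map_mat h Q"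
proof -
  interpret comm_ring_hom h by (rule h)
  let ?P = "map_mat h P" and ?Q = "map_mat h Q" and ?M = "map_mat h M" and ?N = "map_mat h N"
  have c': "?P \<in> carrier_mat p p" "?Q \<in> carrier_mat q q" "?M \<in> carrier_mat p q" "?N \<in> carrier_mat p q"
    using c by simp_all
  have e: "map_mat h (P * X * Q) = ?P * map_mat h X * ?Q" if "X \<in> carrier_mat p q" for X
    using mat_hom_mult[OF mult_carrier_mat[OF c(3) that] c(4)] mat_hom_mult[OF c(3) that] by simp
  have s: "?P * (a \<cdot>\<^sub>m X) * ?Q = a \<cdot>\<^sub>m (?P * X * ?Q)" if "X \<in> carrier_mat p q" for a X
    using mult_smult_distrib[OF c'(1) that] mult_smult_assoc_mat[OF mult_carrier_mat[OF c'(1) that] c'(2)] by simp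
  have "?P * (u \<cdot>\<^sub>m ?M + \<pi> \<cdot>\<^sub>m ?N) = ?P * (u \<cdot>\<^sub>m ?M) + ?P * (\<pi> \<cdot>\<^sub>m ?N)"
    by (rule mult_add_distrib_mat[OF c'(1), of _ q]) (use c' in simp_all)
  hence "?P * (u \<cdot>\<^sub>m ?M + \<pi> \<cdot>\<^sub>m ?N) * ?Q = (?P * (u \<cdot>\<^sub>m ?M) + ?P * (\<pi> \<cdot>\<^sub>m ?N)) * ?Q" by (rule arg_cong)
  also have "\<dots> = ?P * (u \<cdot>\<^sub>m ?M) * ?Q + ?P * (\<pi> \<cdot>\<^sub>m ?N) * ?Q"
    by (rule add_mult_distrib_mat[of _ p q _ _ q]) (use c' in simp_all)
  finally show ?thesis unfolding pencil_form_def e[OF c(1)] e[OF c(2)] s[OF c'(3)] s[OF c'(4)] by (rule sym)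
qed

lemma loc_unimodular_map_mat:
  assumes h: "comm_ring_hom h" and \<pi>: "prime_elem \<pi>" and P: "mutual_inverse n P P'"
  shows "loc_unimodular \<pi> n (map_mat h P)"
proof -
  interpret comm_ring_hom h by (rule h)
  have c: "P \<in> carrier_mat n n" "P' \<in> carrier_mat n n" "P * P' = 1\<^sub>m n" "P' * P = 1\<^sub>m n"
    using P unfolding mutual_inverse_def by auto
  have "map_mat h P * map_mat h P' = 1 \<cdot>\<^sub>m 1\<^sub>m n"
    unfolding mat_hom_mult[OF c(1,2), symmetric] c(3) mat_hom_one by (rule eq_matI) simp_all
  moreover have "map_mat h P' * map_mat h P = 1 \<cdot>\<^sub>m 1\<^sub>m n"
    unfolding mat_hom_mult[OF c(2,1), symmetric] c(4) mat_hom_one by (rule eq_matI) simp_all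
  moreover have "\<not> \<pi> dvd 1" using \<pi> prime_elem_not_unit by blast
  ultimately show ?thesis unfolding loc_unimodular_def scalar_inverse_def using c(1,2)
    by (intro exI[of _ "map_mat h P'"] exI[of _ 1]) simp
qed

text \<open>The constant transformations are absorbed into the local ones; \<open>D\<close> itself
  stays the same.\<close>

lemma local_smith_strict_equiv:
  assumes h: "comm_ring_hom h" and \<pi>: "prime_elem \<pi>"
    and eq: "strict_equiv p q M N M' N'" and sm: "local_smith h u \<pi> M N r g"
  shows "local_smith h u \<pi> M' N' r g"
proof -
  note c = strict_equiv_carrier[OF eq]
  obtain p' q' P Q D where *: "M \<in> carrier_mat p' q'" 
    "loc_unimodular \<pi> p' P" "loc_unimodular \<pi> q' Q" "D = P * pencil_form h u \<pi> M N * Q"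
    "monomial_mat D" "card (support D) = r" "\<And>j. j \<ge> 1 \<Longrightarrow> card {e \<in> support D. \<pi> ^ j dvd D $$ e} = g j"
    using sm unfolding local_smith_def by blast
  have pq: "p' = p" "q' = q" using *(1) c(1) by auto
  note P = loc_unimodular_carrier[OF *(2)[unfolded pq]] and Q = loc_unimodular_carrier[OF *(3)[unfolded pq]]
  obtain R R' S S' where RS: "mutual_inverse p R R'" "mutual_inverse q S S'" "M = R * M' * S" "N = R * N' * S"
    using strict_equiv_sym[OF eq] unfolding strict_equiv_def by blast
  have Rc: "R \<in> carrier_mat p p" "S \<in> carrier_mat q q" using RS(1,2) unfolding mutual_inverse_def by auto
  let ?H = "pencil_form h u \<pi> M' N'" and ?R = "map_mat h R" and ?S = "map_mat h S"
  have H: "?H \<in> carrier_mat p q" using c by simp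
  have c': "?R \<in> carrier_mat p p" "?S \<in> carrier_mat q q" using Rc by simp_all
  have "D = P * (?R * ?H * ?S) * Q" unfolding *(4) RS(3,4) pencil_form_mult[OF h c(3,4) Rc] ..
  also have "P * (?R * ?H * ?S) = P * (?R * ?H) * ?S"
    by (rule assoc_mult_mat[symmetric, of _ p p _ q _ q]) (use P c' H in simp_all)
  also have "P * (?R * ?H) = P * ?R * ?H"
    by (rule assoc_mult_mat[symmetric, of _ p p _ p _ q]) (use P c' H in simp_all)
  also have "P * ?R * ?H * ?S * Q = P * ?R * ?H * (?S * Q)"
    by (rule assoc_mult_mat[of _ p q _ q _ q]) (use P Q c' H in simp_all)
  finally have D: "D = P * ?R * ?H * (?S * Q)" .
  have "loc_unimodular \<pi> p (P * ?R)" "loc_unimodular \<pi> q (?S * Q)"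
    using loc_unimodular_mult[OF \<pi>] loc_unimodular_map_mat[OF h \<pi>] RS(1,2) *(2,3) pq by blast+
  with D c(3,4) *(5,6,7) show ?thesis unfolding local_smith_def by blast
qed

section \<open>Local Smith forms of the elementary blocks\<close>

text \<open>A factorisation through \<open>C\<close> is easier to exhibit than a left
  transformation. The adjugate of \<open>C\<close> turns it into \<open>det C\<close> times
  \<open>D\<close>, and this factor prime to \<pi> changes neither the support nor the
  valuations.\<close>

lemma local_smithI:
  assumes \<pi>: "prime_elem \<pi>" and MN: "M \<in> carrier_mat p q" "N \<in> carrier_mat p q"
    and C: "C \<in> carrier_mat p p" "\<not> \<pi> dvd det C" and Q: "loc_unimodular \<pi> q Q"
    and D: "D \<in> carrier_mat p q" "pencil_form h u \<pi> M N * Q = C * D" "monomial_mat D" "card (support D) = r"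
      "\<And>j. j \<ge> 1 \<Longrightarrow> card {e \<in> support D. \<pi> ^ j dvd D $$ e} = g j"
  shows "local_smith h u \<pi> M N r g"
proof -
  let ?c = "det C" and ?H = "pencil_form h u \<pi> M N"
  note adj = adj_mat[OF C(1)]
  note Qc = loc_unimodular_carrier[OF Q]
  have H: "?H \<in> carrier_mat p q" using MN by simp
  have lu: "loc_unimodular \<pi> p (adj_mat C)"
    unfolding loc_unimodular_def scalar_inverse_def using adj C by blast
  have c0: "?c \<noteq> 0" using C(2) by auto
  have "adj_mat C * ?H * Q = adj_mat C * (C * D)"
    unfolding D(2)[symmetric] by (rule assoc_mult_mat[OF adj(1) H Qc])
  also have "\<dots> = adj_mat C * C * D" by (rule assoc_mult_mat[OF adj(1) C(1) D(1), symmetric])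
  also have "\<dots> = ?c \<cdot>\<^sub>m D" unfolding adj(3) mult_smult_assoc_mat[OF one_carrier_mat D(1)] using D(1) by simp
  finally have e: "?c \<cdot>\<^sub>m D = adj_mat C * ?H * Q" by (rule sym)
  have sup: "support (?c \<cdot>\<^sub>m D) = support D" using c0 unfolding support_def by auto
  have ent: "\<pi> ^ j dvd (?c \<cdot>\<^sub>m D) $$ x \<longleftrightarrow> \<pi> ^ j dvd D $$ x" if "x \<in> support D" "j \<ge> 1" for x j
  proof -
    have "(?c \<cdot>\<^sub>m D) $$ x = ?c * D $$ x" using that(1) by (cases x) (simp add: support_def)
    thus ?thesis using prime_power_dvd_multD[OF \<pi>, of j ?c "D $$ x"] C(2) that(2) by auto
  qed
  have "card {x \<in> support (?c \<cdot>\<^sub>m D). \<pi> ^ j dvd (?c \<cdot>\<^sub>m D) $$ x} = g j" if "j \<ge> 1" for j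
  proof -
    have "{x \<in> support (?c \<cdot>\<^sub>m D). \<pi> ^ j dvd (?c \<cdot>\<^sub>m D) $$ x} = {x \<in> support D. \<pi> ^ j dvd D $$ x}"
      unfolding sup using ent that by blast
    thus ?thesis using D(5)[OF that] by simp
  qed
  moreover have "monomial_mat (?c \<cdot>\<^sub>m D)" using D(3) unfolding monomial_mat_def sup .
  ultimately show ?thesis unfolding local_smith_def using MN lu Q e D(4) sup
    by (intro exI[of _ p] exI[of _ q] exI[of _ "adj_mat C"] exI[of _ Q] exI[of _ "?c \<cdot>\<^sub>m D"]) simp
qed

lemma dvd_prod_add_diff:
  fixes a b :: "'i \<Rightarrow> 'b::comm_ring_1"
  assumes "finite I"
  shows "\<pi> dvd (\<Prod>i\<in>I. a i + \<pi> * b i) - (\<Prod>i\<in>I. a i)"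
  using assms
proof (induction I rule: finite_induct)
  case (insert x I)
  have "(\<Prod>i\<in>insert x I. a i + \<pi> * b i) - (\<Prod>i\<in>insert x I. a i) =
    a x * ((\<Prod>i\<in>I. a i + \<pi> * b i) - (\<Prod>i\<in>I. a i)) + \<pi> * (b x * (\<Prod>i\<in>I. a i + \<pi> * b i))"
    using insert(1,2) by (simp add: algebra_simps)
  moreover have "\<pi> dvd \<dots>" using insert(3) by (intro dvd_add dvd_mult dvd_triv_left)
  ultimately show ?case by simp
qed simp

text \<open>The Leibniz formula reduces the congruence modulo \<pi> to one for products of
  entries.\<close>

lemma dvd_det_add_diff:
  fixes A B :: "'b::comm_ring_1 mat"
  assumes A: "A \<in> carrier_mat n n" and B: "B \<in> carrier_mat n n"
  shows "\<pi> dvd det (A + \<pi> \<cdot>\<^sub>m B) - det A"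
proof -
  have AB: "A + \<pi> \<cdot>\<^sub>m B \<in> carrier_mat n n" using A B by simp
  have "det (A + \<pi> \<cdot>\<^sub>m B) - det A = (\<Sum>p\<in>{p. p permutes {0..<n}}. signof p *
    ((\<Prod>i = 0..<n. (A + \<pi> \<cdot>\<^sub>m B) $$ (i, p i)) - (\<Prod>i = 0..<n. A $$ (i, p i))))"
    unfolding det_def'[OF AB] det_def'[OF A] by (simp add: sum_subtractf right_diff_distrib)
  moreover have "\<pi> dvd \<dots>"
  proof (intro dvd_sum dvd_mult)
    fix p assume "p \<in> {p. p permutes {0..<n}}"
    hence p: "p i < n" if "i < n" for i using permutes_in_image[of p "{0..<n}" i] that by simp
    have "(\<Prod>i = 0..<n. (A + \<pi> \<cdot>\<^sub>m B) $$ (i, p i)) = (\<Prod>i = 0..<n. A $$ (i, p i) + \<pi> * B $$ (i, p i))"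
      by (rule prod.cong) (use A B p in simp_all)
    thus "\<pi> dvd (\<Prod>i = 0..<n. (A + \<pi> \<cdot>\<^sub>m B) $$ (i, p i)) - (\<Prod>i = 0..<n. A $$ (i, p i))"
      using dvd_prod_add_diff[of "{0..<n}" \<pi> "\<lambda>i. A $$ (i, p i)" "\<lambda>i. B $$ (i, p i)"] by simp
  qed
  ultimately show ?thesis by simp
qed

text \<open>Modulo \<pi> the form is \<open>u\<close> times a constant invertible matrix, so its
  determinant is prime to \<pi>. It can then serve as \<open>C\<close> itself, with the identity as
  diagonal form.\<close>

lemma local_smith_invertible:
  assumes h: "comm_ring_hom h" and \<pi>: "prime_elem \<pi>" "\<not> \<pi> dvd u"
    and M: "M \<in> carrier_mat n n" "N \<in> carrier_mat n n" "det M \<noteq> 0"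
  shows "local_smith h u \<pi> M N n (\<lambda>_. 0)"
proof -
  interpret comm_ring_hom h by (rule h)
  let ?H = "pencil_form h u \<pi> M N"
  have "h (det M) * h (inverse (det M)) = 1" unfolding hom_mult[symmetric] using M(3) by simp
  hence "h (det M) dvd 1" by (rule dvdI[OF sym])
  hence 1: "\<not> \<pi> dvd h (det M)" using \<pi>(1) prime_elem_not_unit dvd_trans by blast
  have "det (u \<cdot>\<^sub>m map_mat h M) = u ^ n * h (det M)" using carrier_matD(2)[OF M(1)] by simp
  moreover have "\<not> \<pi> dvd u ^ n" using \<pi> prime_elem_dvd_power by blast
  ultimately have "\<not> \<pi> dvd det (u \<cdot>\<^sub>m map_mat h M)" using 1 prime_elem_dvd_mult_iff[OF \<pi>(1), of "u ^ n" "h (det M)"] by metis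
  moreover have "\<pi> dvd det ?H - det (u \<cdot>\<^sub>m map_mat h M)"
    unfolding pencil_form_def by (rule dvd_det_add_diff) (use M in simp_all)
  ultimately have d: "\<not> \<pi> dvd det ?H"
    using dvd_diff[of \<pi> "det ?H" "det ?H - det (u \<cdot>\<^sub>m map_mat h M)"] by auto
  have H: "?H \<in> carrier_mat n n" using M by simp
  have sup: "support (1\<^sub>m n :: 'b mat) = (\<lambda>i. (i, i)) ` {..<n}"
    unfolding support_def by (auto simp: image_iff split: if_splits)
  show ?thesis
  proof (rule local_smithI[OF \<pi>(1) M(1,2) H d, where Q = "1\<^sub>m n" and D = "1\<^sub>m n"])
    show "loc_unimodular \<pi> n (1\<^sub>m n)"
      by (rule loc_unimodularI_det) (use \<pi>(1) prime_elem_not_unit in auto)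
    show "monomial_mat (1\<^sub>m n :: 'b mat)" unfolding monomial_mat_def sup by (auto simp: inj_on_def)
    show "card (support (1\<^sub>m n :: 'b mat)) = n" unfolding sup by (simp add: card_image inj_on_def)
    fix j :: nat assume j: "j \<ge> 1"
    have "\<not> \<pi> ^ j dvd 1" using \<pi>(1) j prime_elem_not_unit by (simp add: is_unit_power_iff)
    hence "{e \<in> support (1\<^sub>m n :: 'b mat). \<pi> ^ j dvd 1\<^sub>m n $$ e} = {}" unfolding sup by auto
    thus "card {e \<in> support (1\<^sub>m n :: 'b mat). \<pi> ^ j dvd 1\<^sub>m n $$ e} = 0" by (simp only: card.empty)
  qed (use H in simp_all)
qed

lemma not_dvd_det_lower_triangular:
  fixes A :: "'b::factorial_ring_gcd mat"
  assumes \<pi>: "prime_elem \<pi>" and A: "A \<in> carrier_mat n n"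
    and low: "\<And>i j. i < j \<Longrightarrow> j < n \<Longrightarrow> A $$ (i, j) = 0" and d: "\<And>i. i < n \<Longrightarrow> \<not> \<pi> dvd A $$ (i, i)"
  shows "\<not> \<pi> dvd det A"
proof -
  have *: "\<not> \<pi> dvd prod_list xs" if "\<And>x. x \<in> set xs \<Longrightarrow> \<not> \<pi> dvd x" for xs
    using that
  proof (induction xs)
    case Nil
    thus ?case using \<pi> prime_elem_not_unit by simp
  next
    case (Cons x xs)
    thus ?case using prime_elem_dvd_mult_iff[OF \<pi>] by simp
  qed
  have "det A = prod_list (diag_mat A)" by (rule det_lower_triangular[OF low A]) simp_all
  moreover have "\<not> \<pi> dvd x" if "x \<in> set (diag_mat A)" for x
    using that d A unfolding diag_mat_def by auto
  ultimately show ?thesis using *[of "diag_mat A"] by metis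
qed

lemma sum_two_terms:
  fixes n :: nat
  shows "(\<Sum>l = 0..<n. (if l = i then a else if l = Suc i then b else 0) * f l) =
    (if i < n then a * f i else 0) + (if Suc i < n then b * f (Suc i) else (0 :: 'b::comm_ring_1))"
proof -
  have "(\<Sum>l = 0..<n. (if l = i then a else if l = Suc i then b else 0) * f l) =
    (\<Sum>l = 0..<n. (if i = l then a * f l else 0) + (if Suc i = l then b * f l else 0))"
    by (rule sum.cong) auto
  thus ?thesis by (simp add: sum.distrib)
qed

text \<open>The first column of this matrix is a null vector of the bidiagonal matrix with
  \<pi> on the diagonal and u above it.\<close>

definition bidiag_null :: "'b::comm_ring_1 \<Rightarrow> 'b \<Rightarrow> nat \<Rightarrow> 'b mat" where
  "bidiag_null u \<pi> n = mat n n (\<lambda>(i,j). if j = 0 then (- \<pi>) ^ i * u ^ (n - 1 - i) else if i = j then 1 else 0)"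

lemma loc_unimodular_bidiag_null:
  fixes u \<pi> :: "'b::factorial_ring_gcd"
  assumes \<pi>: "prime_elem \<pi>" "\<not> \<pi> dvd u"
  shows "loc_unimodular \<pi> n (bidiag_null u \<pi> n)"
proof (rule loc_unimodularI_det)
  have "\<not> \<pi> dvd u ^ m" "\<not> \<pi> dvd 1" for m
    using \<pi> prime_elem_dvd_power prime_elem_not_unit by blast+
  thus "\<not> \<pi> dvd det (bidiag_null u \<pi> n)"
    by (intro not_dvd_det_lower_triangular[OF \<pi>(1), of _ n]) (auto simp: bidiag_null_def)
qed (simp add: bidiag_null_def)

text \<open>The null vector in the first column of \<open>?Q\<close> clears column 0 of the
  bidiagonal form \<open>?H\<close>. The other columns make up a triangular matrix with
  \<open>u\<close> on the diagonal, so all entries of the diagonal form are units.\<close>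

lemma local_smith_L:
  assumes h: "comm_ring_hom h" and \<pi>: "prime_elem \<pi>" "\<not> \<pi> dvd u"
  shows "local_smith h u \<pi> (L0 k) (L1 k) k (\<lambda>_. 0)"
proof -
  interpret comm_ring_hom h by (rule h)
  let ?H = "pencil_form h u \<pi> (L0 k) (L1 k)"
  \<comment> \<open>\<open>C\<close> consists of the columns 1 to k of \<open>?H\<close>;
    multiplication by \<open>D\<close> puts a zero column in front.\<close>
  define C where "C = mat k k (\<lambda>(i,j). if j = i then u else if i = Suc j then \<pi> else 0)"
  define D :: "'b mat" where "D = mat k (k + 1) (\<lambda>(i,j). if j = Suc i then 1 else 0)"
  let ?Q = "bidiag_null u \<pi> (k + 1)"
  have L: "(L0 k :: 'a mat) \<in> carrier_mat k (k + 1)" "(L1 k :: 'a mat) \<in> carrier_mat k (k + 1)"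
    unfolding L0_def L1_def by simp_all
  have H: "?H $$ (i, l) = (if l = i then \<pi> else if l = Suc i then u else 0)" if "i < k" "l < k + 1" for i l
    using that unfolding pencil_form_def L0_def L1_def by auto
  have Hc: "?H \<in> carrier_mat k (k + 1)" using L by simp
  have sup: "support D = (\<lambda>i. (i, Suc i)) ` {..<k}"
    unfolding support_def D_def by (auto simp: image_iff split: if_splits)
  have eq: "?H * ?Q = C * D"
  proof (rule eq_matI)
    fix i j assume "i < dim_row (C * D)" "j < dim_col (C * D)"
    hence ij: "i < k" "j < k + 1" unfolding C_def D_def by auto
    have "(?H * ?Q) $$ (i, j) = (\<Sum>l = 0..<k + 1. ?H $$ (i, l) * ?Q $$ (l, j))"
      using Hc ij by (simp add: scalar_prod_def bidiag_null_def)
    also have "\<dots> = (\<Sum>l = 0..<k + 1. (if l = i then \<pi> else if l = Suc i then u else 0) * ?Q $$ (l, j))"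
      by (rule sum.cong) (use H ij in simp_all)
    also have "\<dots> = \<pi> * ?Q $$ (i, j) + u * ?Q $$ (Suc i, j)" using ij by (subst sum_two_terms) simp
    also have "\<dots> = (if j = 0 then 0 else if j = Suc i then u else if i = j then \<pi> else 0)"
    proof (cases "j = 0")
      case True
      have "k - i = Suc (k - Suc i)" using ij by simp
      hence "u ^ (k - i) = u * u ^ (k - Suc i)" by simp
      thus ?thesis using True ij by (simp add: bidiag_null_def algebra_simps)
    qed (use ij in \<open>auto simp: bidiag_null_def\<close>)
    also have "\<dots> = (\<Sum>l = 0..<k. if l = j - 1 then (if j = 0 then 0 else C $$ (i, j - 1)) else 0)"
      using ij by (auto simp: C_def)
    also have "\<dots> = (\<Sum>l = 0..<k. C $$ (i, l) * D $$ (l, j))"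
      by (rule sum.cong) (use ij in \<open>auto simp: D_def\<close>)
    also have "\<dots> = (C * D) $$ (i, j)" using ij by (simp add: scalar_prod_def C_def D_def)
    finally show "(?H * ?Q) $$ (i, j) = (C * D) $$ (i, j)" .
  qed (use Hc in \<open>simp_all add: C_def D_def bidiag_null_def\<close>)
  show ?thesis
  proof (rule local_smithI[OF \<pi>(1) L _ _ loc_unimodular_bidiag_null[OF \<pi>] _ eq])
    show "\<not> \<pi> dvd det C"
      by (rule not_dvd_det_lower_triangular[OF \<pi>(1), of _ k]) (use \<pi>(2) in \<open>simp_all add: C_def\<close>)
    show "monomial_mat D" unfolding monomial_mat_def sup by (auto simp: inj_on_def)
    show "card (support D) = k" unfolding sup by (simp add: card_image inj_on_def)
    fix j :: nat assume j: "j \<ge> 1"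
    have "\<not> \<pi> ^ j dvd 1" using \<pi>(1) j prime_elem_not_unit by (simp add: is_unit_power_iff)
    hence "{e \<in> support D. \<pi> ^ j dvd D $$ e} = {}" unfolding sup by (auto simp: D_def)
    thus "card {e \<in> support D. \<pi> ^ j dvd D $$ e} = 0" by (simp only: card.empty)
  qed (simp_all add: C_def D_def)
qed

text \<open>As for L_k, except that the last row has no \<open>u\<close> to cancel against: column 0
  keeps the corner entry \<open>- ((- \<pi>) ^ k)\<close>, the only non-unit of the diagonal
  form.\<close>

lemma local_smith_J:
  assumes h: "comm_ring_hom h" and \<pi>: "prime_elem \<pi>" "\<not> \<pi> dvd u" and k: "k \<ge> 1"
  shows "local_smith h u \<pi> (shift_mat k) (1\<^sub>m k) k (\<lambda>j. if j \<le> k then 1 else 0)"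
proof -
  interpret comm_ring_hom h by (rule h)
  let ?H = "pencil_form h u \<pi> (shift_mat k) (1\<^sub>m k)"
  \<comment> \<open>Columns 1 to k - 1 of \<open>?H\<close>, completed by the last unit vector,
    which carries the surviving corner entry.\<close>
  define C where "C = mat k k (\<lambda>(i,j). if j = i then (if j = k - 1 then 1 else u) else if i = Suc j then \<pi> else 0)"
  define D where "D = mat k k (\<lambda>(i,j). if j = Suc i then 1 else if i = k - 1 \<and> j = 0 then - ((- \<pi>) ^ k) else 0)"
  let ?Q = "bidiag_null u \<pi> k"
  have L: "(shift_mat k :: 'a mat) \<in> carrier_mat k k" "(1\<^sub>m k :: 'a mat) \<in> carrier_mat k k"
    unfolding shift_mat_def by simp_all
  have H: "?H $$ (i, l) = (if l = i then \<pi> else if l = Suc i then u else 0)" if "i < k" "l < k" for i l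
    using that unfolding pencil_form_def shift_mat_def by auto
  have Hc: "?H \<in> carrier_mat k k" using L by simp
  have \<pi>0: "- ((- \<pi>) ^ k) \<noteq> 0" using \<pi>(1) by auto
  have sup: "support D = insert (k - 1, 0) ((\<lambda>i. (i, Suc i)) ` {..<k - 1})"
    unfolding support_def D_def using k \<pi>0 by (auto simp: image_iff split: if_splits)
  have eq: "?H * ?Q = C * D"
  proof (rule eq_matI)
    fix i j assume "i < dim_row (C * D)" "j < dim_col (C * D)"
    hence ij: "i < k" "j < k" unfolding C_def D_def by auto
    have "(?H * ?Q) $$ (i, j) = (\<Sum>l = 0..<k. ?H $$ (i, l) * ?Q $$ (l, j))"
      using Hc ij by (simp add: scalar_prod_def bidiag_null_def)
    also have "\<dots> = (\<Sum>l = 0..<k. (if l = i then \<pi> else if l = Suc i then u else 0) * ?Q $$ (l, j))"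
      by (rule sum.cong) (use H ij in simp_all)
    also have "\<dots> = \<pi> * ?Q $$ (i, j) + (if Suc i < k then u * ?Q $$ (Suc i, j) else 0)"
      using ij by (subst sum_two_terms) simp
    also have "\<dots> = (if j = 0 then (if i = k - 1 then - ((- \<pi>) ^ k) else 0)
      else if j = Suc i then u else if i = j then \<pi> else 0)"
    proof (cases "j = 0")
      case True
      show ?thesis
      proof (cases "Suc i < k")
        case lt: True
        hence "k - Suc i = Suc (k - Suc (Suc i))" by simp
        hence "u ^ (k - Suc i) = u * u ^ (k - Suc (Suc i))" by simp
        thus ?thesis using True lt by (simp add: bidiag_null_def algebra_simps)
      next
        case False
        hence "k = Suc i" using ij by simp
        thus ?thesis using True by (simp add: bidiag_null_def)
      qed
    qed (use ij in \<open>auto simp: bidiag_null_def\<close>)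
    also have "\<dots> = (\<Sum>l = 0..<k. if l = (if j = 0 then k - 1 else j - 1) then
       (if j = 0 then C $$ (i, k - 1) * - ((- \<pi>) ^ k) else C $$ (i, j - 1)) else 0)"
      using ij by (auto simp: C_def)
    also have "\<dots> = (\<Sum>l = 0..<k. C $$ (i, l) * D $$ (l, j))"
      by (rule sum.cong) (use ij in \<open>auto simp: D_def\<close>)
    also have "\<dots> = (C * D) $$ (i, j)" using ij by (simp add: scalar_prod_def C_def D_def)
    finally show "(?H * ?Q) $$ (i, j) = (C * D) $$ (i, j)" .
  qed (use Hc in \<open>simp_all add: C_def D_def bidiag_null_def\<close>)
  have unit: "\<not> \<pi> dvd 1" using \<pi>(1) prime_elem_not_unit by blast
  show ?thesis
  proof (rule local_smithI[OF \<pi>(1) L _ _ loc_unimodular_bidiag_null[OF \<pi>] _ eq])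
    show "\<not> \<pi> dvd det C"
      by (rule not_dvd_det_lower_triangular[OF \<pi>(1), of _ k]) (use \<pi>(2) unit in \<open>simp_all add: C_def\<close>)
    show "monomial_mat D" unfolding monomial_mat_def sup by (auto simp: inj_on_def)
    show "card (support D) = k" unfolding sup using k
      by (subst card_insert_disjoint) (auto simp: card_image inj_on_def)
    fix j :: nat assume j: "j \<ge> 1"
    have 1: "\<not> \<pi> ^ j dvd 1" using \<pi>(1) j prime_elem_not_unit by (simp add: is_unit_power_iff)
    have "\<pi> ^ j dvd - ((- \<pi>) ^ k) \<longleftrightarrow> \<pi> ^ j dvd \<pi> ^ k"
      by (cases "even k") (simp_all add: power_minus_odd)
    also have "\<dots> \<longleftrightarrow> j \<le> k" using \<pi>(1) unit by (subst dvd_power_iff) auto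
    finally have dvd: "\<pi> ^ j dvd - ((- \<pi>) ^ k) \<longleftrightarrow> j \<le> k" .
    have "{e \<in> support D. \<pi> ^ j dvd D $$ e} = (if j \<le> k then {(k - 1, 0)} else {})"
    proof -
      have "\<pi> ^ j dvd D $$ (k - 1, 0) \<longleftrightarrow> j \<le> k"
        using dvd k unfolding D_def by simp
      moreover have "\<not> \<pi> ^ j dvd D $$ (i, Suc i)" if "i < k - 1" for i
        using 1 that unfolding D_def by simp
      hence "{e \<in> (\<lambda>i. (i, Suc i)) ` {..<k - 1}. \<pi> ^ j dvd D $$ e} = {}" by auto
      moreover have "{e \<in> insert x S. R e} = (if R x then insert x {e \<in> S. R e} else {e \<in> S. R e})"
        for x :: "nat \<times> nat" and S R by auto
      ultimately show ?thesis unfolding sup by presburger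
    qed
    thus "card {e \<in> support D. \<pi> ^ j dvd D $$ e} = (if j \<le> k then 1 else 0)" by simp
  qed (simp_all add: C_def D_def)
qed

section \<open>Kronecker blocks\<close>

text \<open>Intertwining relations can be checked entrywise without a formula for the inverse of
  \<open>P\<close>.\<close>

lemma strict_equivI:
  fixes M N M0 N0 :: "'a::field mat"
  assumes c: "M \<in> carrier_mat p q" "N \<in> carrier_mat p q" "M0 \<in> carrier_mat p q" "N0 \<in> carrier_mat p q"
    and P: "mutual_inverse p P P'" and Q: "mutual_inverse q Q Q'"
    and e: "M * Q = P * M0" "N * Q = P * N0"
  shows "strict_equiv p q M N M0 N0"
proof -
  have Pc: "P \<in> carrier_mat p p" "P' \<in> carrier_mat p p" "P' * P = 1\<^sub>m p" "Q \<in> carrier_mat q q"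
    using P Q unfolding mutual_inverse_def by auto
  have "X0 = P' * X * Q" if "X * Q = P * X0" "X \<in> carrier_mat p q" "X0 \<in> carrier_mat p q" for X X0
  proof -
    have "P' * X * Q = P' * (P * X0)" unfolding that(1)[symmetric] using Pc that by (intro assoc_mult_mat) auto
    also have "\<dots> = P' * P * X0" using Pc that by (intro assoc_mult_mat[symmetric]) auto
    finally show ?thesis using Pc(3) that(3) by simp
  qed
  thus ?thesis unfolding strict_equiv_def using c e mutual_inverse_sym[OF P] Q by blast
qed

lemma L_carrier [simp]:
  "L0 k \<in> carrier_mat k (k + 1)" "L1 k \<in> carrier_mat k (k + 1)"
  "L0 k \<in> carrier_mat k (Suc k)" "L1 k \<in> carrier_mat k (Suc k)"
  "dim_row (L0 k) = k" "dim_col (L0 k) = Suc k" "dim_row (L1 k) = k" "dim_col (L1 k) = Suc k"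
  unfolding L0_def L1_def by simp_all

lemma shift_carrier [simp]:
  "shift_mat k \<in> carrier_mat k k" "dim_row (shift_mat k) = k" "dim_col (shift_mat k) = k"
  unfolding shift_mat_def by simp_all

text \<open>\<open>L0\<close> and \<open>L1\<close> act as shift and truncation, which turns the
  intertwining relations into identities between single entries.\<close>

lemma L_mult_left:
  fixes X :: "'a::comm_ring_1 mat"
  assumes "X \<in> carrier_mat (k + 1) n" "i < k" "j < n"
  shows "(L0 k * X) $$ (i, j) = X $$ (Suc i, j)" "(L1 k * X) $$ (i, j) = X $$ (i, j)"
proof -
  have "(\<Sum>l = 0..<Suc k. (if l = Suc i then 1 else 0) * X $$ (l, j)) = (\<Sum>l = 0..<Suc k. if Suc i = l then X $$ (l, j) else 0)"
    by (rule sum.cong) auto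
  thus "(L0 k * X) $$ (i, j) = X $$ (Suc i, j)" using assms by (simp add: L0_def scalar_prod_def)
  have "(\<Sum>l = 0..<Suc k. (if l = i then 1 else 0) * X $$ (l, j)) = (\<Sum>l = 0..<Suc k. if i = l then X $$ (l, j) else 0)"
    by (rule sum.cong) auto
  thus "(L1 k * X) $$ (i, j) = X $$ (i, j)" using assms by (simp add: L1_def scalar_prod_def)
qed

lemma L_mult_right:
  fixes X :: "'a::comm_ring_1 mat"
  assumes "X \<in> carrier_mat n k" "i < n" "j < k + 1"
  shows "(X * L0 k) $$ (i, j) = (if j = 0 then 0 else X $$ (i, j - 1))"
    "(X * L1 k) $$ (i, j) = (if j < k then X $$ (i, j) else 0)"
proof -
  have "(\<Sum>l = 0..<k. X $$ (i, l) * (if j = Suc l then 1 else 0)) =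
    (\<Sum>l = 0..<k. if j - 1 = l then (if j = 0 then 0 else X $$ (i, l)) else 0)"
    by (rule sum.cong) auto
  thus "(X * L0 k) $$ (i, j) = (if j = 0 then 0 else X $$ (i, j - 1))"
    using assms by (auto simp add: L0_def scalar_prod_def)
  have "(\<Sum>l = 0..<k. X $$ (i, l) * (if j = l then 1 else 0)) = (\<Sum>l = 0..<k. if j = l then X $$ (i, l) else 0)"
    by (rule sum.cong) auto
  thus "(X * L1 k) $$ (i, j) = (if j < k then X $$ (i, j) else 0)"
    using assms by (simp add: L1_def scalar_prod_def)
qed

section \<open>L_k at an arbitrary point\<close>

text \<open>The substitution of x + c for x in the monomial basis: row \<open>i\<close> lists the
  coefficients of the i-th power of x + c.\<close>

definition pascal :: "'a::comm_ring_1 \<Rightarrow> nat \<Rightarrow> 'a mat" where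
  "pascal c n = mat n n (\<lambda>(i,j). of_nat (i choose j) * c ^ (i - j))"

text \<open>Reversing rows and columns interchanges \<open>L0\<close> and \<open>L1\<close>, which
  exchanges the points 0 and infinity.\<close>

definition reversal :: "nat \<Rightarrow> 'a::comm_ring_1 mat" where
  "reversal n = mat n n (\<lambda>(i,j). if Suc (i + j) = n then 1 else 0)"

lemma pascal_mutual_inverse:
  fixes c :: "'a::field"
  obtains P' where "mutual_inverse n (pascal c n) P'"
proof -
  have "det (pascal c n) = prod_list (diag_mat (pascal c n))"
    by (rule det_lower_triangular[of n]) (auto simp: pascal_def binomial_eq_0)
  also have "diag_mat (pascal c n) = replicate n 1"
    unfolding diag_mat_def by (rule nth_equalityI) (auto simp: pascal_def)
  finally have "det (pascal c n) \<noteq> 0" by simp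
  thus thesis using that det_nonzero_mutual_inverse[of "pascal c n" n] by (auto simp: pascal_def)
qed

lemma reversal_mutual_inverse: "mutual_inverse n (reversal n) (reversal n :: 'a::comm_ring_1 mat)"
proof -
  have "reversal n * reversal n = (1\<^sub>m n :: 'a mat)"
  proof (rule eq_matI)
    fix i j assume ij: "i < dim_row (1\<^sub>m n :: 'a mat)" "j < dim_col (1\<^sub>m n :: 'a mat)"
    have "(reversal n * reversal n :: 'a mat) $$ (i, j) =
      (\<Sum>l = 0..<n. (if Suc (i + l) = n then 1 else 0) * (if Suc (l + j) = n then 1 else 0))"
      using ij by (simp add: reversal_def scalar_prod_def)
    also have "\<dots> = (\<Sum>l = 0..<n. if n - Suc i = l then (if i = j then 1 else 0) else 0)"
      by (rule sum.cong) (use ij in auto)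
    finally show "(reversal n * reversal n :: 'a mat) $$ (i, j) = 1\<^sub>m n $$ (i, j)" using ij by simp
  qed (simp_all add: reversal_def)
  thus ?thesis unfolding mutual_inverse_def by (simp add: reversal_def)
qed

text \<open>Pascal's rule. Truncated subtraction in an exponent does no harm, since the binomial
  coefficient beside it vanishes whenever the true difference is negative.\<close>

lemma pascal_step:
  fixes c :: "'a::comm_ring_1"
  assumes "j > 0"
  shows "of_nat (Suc i choose j) * c ^ (Suc i - j) - c * (of_nat (i choose j) * c ^ (i - j)) =
    of_nat (i choose (j - 1)) * c ^ (i - (j - 1))"
proof -
  obtain j' where j: "j = Suc j'" using assms by (cases j) auto
  consider "j \<le> i" | "j = Suc i" | "j > Suc i" by linarith
  thus ?thesis
  proof cases
    case 1
    hence "Suc i - j = Suc (i - j)" "i - j' = Suc (i - j)" using j by auto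
    thus ?thesis using j by (simp add: algebra_simps)
  qed (use j in \<open>simp_all add: binomial_eq_0\<close>)
qed

text \<open>The kernel of L_k(s) is spanned by the vector with entries (-s)^i, and expanding (-s -
  lam)^i shows that replacing s by s + lam applies the Pascal matrix with parameter
  \<open>- lam\<close> to it. So L_k is equivalent to its translates and, by reversal, to its form
  at infinity.\<close>

lemma strict_equiv_L:
  fixes \<mu> :: "'a::field ext_pt"
  shows "strict_equiv k (k + 1) (pencil_at \<mu> (L0 k) (L1 k)) (pencil_dir \<mu> (L0 k) (L1 k)) (L0 k) (L1 k)"
proof (cases \<mu>)
  case (Fin lam)
  let ?B = "\<lambda>n. pascal (- lam) n"
  obtain P' where P': "mutual_inverse k (?B k) P'" by (rule pascal_mutual_inverse)
  obtain Q' where Q': "mutual_inverse (k + 1) (?B (k + 1)) Q'" by (rule pascal_mutual_inverse)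
  have c: "?B n \<in> carrier_mat n n" for n by (simp add: pascal_def)
  have c0: "L0 k + lam \<cdot>\<^sub>m L1 k \<in> carrier_mat k (k + 1)" by simp
  have d: "(L0 k + lam \<cdot>\<^sub>m L1 k) * ?B (k + 1) = L0 k * ?B (k + 1) + lam \<cdot>\<^sub>m (L1 k * ?B (k + 1))"
    unfolding add_mult_distrib_mat[OF L_carrier(1) smult_carrier_mat[OF L_carrier(2)] c]
      mult_smult_assoc_mat[OF L_carrier(2) c] ..
  have e0: "(L0 k + lam \<cdot>\<^sub>m L1 k) * ?B (k + 1) = ?B k * L0 k"
  proof (rule eq_matI)
    fix i j assume "i < dim_row (?B k * L0 k)" "j < dim_col (?B k * L0 k)"
    hence ij: "i < k" "j < k + 1" by (simp_all add: pascal_def)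
    have "((L0 k + lam \<cdot>\<^sub>m L1 k) * ?B (k + 1)) $$ (i, j) = ?B (k + 1) $$ (Suc i, j) + lam * ?B (k + 1) $$ (i, j)"
      unfolding d using ij L_mult_left[OF c ij] by (simp add: pascal_def)
    also have "\<dots> = (if j = 0 then 0 else ?B k $$ (i, j - 1))"
    proof (cases "j = 0")
      case True
      thus ?thesis using ij by (simp add: pascal_def)
    next
      case False
      thus ?thesis using ij pascal_step[of j i "- lam"] by (simp add: pascal_def)
    qed
    also have "\<dots> = (?B k * L0 k) $$ (i, j)" using L_mult_right(1)[OF c ij] by simp
    finally show "((L0 k + lam \<cdot>\<^sub>m L1 k) * ?B (k + 1)) $$ (i, j) = (?B k * L0 k) $$ (i, j)" .
  qed (simp_all add: pascal_def)
  have e1: "L1 k * ?B (k + 1) = ?B k * L1 k"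
  proof (rule eq_matI)
    fix i j assume "i < dim_row (?B k * L1 k)" "j < dim_col (?B k * L1 k)"
    hence ij: "i < k" "j < k + 1" by (simp_all add: pascal_def)
    show "(L1 k * ?B (k + 1)) $$ (i, j) = (?B k * L1 k) $$ (i, j)"
      unfolding L_mult_left(2)[OF c ij] L_mult_right(2)[OF c ij] using ij
      by (auto simp: pascal_def binomial_eq_0)
  qed (simp_all add: pascal_def)
  show ?thesis unfolding Fin pencil_at_def pencil_dir_def ext_pt.case
    by (rule strict_equivI[OF c0 L_carrier(2) L_carrier(1) L_carrier(2) P' Q' e0 e1])
next
  case Infty
  let ?J = "\<lambda>n. reversal n :: 'a mat"
  have c: "?J n \<in> carrier_mat n n" for n by (simp add: reversal_def)
  have e0: "L1 k * ?J (k + 1) = ?J k * L0 k"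
  proof (rule eq_matI)
    fix i j assume "i < dim_row (?J k * L0 k)" "j < dim_col (?J k * L0 k)"
    hence ij: "i < k" "j < k + 1" by (simp_all add: reversal_def)
    show "(L1 k * ?J (k + 1)) $$ (i, j) = (?J k * L0 k) $$ (i, j)"
      unfolding L_mult_left(2)[OF c ij] L_mult_right(1)[OF c ij] using ij by (auto simp: reversal_def)
  qed (simp_all add: reversal_def)
  have e1: "L0 k * ?J (k + 1) = ?J k * L1 k"
  proof (rule eq_matI)
    fix i j assume "i < dim_row (?J k * L1 k)" "j < dim_col (?J k * L1 k)"
    hence ij: "i < k" "j < k + 1" by (simp_all add: reversal_def)
    show "(L0 k * ?J (k + 1)) $$ (i, j) = (?J k * L1 k) $$ (i, j)"
      unfolding L_mult_left(1)[OF c ij] L_mult_right(2)[OF c ij] using ij by (auto simp: reversal_def)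
  qed (simp_all add: reversal_def)
  show ?thesis unfolding Infty pencil_at_def pencil_dir_def ext_pt.case
    by (rule strict_equivI[OF L_carrier(2) L_carrier(1) L_carrier(1) L_carrier(2)
          reversal_mutual_inverse reversal_mutual_inverse e0 e1])
qed

section \<open>Root spaces of the elementary blocks\<close>

lemma L_mult_vec:
  fixes x :: "'a::comm_ring_1 vec"
  assumes "x \<in> carrier_vec (k + 1)" "i < k"
  shows "(L0 k *\<^sub>v x) $ i = x $ Suc i" "(L1 k *\<^sub>v x) $ i = x $ i"
proof -
  have "(\<Sum>l = 0..<Suc k. (if l = Suc i then 1 else 0) * x $ l) = (\<Sum>l = 0..<Suc k. if Suc i = l then x $ l else 0)"
    by (rule sum.cong) auto
  thus "(L0 k *\<^sub>v x) $ i = x $ Suc i" using assms by (simp add: L0_def scalar_prod_def)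
  have "(\<Sum>l = 0..<Suc k. (if l = i then 1 else 0) * x $ l) = (\<Sum>l = 0..<Suc k. if i = l then x $ l else 0)"
    by (rule sum.cong) auto
  thus "(L1 k *\<^sub>v x) $ i = x $ i" using assms by (simp add: L1_def scalar_prod_def)
qed

text \<open>The recursion reads x_(i+1) = y_i for i < k and leaves x_0 free, so each step allows one
  more coordinate until all k + 1 are reached.\<close>

lemma root_dims_L: "root_dims (L0 k) (L1 k :: 'a::field mat) (\<lambda>l. min l (k + 1))"
proof (rule root_dims_initial_segments[OF L_carrier(1) L_carrier(2)])
  fix l
  show "root_space (L0 k) (L1 k) l = {x \<in> carrier_vec (k + 1). \<forall>i<k + 1. l \<le> i \<longrightarrow> x $ i = (0 :: 'a)}"
  proof (induction l)
    case 0
    show ?case by auto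
  next
    case (Suc l)
    show ?case
    proof (intro Set.set_eqI iffI)
      fix x :: "'a vec" assume "x \<in> root_space (L0 k) (L1 k) (Suc l)"
      then obtain y where x: "x \<in> carrier_vec (k + 1)" and y: "y \<in> root_space (L0 k) (L1 k) l"
        and e: "L0 k *\<^sub>v x = L1 k *\<^sub>v y" by auto
      have y': "y \<in> carrier_vec (k + 1)" "\<And>i. i < k + 1 \<Longrightarrow> l \<le> i \<Longrightarrow> y $ i = 0" using y unfolding Suc by auto
      have "x $ i = 0" if i: "i < k + 1" "Suc l \<le> i" for i
      proof -
        obtain i' where i': "i = Suc i'" using i by (cases i) auto
        have "x $ i = (L0 k *\<^sub>v x) $ i'" using L_mult_vec(1)[OF x] i i' by simp
        also have "\<dots> = y $ i'" unfolding e using L_mult_vec(2)[OF y'(1)] i i' by simp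
        also have "\<dots> = 0" using y'(2) i i' by simp
        finally show ?thesis .
      qed
      thus "x \<in> {x \<in> carrier_vec (k + 1). \<forall>i<k + 1. Suc l \<le> i \<longrightarrow> x $ i = 0}" using x by simp
    next
      fix x :: "'a vec" assume x: "x \<in> {x \<in> carrier_vec (k + 1). \<forall>i<k + 1. Suc l \<le> i \<longrightarrow> x $ i = 0}"
      \<comment> \<open>\<open>L1\<close> does not see the last coordinate of \<open>y\<close>; the
        value 0 is admissible for every \<open>l\<close>.\<close>
      define y where "y = vec (k + 1) (\<lambda>i. if i < k then x $ Suc i else 0)"
      have yc: "y \<in> carrier_vec (k + 1)" by (simp add: y_def)
      have "y \<in> root_space (L0 k) (L1 k) l" unfolding Suc using x by (simp add: y_def)
      moreover have "L0 k *\<^sub>v x = L1 k *\<^sub>v y"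
      proof (rule eq_vecI)
        fix i assume "i < dim_vec (L1 k *\<^sub>v y)"
        hence i: "i < k" by simp
        have xc: "x \<in> carrier_vec (k + 1)" using x by simp
        show "(L0 k *\<^sub>v x) $ i = (L1 k *\<^sub>v y) $ i"
          unfolding L_mult_vec(1)[OF xc i] L_mult_vec(2)[OF yc i] using i by (simp add: y_def)
      qed simp
      moreover have "x \<in> carrier_vec (dim_col (L0 k))" using x by simp
      ultimately show "x \<in> root_space (L0 k) (L1 k) (Suc l)" unfolding root_space.simps by blast
    qed
  qed
qed

lemma shift_mult_vec:
  fixes x :: "'a::comm_ring_1 vec"
  assumes "x \<in> carrier_vec k" "i < k"
  shows "(shift_mat k *\<^sub>v x) $ i = (if Suc i < k then x $ Suc i else 0)"
proof -
  have "(\<Sum>l = 0..<k. (if l = Suc i then 1 else 0) * x $ l) = (\<Sum>l = 0..<k. if Suc i = l then x $ l else 0)"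
    by (rule sum.cong) auto
  thus ?thesis using assms by (simp add: shift_mat_def scalar_prod_def)
qed

text \<open>With the identity as \<open>N\<close> the recursion takes preimages under the shift, so
  the spaces are the kernels of its powers.\<close>

lemma root_dims_J: "root_dims (shift_mat k) (1\<^sub>m k :: 'a::field mat) (\<lambda>l. min l k)"
proof (rule root_dims_initial_segments[OF shift_carrier(1) one_carrier_mat])
  fix l
  show "root_space (shift_mat k) (1\<^sub>m k) l = {x \<in> carrier_vec k. \<forall>i<k. l \<le> i \<longrightarrow> x $ i = (0 :: 'a)}"
  proof (induction l)
    case 0
    show ?case by auto
  next
    case (Suc l)
    have "x \<in> root_space (shift_mat k) (1\<^sub>m k) (Suc l) \<longleftrightarrow> x \<in> carrier_vec k \<and> (\<forall>i<k. Suc l \<le> i \<longrightarrow> x $ i = 0)"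
      for x :: "'a vec"
    proof -
      have "x \<in> root_space (shift_mat k) (1\<^sub>m k) (Suc l) \<longleftrightarrow>
        x \<in> carrier_vec k \<and> shift_mat k *\<^sub>v x \<in> root_space (shift_mat k) (1\<^sub>m k) l"
      proof -
        have "1\<^sub>m k *\<^sub>v y = y" if "y \<in> root_space (shift_mat k) (1\<^sub>m k) l" for y :: "'a vec"
          using subsetD[OF root_space_carrier that] by simp
        thus ?thesis by auto
      qed
      also have "\<dots> \<longleftrightarrow> x \<in> carrier_vec k \<and> (\<forall>i<k. l \<le> i \<longrightarrow> (shift_mat k *\<^sub>v x) $ i = 0)"
        unfolding Suc using mult_mat_vec_carrier[OF shift_carrier(1), of x k] by auto
      also have "\<dots> \<longleftrightarrow> x \<in> carrier_vec k \<and> (\<forall>i<k. Suc l \<le> i \<longrightarrow> x $ i = 0)"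
      proof (rule conj_cong[OF refl])
        assume x: "x \<in> carrier_vec k"
        show "(\<forall>i<k. l \<le> i \<longrightarrow> (shift_mat k *\<^sub>v x) $ i = 0) \<longleftrightarrow> (\<forall>i<k. Suc l \<le> i \<longrightarrow> x $ i = 0)"
        proof
          assume *: "\<forall>i<k. l \<le> i \<longrightarrow> (shift_mat k *\<^sub>v x) $ i = 0"
          show "\<forall>i<k. Suc l \<le> i \<longrightarrow> x $ i = 0"
          proof (intro allI impI)
            fix i assume i: "i < k" "Suc l \<le> i"
            then obtain i' where i': "i = Suc i'" by (cases i) auto
            hence "(shift_mat k *\<^sub>v x) $ i' = 0" using * i by simp
            thus "x $ i = 0" using shift_mult_vec[OF x, of i'] i i' by simp
          qed
        next
          assume "\<forall>i<k. Suc l \<le> i \<longrightarrow> x $ i = 0"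
          thus "\<forall>i<k. l \<le> i \<longrightarrow> (shift_mat k *\<^sub>v x) $ i = 0" using shift_mult_vec[OF x] by simp
        qed
      qed
      finally show ?thesis .
    qed
    thus ?case by blast
  qed
qed

text \<open>Entry i + 1 of the image is x_i, so the transpose of \<open>L0\<close> is
  injective.\<close>

lemma root_dims_LT: "root_dims (L0 k)\<^sup>T ((L1 k)\<^sup>T :: 'a::field mat) (\<lambda>_. 0)"
proof (rule root_dims_injective[of _ "k + 1" k])
  fix x :: "'a vec" assume x: "x \<in> carrier_vec k" "(L0 k)\<^sup>T *\<^sub>v x = 0\<^sub>v (k + 1)"
  show "x = 0\<^sub>v k"
  proof (rule eq_vecI)
    fix i assume "i < dim_vec (0\<^sub>v k :: 'a vec)"
    hence i: "i < k" by simp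
    have "(\<Sum>l = 0..<k. (if i = l then 1 else 0) * x $ l) = (\<Sum>l = 0..<k. if i = l then x $ l else 0)"
      by (rule sum.cong) auto
    hence "((L0 k)\<^sup>T *\<^sub>v x) $ Suc i = x $ i" using x(1) i by (simp add: L0_def scalar_prod_def)
    thus "x $ i = 0\<^sub>v k $ i" using x(2) i by simp
  qed (use x in simp)
qed simp_all

lemma root_dims_invertible:
  assumes "M \<in> carrier_mat n n" "N \<in> carrier_mat n n" "det M \<noteq> 0"
  shows "root_dims M N (\<lambda>_. 0)"
proof (rule root_dims_injective[OF assms(1,2)])
  fix x assume x: "x \<in> carrier_vec n" "M *\<^sub>v x = 0\<^sub>v n"
  obtain M' where M': "mutual_inverse n M M'" by (rule det_nonzero_mutual_inverse[OF assms(1,3)])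
  show "x = 0\<^sub>v n"
    by (rule mutual_inverse_inj[OF M' x(1)]) (use x(2) mult_mat_vec_zero[OF assms(1)] in simp_all)
qed

lemma local_smith_cong:
  assumes "local_smith h u \<pi> M N r g" "\<And>j. j \<ge> 1 \<Longrightarrow> g j = g' j"
  shows "local_smith h u \<pi> M N r g'"
  using assms(1) unfolding local_smith_def using assms(2) by simp

section \<open>Numerical data of the Kronecker blocks\<close>

text \<open>The rank of the block over the rational functions, for the rectangular types as
  well.\<close>

fun kblock_size :: "'a kblock \<Rightarrow> nat" where
  "kblock_size (Lblk k) = k"
| "kblock_size (LTblk k) = k"
| "kblock_size (Jblk lam k) = k"
| "kblock_size (Nblk k) = k"

fun kblock_mult :: "'a ext_pt \<Rightarrow> 'a kblock \<Rightarrow> nat" where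
  "kblock_mult \<mu> (Jblk lam k) = (if \<mu> = Fin lam then k else 0)"
| "kblock_mult \<mu> (Nblk k) = (if \<mu> = Infty then k else 0)"
| "kblock_mult \<mu> _ = 0"

text \<open>The second equation also covers \<open>LTblk\<close>, whose multiplicity is 0.\<close>

fun kblock_root_dim :: "'a ext_pt \<Rightarrow> 'a kblock \<Rightarrow> nat \<Rightarrow> nat" where
  "kblock_root_dim \<mu> (Lblk k) l = min l (k + 1)"
| "kblock_root_dim \<mu> b l = min l (kblock_mult \<mu> b)"

lemma det_shift_plus_scalar:
  fixes a b :: "'a::comm_ring_1"
  shows "det (mat k k (\<lambda>(i,j). if j = Suc i then a else if i = j then b else 0)) = b ^ k"
proof -
  let ?M = "mat k k (\<lambda>(i,j). if j = Suc i then a else if i = j then b else 0)"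
  have "det ?M = prod_list (diag_mat ?M)"
    by (rule det_upper_triangular[of _ k]) (auto simp: upper_triangular_def)
  also have "diag_mat ?M = replicate k b" unfolding diag_mat_def by (rule nth_equalityI) auto
  finally show ?thesis by simp
qed

lemma pencil_transpose:
  "A0 \<in> carrier_mat p q \<Longrightarrow> A1 \<in> carrier_mat p q \<Longrightarrow> pencil_at \<mu> A0\<^sup>T A1\<^sup>T = (pencil_at \<mu> A0 A1)\<^sup>T"
  "pencil_dir \<mu> A0\<^sup>T A1\<^sup>T = (pencil_dir \<mu> A0 A1)\<^sup>T"
  unfolding pencil_at_def pencil_dir_def by (auto split: ext_pt.splits intro!: eq_matI)

text \<open>At a finite point a, \<open>Jblk lam k\<close> gives the shift plus (a - lam) times the
  identity and \<open>Nblk k\<close> the identity plus a times the shift, with determinants (a -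
  lam)^k and 1. At infinity they give the identity and the shift. The two rectangular types are left
  to \<open>strict_equiv_L\<close>.\<close>

lemma kblock_cases_at:
  fixes b :: "'a::field kblock" and \<mu> :: "'a ext_pt"
  assumes "kblock_ok b"
  defines "M \<equiv> pencil_at \<mu> (kblock0 b) (kblock1 b)" and "N \<equiv> pencil_dir \<mu> (kblock0 b) (kblock1 b)"
  shows "(\<exists>k. b = Lblk k) \<or> (\<exists>k. b = LTblk k) \<or>
    (kblock_mult \<mu> b = kblock_size b \<and> kblock_size b \<ge> 1 \<and> M = shift_mat (kblock_size b) \<and> N = 1\<^sub>m (kblock_size b)) \<or>
    (kblock_mult \<mu> b = 0 \<and> M \<in> carrier_mat (kblock_size b) (kblock_size b) \<and>
      N \<in> carrier_mat (kblock_size b) (kblock_size b) \<and> det M \<noteq> 0)"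
proof (cases b)
  case (Jblk lam k)
  show ?thesis
  proof (cases \<mu>)
    case (Fin a)
    have N: "N = 1\<^sub>m k" unfolding N_def pencil_dir_def Fin Jblk by simp
    have M: "M = mat k k (\<lambda>(i,j). if j = Suc i then 1 else if i = j then a - lam else 0)"
      unfolding M_def pencil_at_def Fin Jblk by (rule eq_matI) (auto simp: shift_mat_def)
    show ?thesis
    proof (cases "a = lam")
      case True
      have "M = shift_mat k" unfolding M True by (rule eq_matI) (auto simp: shift_mat_def)
      thus ?thesis using True N Fin Jblk assms(1) by simp
    next
      case False
      hence "det M \<noteq> 0" unfolding M det_shift_plus_scalar by simp
      thus ?thesis using False N Fin Jblk M by simp
    qed
  next
    case Infty
    have "M = 1\<^sub>m k" "N = shift_mat k - lam \<cdot>\<^sub>m 1\<^sub>m k"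
      unfolding M_def N_def pencil_at_def pencil_dir_def Infty Jblk by simp_all
    moreover have "shift_mat k - lam \<cdot>\<^sub>m 1\<^sub>m k \<in> carrier_mat k k" by (intro minus_carrier_mat) simp
    ultimately show ?thesis using Infty Jblk by simp
  qed
next
  case (Nblk k)
  show ?thesis
  proof (cases \<mu>)
    case (Fin a)
    have N: "N = shift_mat k" unfolding N_def pencil_dir_def Fin Nblk by simp
    have M: "M = mat k k (\<lambda>(i,j). if j = Suc i then a else if i = j then 1 else 0)"
      unfolding M_def pencil_at_def Fin Nblk by (rule eq_matI) (auto simp: shift_mat_def)
    have "det M \<noteq> 0" unfolding M det_shift_plus_scalar by simp
    thus ?thesis using N Fin Nblk M by simp
  next
    case Infty
    have "M = shift_mat k" "N = 1\<^sub>m k"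
      unfolding M_def N_def pencil_at_def pencil_dir_def Infty Nblk by simp_all
    thus ?thesis using Infty Nblk assms(1) by simp
  qed
qed simp_all

lemma root_dims_kblock:
  fixes b :: "'a::field kblock"
  assumes "kblock_ok b"
  shows "root_dims (pencil_at \<mu> (kblock0 b) (kblock1 b)) (pencil_dir \<mu> (kblock0 b) (kblock1 b)) (kblock_root_dim \<mu> b)"
proof -
  \<comment> \<open>The last two cases exclude \<open>Lblk\<close>, for which
    \<open>kblock_root_dim\<close> has an equation of its own.\<close>
  consider k where "b = Lblk k" | k where "b = LTblk k"
    | "kblock_mult \<mu> b = kblock_size b" "pencil_at \<mu> (kblock0 b) (kblock1 b) = shift_mat (kblock_size b)"
      "pencil_dir \<mu> (kblock0 b) (kblock1 b) = 1\<^sub>m (kblock_size b)" "\<And>k. b \<noteq> Lblk k"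
    | n where "kblock_mult \<mu> b = 0" "pencil_at \<mu> (kblock0 b) (kblock1 b) \<in> carrier_mat n n"
      "pencil_dir \<mu> (kblock0 b) (kblock1 b) \<in> carrier_mat n n" "det (pencil_at \<mu> (kblock0 b) (kblock1 b)) \<noteq> 0"
      "\<And>k. b \<noteq> Lblk k"
    using kblock_cases_at[OF assms, of \<mu>] by blast
  thus ?thesis
  proof cases
    case (1 k)
    have "kblock_root_dim \<mu> (Lblk k) = (\<lambda>l. min l (k + 1))" by (rule ext) simp
    thus ?thesis using root_dims_strict_equiv[OF strict_equiv_sym[OF strict_equiv_L] root_dims_L] 1 by simp
  next
    case (2 k)
    have "kblock_root_dim \<mu> (LTblk k) = (\<lambda>_. 0)" by (rule ext) simp
    thus ?thesis
      using root_dims_strict_equiv[OF strict_equiv_sym[OF strict_equiv_transpose[OF strict_equiv_L]] root_dims_LT, of \<mu> k]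
      unfolding 2 kblock0.simps kblock1.simps pencil_transpose(1)[OF L_carrier(1,2)] pencil_transpose(2) by simp
  next
    case 3
    have "kblock_root_dim \<mu> b = (\<lambda>l. min l (kblock_size b))"
      by (rule ext) (use 3(1,4) in \<open>cases b; simp\<close>)
    thus ?thesis using root_dims_J unfolding 3(2,3) by metis
  next
    case (4 n)
    have "kblock_root_dim \<mu> b = (\<lambda>_. 0)" by (rule ext) (use 4(1,5) in \<open>cases b; simp\<close>)
    thus ?thesis using root_dims_invertible[OF 4(2,3,4)] by metis
  qed
qed

lemma local_smith_kblock:
  fixes b :: "'a::field kblock"
  assumes ok: "kblock_ok b" and h: "comm_ring_hom h" and \<pi>: "prime_elem \<pi>" "\<not> \<pi> dvd u"
  shows "local_smith h u \<pi> (pencil_at \<mu> (kblock0 b) (kblock1 b)) (pencil_dir \<mu> (kblock0 b) (kblock1 b))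
    (kblock_size b) (\<lambda>j. if j \<le> kblock_mult \<mu> b then 1 else 0)"
proof -
  consider k where "b = Lblk k" | k where "b = LTblk k"
    | "kblock_mult \<mu> b = kblock_size b" "kblock_size b \<ge> 1"
      "pencil_at \<mu> (kblock0 b) (kblock1 b) = shift_mat (kblock_size b)"
      "pencil_dir \<mu> (kblock0 b) (kblock1 b) = 1\<^sub>m (kblock_size b)"
    | "kblock_mult \<mu> b = 0" "pencil_at \<mu> (kblock0 b) (kblock1 b) \<in> carrier_mat (kblock_size b) (kblock_size b)"
      "pencil_dir \<mu> (kblock0 b) (kblock1 b) \<in> carrier_mat (kblock_size b) (kblock_size b)"
      "det (pencil_at \<mu> (kblock0 b) (kblock1 b)) \<noteq> 0"
    using kblock_cases_at[OF ok, of \<mu>] by metis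
  thus ?thesis
  proof cases
    case (1 k)
    have "local_smith h u \<pi> (pencil_at \<mu> (L0 k) (L1 k)) (pencil_dir \<mu> (L0 k) (L1 k)) k (\<lambda>_. 0)"
      by (rule local_smith_strict_equiv[OF h \<pi>(1) strict_equiv_sym[OF strict_equiv_L] local_smith_L[OF h \<pi>]])
    thus ?thesis unfolding 1 kblock0.simps kblock1.simps kblock_size.simps
      by (rule local_smith_cong) simp
  next
    case (2 k)
    have "local_smith h u \<pi> (pencil_at \<mu> (L0 k) (L1 k)) (pencil_dir \<mu> (L0 k) (L1 k)) k (\<lambda>_. 0)"
      by (rule local_smith_strict_equiv[OF h \<pi>(1) strict_equiv_sym[OF strict_equiv_L] local_smith_L[OF h \<pi>]])
    from local_smith_transpose[OF this] show ?thesis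
      unfolding 2 kblock0.simps kblock1.simps kblock_size.simps pencil_transpose(1)[OF L_carrier(1,2)] pencil_transpose(2)
      by (rule local_smith_cong) simp
  next
    case 3
    show ?thesis unfolding 3(1,3,4) by (rule local_smith_J[OF h \<pi> 3(2)])
  next
    case 4
    show ?thesis by (rule local_smith_cong[OF local_smith_invertible[OF h \<pi> 4(2,3,4)]]) (use 4(1) in simp)
  qed
qed

section \<open>Kronecker canonical forms\<close>

abbreviation block2 :: "'b::zero mat \<Rightarrow> 'b mat \<Rightarrow> 'b mat" where
  "block2 A B \<equiv> four_block_mat A (0\<^sub>m (dim_row A) (dim_col B)) (0\<^sub>m (dim_row B) (dim_col A)) B"

lemma pencil_block2:
  fixes A0 A1 B0 B1 :: "'a::comm_ring_1 mat"
  assumes "A0 \<in> carrier_mat p1 q1" "A1 \<in> carrier_mat p1 q1" "B0 \<in> carrier_mat p2 q2" "B1 \<in> carrier_mat p2 q2"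
  shows "pencil_at \<mu> (block2 A0 B0) (block2 A1 B1) = block2 (pencil_at \<mu> A0 A1) (pencil_at \<mu> B0 B1)"
    "pencil_dir \<mu> (block2 A0 B0) (block2 A1 B1) = block2 (pencil_dir \<mu> A0 A1) (pencil_dir \<mu> B0 B1)"
  using assms unfolding pencil_at_def pencil_dir_def by (cases \<mu>; auto intro!: eq_matI)+

lemma kblock1_dims: "dim_row (kblock1 b) = dim_row (kblock0 b)" "dim_col (kblock1 b) = dim_col (kblock0 b)"
  by (cases b; simp)+

lemma kblock_carrier:
  "kblock0 b \<in> carrier_mat (dim_row (kblock0 b)) (dim_col (kblock0 b))"
  "kblock1 b \<in> carrier_mat (dim_row (kblock0 b)) (dim_col (kblock0 b))"
  by (rule carrier_mat_triv, rule carrier_matI[OF kblock1_dims])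

lemma kblocks_carrier:
  "diag_block_mat (map kblock0 bs) \<in> carrier_mat (dim_row (diag_block_mat (map kblock0 bs))) (dim_col (diag_block_mat (map kblock0 bs)))"
  "diag_block_mat (map kblock1 bs) \<in> carrier_mat (dim_row (diag_block_mat (map kblock0 bs))) (dim_col (diag_block_mat (map kblock0 bs)))"
proof -
  have "map dim_row (map kblock1 bs) = map dim_row (map kblock0 bs)"
    "map dim_col (map kblock1 bs) = map dim_col (map kblock0 bs)"
    by (induction bs) (simp_all add: kblock1_dims)
  thus "diag_block_mat (map kblock1 bs) \<in> carrier_mat (dim_row (diag_block_mat (map kblock0 bs))) (dim_col (diag_block_mat (map kblock0 bs)))"
    by (intro carrier_matI) (simp_all only: dim_diag_block_mat)
qed simp

lemma kblocks_invariants: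
  fixes bs :: "'a::field kblock list" and \<mu> :: "'a ext_pt" and h :: "'a \<Rightarrow> 'b::factorial_ring_gcd"
  assumes "\<forall>b\<in>set bs. kblock_ok b"
  defines "M \<equiv> pencil_at \<mu> (diag_block_mat (map kblock0 bs)) (diag_block_mat (map kblock1 bs))"
    and "N \<equiv> pencil_dir \<mu> (diag_block_mat (map kblock0 bs)) (diag_block_mat (map kblock1 bs))"
  shows "root_dims M N (\<lambda>l. \<Sum>b\<leftarrow>bs. kblock_root_dim \<mu> b l)"
    and "comm_ring_hom h \<Longrightarrow> prime_elem \<pi> \<Longrightarrow> \<not> \<pi> dvd u \<Longrightarrow>
      local_smith h u \<pi> M N (\<Sum>b\<leftarrow>bs. kblock_size b) (\<lambda>j. \<Sum>b\<leftarrow>bs. if j \<le> kblock_mult \<mu> b then 1 else 0)"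
  using assms(1) unfolding M_def N_def
proof (induction bs)
  case Nil
  let ?Z = "diag_block_mat (map kblock0 []) :: 'a mat"
  have c: "pencil_at \<mu> ?Z ?Z \<in> carrier_mat 0 0" "pencil_dir \<mu> ?Z ?Z \<in> carrier_mat 0 0" by simp_all
  \<comment> \<open>The empty matrix has determinant 1, so the empty sum counts as an invertible
    block of size 0.\<close>
  have d: "det (pencil_at \<mu> ?Z ?Z) \<noteq> 0" using det_dim_zero[OF c(1)] by simp
  {
    case 1
    show ?case using root_dims_invertible[OF c d] by simp
  next
    case 2
    thus ?case using local_smith_invertible[OF _ _ _ c d, of h \<pi> u] by simp
  }
next
  case (Cons b bs)
  let ?B0 = "diag_block_mat (map kblock0 bs)" and ?B1 = "diag_block_mat (map kblock1 bs)"
  have e: "diag_block_mat (map kblock0 (b # bs)) = block2 (kblock0 b) ?B0"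
    "diag_block_mat (map kblock1 (b # bs)) = block2 (kblock1 b) ?B1" by (simp_all add: Let_def)
  note pb = pencil_block2[OF kblock_carrier[of b] kblocks_carrier[of bs], of \<mu>]
  {
    case 1
    hence ok: "kblock_ok b" "\<forall>b\<in>set bs. kblock_ok b" by simp_all
    show ?case unfolding e pb
      using root_dims_block[OF root_dims_kblock[OF ok(1)] Cons.IH(1)[OF ok(2)]] by simp
  next
    case 2
    hence ok: "kblock_ok b" "\<forall>b\<in>set bs. kblock_ok b" by simp_all
    interpret comm_ring_hom h by (rule 2(1))
    show ?case unfolding e pb
      using local_smith_block[OF 2(2) hom_zero local_smith_kblock[OF ok(1) 2(1,2,3)] Cons.IH(2)[OF 2(1,2,3) ok(2)]] by simp
  }
qed

lemma mult_add_smult_mat: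
  fixes P X Y Q :: "'a::comm_ring_1 mat"
  assumes "P \<in> carrier_mat p p" "X \<in> carrier_mat p q" "Y \<in> carrier_mat p q" "Q \<in> carrier_mat q q"
  shows "P * (X + c \<cdot>\<^sub>m Y) * Q = P * X * Q + c \<cdot>\<^sub>m (P * Y * Q)"
proof -
  have "P * (X + c \<cdot>\<^sub>m Y) = P * X + c \<cdot>\<^sub>m (P * Y)"
    unfolding mult_add_distrib_mat[OF assms(1,2) smult_carrier_mat[OF assms(3)]] mult_smult_distrib[OF assms(1,3)] ..
  thus ?thesis
    using add_mult_distrib_mat[OF mult_carrier_mat[OF assms(1,2)] smult_carrier_mat[OF mult_carrier_mat[OF assms(1,3)]] assms(4), of c]
      mult_smult_assoc_mat[OF mult_carrier_mat[OF assms(1,3)] assms(4), of c] by simp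
qed

lemma KCF_strict_equiv:
  fixes A0 A1 :: "'a::field mat" and \<mu> :: "'a ext_pt"
  assumes A: "A0 \<in> carrier_mat p q" "A1 \<in> carrier_mat p q" and K: "is_KCF A0 A1 bs"
  defines "B0 \<equiv> diag_block_mat (map kblock0 bs)" and "B1 \<equiv> diag_block_mat (map kblock1 bs)"
  shows "strict_equiv p q (pencil_at \<mu> B0 B1) (pencil_dir \<mu> B0 B1) (pencil_at \<mu> A0 A1) (pencil_dir \<mu> A0 A1)"
    and "dim_col B0 = q"
proof -
  obtain P Q where PQ: "P \<in> carrier_mat p p" "invertible_mat P" "Q \<in> carrier_mat q q" "invertible_mat Q"
    "P * A0 * Q = B0" "P * A1 * Q = B1"
    using K A unfolding is_KCF_def B0_def B1_def by auto
  obtain P' where P': "mutual_inverse p P P'" by (rule invertible_mat_mutual_inverse[OF PQ(1,2)])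
  obtain Q' where Q': "mutual_inverse q Q Q'" by (rule invertible_mat_mutual_inverse[OF PQ(3,4)])
  show "dim_col B0 = q" unfolding PQ(5)[symmetric] using PQ(3) by simp
  have "pencil_at \<mu> B0 B1 = P * pencil_at \<mu> A0 A1 * Q" "pencil_dir \<mu> B0 B1 = P * pencil_dir \<mu> A0 A1 * Q"
    unfolding pencil_at_def pencil_dir_def PQ(5,6)[symmetric]
    by (cases \<mu>; simp add: mult_add_smult_mat[OF PQ(1) A PQ(3)])+
  hence "strict_equiv p q (pencil_at \<mu> A0 A1) (pencil_dir \<mu> A0 A1) (pencil_at \<mu> B0 B1) (pencil_dir \<mu> B0 B1)"
    unfolding strict_equiv_def using P' Q' pencil_at_carrier[OF A] by blast
  thus "strict_equiv p q (pencil_at \<mu> B0 B1) (pencil_dir \<mu> B0 B1) (pencil_at \<mu> A0 A1) (pencil_dir \<mu> A0 A1)"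
    by (rule strict_equiv_sym)
qed

section \<open>Rank over the field of fractions\<close>

lemma image_mult_has_dim:
  fixes X :: "'a::field mat"
  assumes R: "mutual_inverse p R R'" and S: "mutual_inverse q S S'" and X: "X \<in> carrier_mat p q"
    and d: "has_dim p ((\<lambda>v. (R * X * S) *\<^sub>v v) ` carrier_vec q) d"
  shows "has_dim p ((\<lambda>v. X *\<^sub>v v) ` carrier_vec q) d"
proof -
  have c: "R \<in> carrier_mat p p" "R' \<in> carrier_mat p p" "S \<in> carrier_mat q q" "S' \<in> carrier_mat q q"
    using R S unfolding mutual_inverse_def by auto
  have e: "(R * X * S) *\<^sub>v v = R *\<^sub>v (X *\<^sub>v (S *\<^sub>v v))" if "v \<in> carrier_vec q" for v
  proof -
    have "(R * X * S) *\<^sub>v v = (R * X) *\<^sub>v (S *\<^sub>v v)" by (rule assoc_mult_mat_vec[of _ p q _ q]) (use c X that in simp_all)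
    also have "\<dots> = R *\<^sub>v (X *\<^sub>v (S *\<^sub>v v))" by (rule assoc_mult_mat_vec[of _ p p _ q]) (use c X that in simp_all)
    finally show ?thesis .
  qed
  have "(\<lambda>v. X *\<^sub>v v) ` carrier_vec q = (\<lambda>v. R' *\<^sub>v v) ` ((\<lambda>v. (R * X * S) *\<^sub>v v) ` carrier_vec q)"
    unfolding image_image
  proof (intro subset_antisym subsetI)
    fix y assume "y \<in> (\<lambda>v. X *\<^sub>v v) ` carrier_vec q"
    then obtain v where v: "v \<in> carrier_vec q" "y = X *\<^sub>v v" by auto
    have "R' *\<^sub>v ((R * X * S) *\<^sub>v (S' *\<^sub>v v)) = R' *\<^sub>v (R *\<^sub>v (X *\<^sub>v v))"
      using e[of "S' *\<^sub>v v"] mutual_inverse_vec[OF S v(1)] c v(1) by simp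
    also have "\<dots> = X *\<^sub>v v" by (rule mutual_inverse_vec[OF mutual_inverse_sym[OF R]]) (use X v in simp)
    finally have "y = R' *\<^sub>v ((R * X * S) *\<^sub>v (S' *\<^sub>v v))" using v(2) by simp
    moreover have "S' *\<^sub>v v \<in> carrier_vec q" using c v by simp
    ultimately show "y \<in> (\<lambda>v. R' *\<^sub>v ((R * X * S) *\<^sub>v v)) ` carrier_vec q" by (rule image_eqI)
  next
    fix y assume "y \<in> (\<lambda>v. R' *\<^sub>v ((R * X * S) *\<^sub>v v)) ` carrier_vec q"
    then obtain v where v: "v \<in> carrier_vec q" "y = R' *\<^sub>v ((R * X * S) *\<^sub>v v)" by auto
    have "y = X *\<^sub>v (S *\<^sub>v v)" unfolding v(2) e[OF v(1)]
      by (rule mutual_inverse_vec[OF mutual_inverse_sym[OF R]]) (use X c v in simp)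
    moreover have "S *\<^sub>v v \<in> carrier_vec q" using c v by simp
    ultimately show "y \<in> (\<lambda>v. X *\<^sub>v v) ` carrier_vec q" by (rule image_eqI)
  qed
  moreover have "has_dim p ((\<lambda>v. R' *\<^sub>v v) ` ((\<lambda>v. (R * X * S) *\<^sub>v v) ` carrier_vec q)) d"
  proof (rule has_dim_mult[OF d c(2)])
    fix x assume x: "x \<in> carrier_vec p" "R' *\<^sub>v x = 0\<^sub>v p"
    show "x = 0\<^sub>v p"
      by (rule mutual_inverse_inj[OF mutual_inverse_sym[OF R] x(1)]) (use x(2) mult_mat_vec_zero[OF c(2)] in simp_all)
  qed
  ultimately show ?thesis by simp
qed

lemma image_mult_eq:
  fixes X :: "'a::field mat"
  assumes X: "X \<in> carrier_mat p q" and B: "B \<in> carrier_mat p d"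
    and ST: "S \<in> carrier_mat d q" "T \<in> carrier_mat q d" "X = B * S" "B = X * T"
  shows "(\<lambda>v. X *\<^sub>v v) ` carrier_vec q = (\<lambda>v. B *\<^sub>v v) ` carrier_vec d"
proof (intro subset_antisym subsetI)
  fix y assume "y \<in> (\<lambda>v. X *\<^sub>v v) ` carrier_vec q"
  then obtain v where v: "v \<in> carrier_vec q" "y = X *\<^sub>v v" by auto
  have "y = B *\<^sub>v (S *\<^sub>v v)" unfolding v(2) ST(3) by (rule assoc_mult_mat_vec[OF B ST(1) v(1)])
  moreover have "S *\<^sub>v v \<in> carrier_vec d" using ST(1) v by simp
  ultimately show "y \<in> (\<lambda>v. B *\<^sub>v v) ` carrier_vec d" by (rule image_eqI)
next
  fix y assume "y \<in> (\<lambda>v. B *\<^sub>v v) ` carrier_vec d"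
  then obtain v where v: "v \<in> carrier_vec d" "y = B *\<^sub>v v" by auto
  have "y = X *\<^sub>v (T *\<^sub>v v)" unfolding v(2) by (subst ST(4)) (rule assoc_mult_mat_vec[OF X ST(2) v(1)])
  moreover have "T *\<^sub>v v \<in> carrier_vec q" using ST(2) v by simp
  ultimately show "y \<in> (\<lambda>v. X *\<^sub>v v) ` carrier_vec q" by (rule image_eqI)
qed

text \<open>The nonzero columns of \<open>D\<close> form the basis \<open>B\<close>;
  \<open>T\<close> selects them and \<open>S\<close> puts them back. In the row of the nonzero entry
  number \<open>a\<close>, \<open>B\<close> has no other nonzero entry, so a kernel vector vanishes
  at \<open>a\<close>.\<close>

lemma has_dim_monomial:
  fixes D :: "'a::field mat"
  assumes D: "D \<in> carrier_mat p q" and mono: "monomial_mat D"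
  shows "has_dim p ((\<lambda>v. D *\<^sub>v v) ` carrier_vec q) (card (support D))"
proof -
  let ?d = "card (support D)"
  obtain ys where ys: "set ys = support D" "distinct ys"
    using finite_distinct_list[OF finite_support] by blast
  have len: "length ys = ?d" using ys distinct_card by metis
  have pos: "fst (ys ! a) < p" "snd (ys ! a) < q" "D $$ (fst (ys ! a), snd (ys ! a)) \<noteq> 0" if "a < ?d" for a
  proof -
    have "ys ! a \<in> support D" using nth_mem[of a ys] that len unfolding ys(1) by simp
    thus "fst (ys ! a) < p" "snd (ys ! a) < q" "D $$ (fst (ys ! a), snd (ys ! a)) \<noteq> 0"
      using D by (cases "ys ! a"; simp add: support_def)+
  qed
  have col: "\<exists>a<?d. ys ! a = (i, j)" if "i < p" "j < q" "D $$ (i, j) \<noteq> 0" for i j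
  proof -
    have "(i, j) \<in> support D" using that D unfolding support_def by simp
    thus ?thesis unfolding ys(1)[symmetric] in_set_conv_nth len by blast
  qed
  have snd_inj: "a = b" if "a < ?d" "b < ?d" "snd (ys ! a) = snd (ys ! b)" for a b
  proof -
    have mem: "ys ! a \<in> support D" "ys ! b \<in> support D"
      using nth_mem[of a ys] nth_mem[of b ys] that(1,2) unfolding len ys(1) by simp_all
    have "ys ! a = ys ! b" by (rule inj_onD[OF mono[unfolded monomial_mat_def, THEN conjunct2] that(3) mem])
    thus ?thesis using nth_eq_iff_index_eq[OF ys(2), of a b] that(1,2) len by simp
  qed
  have fst_inj: "a = b" if "a < ?d" "b < ?d" "fst (ys ! a) = fst (ys ! b)" for a b
  proof -
    have mem: "ys ! a \<in> support D" "ys ! b \<in> support D"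
      using nth_mem[of a ys] nth_mem[of b ys] that(1,2) unfolding len ys(1) by simp_all
    have "ys ! a = ys ! b" by (rule inj_onD[OF mono[unfolded monomial_mat_def, THEN conjunct1] that(3) mem])
    thus ?thesis using nth_eq_iff_index_eq[OF ys(2), of a b] that(1,2) len by simp
  qed
  define T :: "'a mat" where "T = mat q ?d (\<lambda>(j,a). if j = snd (ys ! a) then 1 else 0)"
  define S :: "'a mat" where "S = mat ?d q (\<lambda>(a,j). if j = snd (ys ! a) then 1 else 0)"
  define B where "B = mat p ?d (\<lambda>(i,a). D $$ (i, snd (ys ! a)))"
  have c: "T \<in> carrier_mat q ?d" "S \<in> carrier_mat ?d q" "B \<in> carrier_mat p ?d"
    unfolding T_def S_def B_def by simp_all
  have BT: "B = D * T"
  proof (rule eq_matI)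
    fix i a assume "i < dim_row (D * T)" "a < dim_col (D * T)"
    hence ia: "i < p" "a < ?d" using D c by auto
    have "(D * T) $$ (i, a) = (\<Sum>j = 0..<q. D $$ (i, j) * (if j = snd (ys ! a) then 1 else 0))"
      using ia D by (simp add: scalar_prod_def T_def)
    also have "\<dots> = (\<Sum>j = 0..<q. if snd (ys ! a) = j then D $$ (i, j) else 0)"
      by (rule sum.cong) auto
    also have "\<dots> = B $$ (i, a)" using ia pos(2)[of a] by (simp add: B_def)
    finally show "B $$ (i, a) = (D * T) $$ (i, a)" by simp
  qed (use D c in auto)
  have DS: "D = B * S"
  proof (rule eq_matI)
    fix i j assume "i < dim_row (B * S)" "j < dim_col (B * S)"
    hence ij: "i < p" "j < q" using c by auto
    have "(B * S) $$ (i, j) = (\<Sum>a = 0..<?d. D $$ (i, snd (ys ! a)) * (if j = snd (ys ! a) then 1 else 0))"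
      using ij by (simp add: scalar_prod_def S_def B_def)
    also have "\<dots> = (\<Sum>a = 0..<?d. if j = snd (ys ! a) then D $$ (i, j) else 0)"
      by (rule sum.cong) auto
    also have "\<dots> = D $$ (i, j)"
    proof (cases "D $$ (i, j) = 0")
      case True
      thus ?thesis by (auto intro!: sum.neutral)
    next
      case False
      then obtain a where a: "a < ?d" "ys ! a = (i, j)" using col[OF ij] by blast
      have "(\<Sum>b = 0..<?d. if j = snd (ys ! b) then D $$ (i, j) else 0) = (\<Sum>b = 0..<?d. if a = b then D $$ (i, j) else 0)"
      proof (rule sum.cong[OF refl])
        fix b assume b: "b \<in> {0..<?d}"
        have "j = snd (ys ! b) \<longleftrightarrow> a = b" using snd_inj[OF a(1), of b] a b by auto
        thus "(if j = snd (ys ! b) then D $$ (i, j) else 0) = (if a = b then D $$ (i, j) else 0)" by simp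
      qed
      thus ?thesis using a(1) by simp
    qed
    finally show "D $$ (i, j) = (B * S) $$ (i, j)" by simp
  qed (use D c in auto)
  have inj: "v = 0\<^sub>v ?d" if v: "v \<in> carrier_vec ?d" "B *\<^sub>v v = 0\<^sub>v p" for v
  proof (rule eq_vecI)
    fix a assume "a < dim_vec (0\<^sub>v ?d :: 'a vec)"
    hence a: "a < ?d" by simp
    let ?i = "fst (ys ! a)"
    have off: "D $$ (?i, snd (ys ! b)) = 0" if b: "b < ?d" "b \<noteq> a" for b
    proof (rule ccontr)
      assume "D $$ (?i, snd (ys ! b)) \<noteq> 0"
      then obtain e where e: "e < ?d" "ys ! e = (?i, snd (ys ! b))" using col pos(1)[OF a] pos(2)[OF b(1)] by blast
      have "e = a" using fst_inj[OF e(1) a] e(2) by simp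
      moreover have "e = b" using snd_inj[OF e(1) b(1)] e(2) by simp
      ultimately show False using b(2) by simp
    qed
    have "0 = (B *\<^sub>v v) $ ?i" using v(2) pos(1)[OF a] by simp
    also have "\<dots> = (\<Sum>b = 0..<?d. D $$ (?i, snd (ys ! b)) * v $ b)"
      using v(1) pos(1)[OF a] by (simp add: scalar_prod_def B_def)
    also have "\<dots> = (\<Sum>b = 0..<?d. if a = b then D $$ (?i, snd (ys ! a)) * v $ a else 0)"
      by (rule sum.cong) (use off in auto)
    also have "\<dots> = D $$ (?i, snd (ys ! a)) * v $ a" using a by simp
    finally show "v $ a = 0\<^sub>v ?d $ a" using pos(3)[OF a] a by simp
  qed (use v in simp)
  show ?thesis unfolding has_dim_def image_mult_eq[OF D c(3,2,1) DS BT] using c(3) inj by blast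
qed

text \<open>The scalar \<open>c\<close> is not divisible by \<pi>, hence nonzero; so local
  unimodularity survives as invertibility over the field of fractions.\<close>

lemma loc_unimodular_det: "loc_unimodular \<pi> n P \<Longrightarrow> det P \<noteq> 0" for P :: "'b::idom mat"
proof -
  assume "loc_unimodular \<pi> n P"
  then obtain P' c where P: "P \<in> carrier_mat n n" "P' \<in> carrier_mat n n" "P * P' = c \<cdot>\<^sub>m 1\<^sub>m n" "\<not> \<pi> dvd c"
    unfolding loc_unimodular_def scalar_inverse_def by blast
  have "det P * det P' = c ^ n" unfolding det_mult[OF P(1,2), symmetric] P(3) by simp
  moreover have "c \<noteq> 0" using P(4) by auto
  ultimately show "det P \<noteq> 0" by auto
qed

lemma comm_ring_hom_to_fract: "comm_ring_hom (to_fract :: 'b::idom \<Rightarrow> 'b fract)"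
  by unfold_locales simp_all

lemma support_to_fract: "support (map_mat to_fract D) = support D"
proof -
  have "(i < dim_row D \<and> j < dim_col D \<and> map_mat to_fract D $$ (i, j) \<noteq> 0) \<longleftrightarrow>
    (i < dim_row D \<and> j < dim_col D \<and> D $$ (i, j) \<noteq> 0)" for i j
    by (intro conj_cong refl) (simp only: index_map_mat to_fract_eq_0_iff)
  thus ?thesis unfolding support_def index_map_mat by simp
qed

lemma rank_to_fract_monomial:
  fixes X :: "'b::idom mat"
  assumes X: "X \<in> carrier_mat p q" and PQ: "loc_unimodular \<pi> p P" "loc_unimodular \<pi> q Q"
    and mono: "monomial_mat (P * X * Q)"
  shows "vec_space.rank p (map_mat to_fract X) = card (support (P * X * Q))"
proof -
  interpret comm_ring_hom "to_fract :: 'b \<Rightarrow> 'b fract" by (rule comm_ring_hom_to_fract)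
  let ?D = "P * X * Q"
  note P = loc_unimodular_carrier[OF PQ(1)] and Q = loc_unimodular_carrier[OF PQ(2)]
  have c: "map_mat to_fract P \<in> carrier_mat p p" "map_mat to_fract Q \<in> carrier_mat q q"
    "map_mat to_fract X \<in> carrier_mat p q" using P Q X by simp_all
  have d: "det (map_mat to_fract P) \<noteq> 0" "det (map_mat to_fract Q) \<noteq> 0"
    unfolding hom_det to_fract_eq_0_iff by (fact loc_unimodular_det[OF PQ(1)] loc_unimodular_det[OF PQ(2)])+
  obtain P' where P': "mutual_inverse p (map_mat to_fract P) P'"
    by (rule det_nonzero_mutual_inverse[OF c(1) d(1)])
  obtain Q' where Q': "mutual_inverse q (map_mat to_fract Q) Q'"
    by (rule det_nonzero_mutual_inverse[OF c(2) d(2)])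
  have e: "map_mat to_fract ?D = map_mat to_fract P * map_mat to_fract X * map_mat to_fract Q"
    unfolding mat_hom_mult[OF mult_carrier_mat[OF P X] Q] mat_hom_mult[OF P X] ..
  note sup = support_to_fract[of ?D]
  have D: "?D \<in> carrier_mat p q" using P X Q by simp
  have "monomial_mat (map_mat to_fract ?D)" using mono unfolding monomial_mat_def sup .
  moreover have "map_mat to_fract ?D \<in> carrier_mat p q" unfolding map_carrier_mat by (rule D)
  ultimately have "has_dim p ((\<lambda>v. map_mat to_fract ?D *\<^sub>v v) ` carrier_vec q) (card (support (map_mat to_fract ?D)))"
    by (intro has_dim_monomial)
  hence "has_dim p ((\<lambda>v. map_mat to_fract ?D *\<^sub>v v) ` carrier_vec q) (card (support ?D))"
    unfolding sup .
  hence "has_dim p ((\<lambda>v. map_mat to_fract X *\<^sub>v v) ` carrier_vec q) (card (support ?D))"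
    unfolding e by (rule image_mult_has_dim[OF P' Q' c(3)])
  thus ?thesis by (rule rank_has_dim[OF c(3)])
qed

section \<open>The prime attached to a point\<close>

text \<open>Divisibility by x - c means vanishing at c, and evaluation at c is multiplicative into a
  domain. Coefficients in F[t] and c = lam t give the form s - lam t.\<close>

lemma prime_elem_linear_monic: "prime_elem [:- c, 1:]" for c :: "'b::idom"
proof (rule prime_elemI)
  show "\<not> [:- c, 1:] dvd 1"
  proof
    assume "[:- c, 1:] dvd 1"
    hence "poly 1 c = 0" using poly_eq_0_iff_dvd[of 1 c] by blast
    thus False by simp
  qed
  fix a b assume "[:- c, 1:] dvd a * b"
  thus "[:- c, 1:] dvd a \<or> [:- c, 1:] dvd b" unfolding poly_eq_0_iff_dvd[symmetric] by simp
qed simp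

fun point_form :: "'a::comm_ring_1 ext_pt \<Rightarrow> 'a poly poly" where
  "point_form (Fin lam) = lin_form lam"
| "point_form Infty = var_t"

text \<open>\<open>point_coform\<close> and \<open>point_form\<close> are the u and \<pi> of u M +
  \<pi> N. The outer variable of the nested polynomials is s, so \<open>[:0, 1:]\<close> is
  s.\<close>

fun point_coform :: "'a::comm_ring_1 ext_pt \<Rightarrow> 'a poly poly" where
  "point_coform (Fin lam) = var_t"
| "point_coform Infty = [:0, 1:]"

lemma lin_form_alt: "lin_form lam = [:- [:0, lam:], 1:]"
  unfolding lin_form_def by (simp add: one_pCons)

lemma prime_elem_point_form: "prime_elem (point_form \<mu> :: 'a::field_gcd poly poly)"
proof (cases \<mu>)
  case (Fin lam)
  thus ?thesis by (simp only: point_form.simps lin_form_alt prime_elem_linear_monic)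
next
  case Infty
  have "prime_elem ([:0, 1:] :: 'a poly)" using prime_elem_linear_monic[of "0 :: 'a"] by simp
  thus ?thesis unfolding Infty point_form.simps var_t_def prime_elem_const_poly_iff .
qed

text \<open>Substituting lam t for s in the coform t leaves t, which is nonzero; at infinity t would
  have to divide the coefficient 1 of s.\<close>

lemma point_form_not_dvd_coform: "\<not> point_form \<mu> dvd (point_coform \<mu> :: 'a::field poly poly)"
proof (cases \<mu>)
  case (Fin lam)
  show ?thesis unfolding Fin point_form.simps point_coform.simps lin_form_alt poly_eq_0_iff_dvd[symmetric] var_t_def
    by simp
next
  case Infty
  have "\<not> [:0, 1:] dvd (1 :: 'a poly)" using poly_eq_0_iff_dvd[of "1 :: 'a poly" 0] by simp
  moreover have "coeff [:0, 1 :: 'a poly:] 1 = 1" by simp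
  ultimately show ?thesis unfolding Infty point_form.simps point_coform.simps var_t_def const_poly_dvd_iff
    by metis
qed

lemma comm_ring_hom_const2: "comm_ring_hom (\<lambda>a::'a::comm_ring_1. [:[:a:]:])"
  by unfold_locales (simp_all add: one_pCons)

lemma comm_ring_hom_const: "comm_ring_hom (\<lambda>a::'a::comm_ring_1. [:a:])"
  by unfold_locales (simp_all add: one_pCons)

text \<open>With \<mu> = Fin lam this is t A0 + s A1 = t (A0 + lam A1) + (s - lam t) A1.\<close>

lemma hom_pencil_eq:
  fixes A0 A1 :: "'a::comm_ring_1 mat"
  assumes "A0 \<in> carrier_mat p q" "A1 \<in> carrier_mat p q"
  shows "hom_pencil A0 A1 = pencil_form (\<lambda>a. [:[:a:]:]) (point_coform \<mu>) (point_form \<mu>)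
    (pencil_at \<mu> A0 A1) (pencil_dir \<mu> A0 A1)"
  using assms unfolding hom_pencil_def pencil_form_def pencil_at_def pencil_dir_def
  by (cases \<mu>; intro eq_matI) (simp_all add: lin_form_def var_t_def)

text \<open>One prime of F[s] suffices for the rank; the point 0 gives \<pi> = s and u = 1.\<close>

lemma pencil_poly_eq:
  fixes A0 A1 :: "'a::comm_ring_1 mat"
  assumes "A0 \<in> carrier_mat p q" "A1 \<in> carrier_mat p q"
  shows "pencil_poly A0 A1 = pencil_form (\<lambda>a. [:a:]) 1 [:0, 1:] (pencil_at (Fin 0) A0 A1) (pencil_dir (Fin 0) A0 A1)"
  using assms unfolding pencil_poly_def pencil_form_def pencil_at_def pencil_dir_def
  by (intro eq_matI) simp_all

section \<open>Both sides of the claim on the Kronecker form\<close>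

lemma part_mult_eq:
  "part_mult A0 A1 \<mu> i = multiplicity (point_form \<mu>) (invariant_factor (hom_pencil A0 A1) (pencil_rank A0 A1 - i + 1))"
  unfolding part_mult_def hom_inv_factor_def Let_def by (cases \<mu>) simp_all

text \<open>Local equivalences are invertible over the field of fractions, so the rank is the number
  of nonzero entries of a local Smith form at s = 0.\<close>

lemma pencil_rank_KCF:
  fixes A0 A1 :: "'a::field_gcd mat"
  assumes A: "A0 \<in> carrier_mat p q" "A1 \<in> carrier_mat p q" and K: "is_KCF A0 A1 bs"
  shows "pencil_rank A0 A1 = (\<Sum>b\<leftarrow>bs. kblock_size b)"
proof -
  have ok: "\<forall>b\<in>set bs. kblock_ok b" using K unfolding is_KCF_def by blast
  have \<pi>: "prime_elem ([:0, 1:] :: 'a poly)" using prime_elem_linear_monic[of "0 :: 'a"] by simp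
  have u: "\<not> [:0, 1:] dvd (1 :: 'a poly)" using \<pi> prime_elem_not_unit by blast
  let ?M = "pencil_at (Fin 0) A0 A1" and ?N = "pencil_dir (Fin 0) A0 A1"
  have "local_smith (\<lambda>a. [:a:]) 1 [:0, 1:] ?M ?N (\<Sum>b\<leftarrow>bs. kblock_size b)
      (\<lambda>j. \<Sum>b\<leftarrow>bs. if j \<le> kblock_mult (Fin 0) b then 1 else 0)"
    by (rule local_smith_strict_equiv[OF comm_ring_hom_const \<pi> KCF_strict_equiv(1)[OF A K]
        kblocks_invariants(2)[OF ok comm_ring_hom_const \<pi> u]])
  then obtain p' q' P Q D where *: "?M \<in> carrier_mat p' q'" "loc_unimodular [:0, 1:] p' P" "loc_unimodular [:0, 1:] q' Q"
    "D = P * pencil_poly A0 A1 * Q" "monomial_mat D" "card (support D) = (\<Sum>b\<leftarrow>bs. kblock_size b)"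
    unfolding local_smith_def pencil_poly_eq[OF A, symmetric] by blast
  have pq: "p' = p" "q' = q" using *(1) pencil_at_carrier(1)[OF A, of "Fin 0"] by auto
  have X: "pencil_poly A0 A1 \<in> carrier_mat p q" using A unfolding pencil_poly_def by simp
  show ?thesis unfolding pencil_rank_def carrier_matD(1)[OF A(1)]
    using rank_to_fract_monomial[OF X *(2,3)[unfolded pq] *(5)[unfolded *(4)]] *(6) unfolding *(4) by simp
qed

lemma wR_KCF:
  fixes A0 A1 :: "'a::field_gcd mat" and \<mu> :: "'a ext_pt"
  assumes A: "A0 \<in> carrier_mat p q" "A1 \<in> carrier_mat p q" and K: "is_KCF A0 A1 bs" and k: "k \<ge> 1"
  shows "wR A0 A1 \<mu> k = (\<Sum>b\<leftarrow>bs. if k \<le> kblock_mult \<mu> b then 1 else 0)"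
proof -
  have ok: "\<forall>b\<in>set bs. kblock_ok b" using K unfolding is_KCF_def by blast
  let ?\<pi> = "point_form \<mu>" and ?h = "\<lambda>a::'a. [:[:a:]:]"
  note \<pi> = prime_elem_point_form[of \<mu>]
  let ?M = "pencil_at \<mu> A0 A1" and ?N = "pencil_dir \<mu> A0 A1"
  have "local_smith ?h (point_coform \<mu>) ?\<pi> ?M ?N (\<Sum>b\<leftarrow>bs. kblock_size b)
      (\<lambda>j. \<Sum>b\<leftarrow>bs. if j \<le> kblock_mult \<mu> b then 1 else 0)"
    by (rule local_smith_strict_equiv[OF comm_ring_hom_const2 \<pi> KCF_strict_equiv(1)[OF A K]
        kblocks_invariants(2)[OF ok comm_ring_hom_const2 \<pi> point_form_not_dvd_coform]])
  then obtain p' q' P Q D where *: "?M \<in> carrier_mat p' q'" "loc_unimodular ?\<pi> p' P" "loc_unimodular ?\<pi> q' Q"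
    "D = P * hom_pencil A0 A1 * Q" "monomial_mat D" "card (support D) = (\<Sum>b\<leftarrow>bs. kblock_size b)"
    "\<forall>j\<ge>1. card {e \<in> support D. ?\<pi> ^ j dvd D $$ e} = (\<Sum>b\<leftarrow>bs. if j \<le> kblock_mult \<mu> b then 1 else 0)"
    unfolding local_smith_def hom_pencil_eq[OF A, symmetric] by blast
  have pq: "p' = p" "q' = q" using *(1) pencil_at_carrier(1)[OF A, of \<mu>] by auto
  have X: "hom_pencil A0 A1 \<in> carrier_mat p q" using A unfolding hom_pencil_def by simp
  \<comment> \<open>The multiplicities are numbered by means of the pencil rank, the local Smith
    form by the size of its support; both equal the sum of the block sizes.\<close>
  have rk: "pencil_rank A0 A1 = card (support (P * hom_pencil A0 A1 * Q))"
    using pencil_rank_KCF[OF A K] *(6) unfolding *(4) by simp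
  show ?thesis unfolding wR_def part_mult_eq rk
    using card_multiplicity_invariant_factors[OF \<pi> X *(2,3)[unfolded pq] *(5)[unfolded *(4)], of k]
      *(7)[rule_format, OF k] unfolding *(4) by simp
qed

text \<open>For L_k, \<open>min i (k + 1)\<close> exceeds \<open>min (i - 1) (k + 1)\<close> by one
  iff i \<le> k + 1; this is the condition \<open>i - 1 \<le> k\<close> counted by
  \<open>r (i - 1)\<close>.\<close>

lemma kblock_root_dim_diff:
  assumes "i \<ge> 1"
  shows "kblock_root_dim \<mu> b i = kblock_root_dim \<mu> b (i - 1) +
    (if i \<le> kblock_mult \<mu> b then 1 else 0) + (case b of Lblk k \<Rightarrow> if i - 1 \<le> k then 1 else 0 | _ \<Rightarrow> 0)"
  using assms by (cases b) (auto simp: min_def)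

text \<open>Only the L_k have more columns than their rank, and by exactly one, so the number of
  columns minus the rank counts these blocks for every k.\<close>

lemma kblock_dim_col: "dim_col (kblock0 b) = kblock_size b + (case b of Lblk k \<Rightarrow> 1 | _ \<Rightarrow> 0)"
  by (cases b) simp_all

theorem theorem3p8:
  fixes A0 A1 :: "'a::{alg_closed_field, field_gcd} mat"
    and p q :: nat and bs :: "'a kblock list" and \<mu> :: "'a ext_pt"
  assumes "A0 \<in> carrier_mat p q" and "A1 \<in> carrier_mat p q"
    and "is_KCF A0 A1 bs"
  defines "r \<equiv> (\<lambda>j. if j = 0 then q - pencil_rank A0 A1
                  else length (filter (\<lambda>c. c \<ge> j) (col_min_indices bs)))"
  shows "\<forall>i\<ge>1. w A0 A1 \<mu> i = wR A0 A1 \<mu> i + r (i - 1)"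
proof (intro allI impI)
  fix i :: nat assume i: "i \<ge> 1"
  note A = assms(1,2) and K = assms(3)
  have ok: "\<forall>b\<in>set bs. kblock_ok b" using K unfolding is_KCF_def by blast
  let ?f = "\<lambda>l. \<Sum>b\<leftarrow>bs. kblock_root_dim \<mu> b l"
  let ?c = "\<lambda>j b. case b of Lblk k \<Rightarrow> if j \<le> k then 1 else (0::nat) | _ \<Rightarrow> 0"
  have "root_dims (pencil_at \<mu> A0 A1) (pencil_dir \<mu> A0 A1) ?f"
    by (rule root_dims_strict_equiv[OF KCF_strict_equiv(1)[OF A K] kblocks_invariants(1)[OF ok]])
  hence w: "w A0 A1 \<mu> i = ?f i - ?f (i - 1)" by (rule w_eq_root_dims[OF A])
  have f: "?f i = ?f (i - 1) + wR A0 A1 \<mu> i + (\<Sum>b\<leftarrow>bs. ?c (i - 1) b)"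
    unfolding wR_KCF[OF A K i] sum_list_addf[symmetric]
    by (intro arg_cong[where f = sum_list] map_cong refl kblock_root_dim_diff[OF i])
  have "r j = (\<Sum>b\<leftarrow>bs. ?c j b)" for j
  proof (cases "j = 0")
    case True
    \<comment> \<open>\<open>r 0\<close> is given through the rank, not through the list of indices;
      counting columns identifies it with the number of L_k blocks, zero indices included.\<close>
    have "q = (\<Sum>b\<leftarrow>bs. dim_col (kblock0 b))"
      using KCF_strict_equiv(2)[OF A K] unfolding dim_diag_block_mat map_map comp_def by simp
    also have "\<dots> = (\<Sum>b\<leftarrow>bs. kblock_size b) + (\<Sum>b\<leftarrow>bs. ?c 0 b)"
      unfolding sum_list_addf[symmetric]
      by (intro arg_cong[where f = sum_list] map_cong refl) (simp add: kblock_dim_col split: kblock.splits)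
    finally have "q - (\<Sum>b\<leftarrow>bs. kblock_size b) = (\<Sum>b\<leftarrow>bs. ?c 0 b)" by (simp only: diff_add_inverse)
    thus ?thesis unfolding r_def pencil_rank_KCF[OF A K] True by (simp only: simp_thms if_True)
  next
    case False
    have "length (filter (\<lambda>c. c \<ge> j) (col_min_indices bs)) = (\<Sum>b\<leftarrow>bs. ?c j b)"
      unfolding col_min_indices_def by (induction bs) (simp_all split: kblock.splits)
    thus ?thesis unfolding r_def using False by simp
  qed
  \<comment> \<open>By \<open>f\<close> the truncated difference of dimensions in \<open>w\<close>
    is exact.\<close>
  thus "w A0 A1 \<mu> i = wR A0 A1 \<mu> i + r (i - 1)" unfolding w f by simp
qed

end
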